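(* Let $N\in\mathbb N$, let $U$ be a finite-dimensional complex Banach space, let $L$ be a Laurent operator in the Wiener algebra, $b\in\ell^\infty(\mathbb Z^N,L(U))$, $A=L+M_b$, and $\Sigma=\mathrm{clos}_{L(U)}\,b(\mathbb Z^N)$. If $b$ is pseudo-ergodic then, for all $p\in\{0\}\cup[1,\infty]$, $$\mathrm{spec}^p_{\rm ess}(A)=\mathrm{spec}^p(A)=\bigcup_{c\in\Sigma^{\mathbb Z^N}}\mathrm{spec}^p(L+M_c)=\bigcup_{c\in\Sigma^{\mathbb Z^N}}\mathrm{spec}^\infty_{\rm point}(L+M_c).$$
   Context: $Y^p=\ell^p(\mathbb Z^N,U)$ for $1\le p\le\infty$, $Y^0=c_0(\mathbb Z^N,U)$, with the usual norms. For $b\in\ell^\infty(\mathbb Z^N,L(U))$, $M_bx(m)=b(m)x(m)$. A Laurent operator in the Wiener algebra is $Lx(i)=\sum_{j\in\mathbb Z^N}\lambda_{i-j}x(j)$ with $\lambda_k\in L(U)$ and $\sum_{k\in\mathbb Z^N}\|\lambda_k\|<\infty$. $b$ is pseudo-ergodic if, for every $\varepsilon>0$, every finite set $S\subset\mathbb Z^N$ and every function $f:S\to\Sigma$, there is $z\in\mathbb Z^N$ with $\|f(s)-b(z+s)\|<\varepsilon$ for all $s\in S$. $\Sigma^{\mathbb Z^N}$ is the set of all functions $c:\mathbb Z^N\to\Sigma$. $\mathrm{spec}^p$, $\mathrm{spec}^p_{\rm ess}$, $\mathrm{spec}^p_{\rm point}$ denote spectrum, essential spectrum (set of $\lambda$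 with $\lambda I-A$ not Fredholm) and point spectrum (set of eigenvalues) of an operator considered on $Y^p$. *)

theory Defs
  imports "HOL-Analysis.Analysis" "HOL-Library.Function_Algebras"
begin

class complex_normed_vector = real_normed_vector +
  fixes scaleC :: "complex \<Rightarrow> 'a \<Rightarrow> 'a"  (infixr "*\<^sub>C" 75)
  assumes scaleC_add_right: "c *\<^sub>C (x + y) = c *\<^sub>C x + c *\<^sub>C y"
    and scaleC_add_left: "(c + d) *\<^sub>C x = c *\<^sub>C x + d *\<^sub>C x"
    and scaleC_scaleC: "c *\<^sub>C d *\<^sub>C x = (c * d) *\<^sub>C x"
    and scaleC_of_real: "complex_of_real r *\<^sub>C x = r *\<^sub>R x"
    and norm_scaleC: "norm (c *\<^sub>C x) = cmod c * norm x"

instantiation complex :: complex_normed_vector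
begin
definition "scaleC_complex = ((*) :: complex \<Rightarrow> complex \<Rightarrow> complex)"
instance
  by standard (auto simp: scaleC_complex_def algebra_simps norm_mult scaleR_conv_of_real)
end

interpretation cvec: vector_space "scaleC :: complex \<Rightarrow> 'u \<Rightarrow> 'u::complex_normed_vector"
  by standard (use scaleC_of_real[of 1] in
      \<open>auto simp: scaleC_add_right scaleC_add_left scaleC_scaleC\<close>)

text \<open>Addition and zero of functions are pointwise, from \<^theory>\<open>HOL-Library.Function_Algebras\<close>.\<close>

definition scaleF :: "complex \<Rightarrow> ('i \<Rightarrow> 'u) \<Rightarrow> 'i \<Rightarrow> 'u::complex_normed_vector"
  where "scaleF c x = (\<lambda>i. c *\<^sub>C x i)"

interpretation cfun: vector_space "scaleF :: complex \<Rightarrow> ('i \<Rightarrow> 'u) \<Rightarrow> 'i \<Rightarrow> 'u::complex_normed_vector"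
  by standard (use scaleC_of_real[of 1] in
      \<open>auto simp: scaleF_def fun_eq_iff scaleC_add_right scaleC_add_left scaleC_scaleC\<close>)

text \<open>The library type of bounded operators consists of the real-linear ones; the algebra
  \<open>L(U)\<close> of a complex space is the following closed subset, with the same operator norm.\<close>

definition clin_ops :: "('u::complex_normed_vector \<Rightarrow>\<^sub>L 'u) set"
  where "clin_ops = {T. \<forall>c x. blinfun_apply T (c *\<^sub>C x) = c *\<^sub>C blinfun_apply T x}"

text \<open>The exponent \<open>p = 0\<close> stands for \<open>c\<^sub>0\<close>. As index set, \<open>\<int>\<^sup>N\<close> is the type
  \<open>int ^ 'n\<close>; a sequence tends to zero at infinity iff each set of indices where its norm
  is at least \<open>\<epsilon> > 0\<close> is finite.\<close>

definition Y :: "ereal \<Rightarrow> (int ^ 'n::finite \<Rightarrow> 'u::real_normed_vector) set"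
  where "Y p =
    (if p = 0 then {x. \<forall>\<epsilon>>0. finite {m. norm (x m) \<ge> \<epsilon>}}
     else if p = \<infinity> then {x. bounded (range x)}
     else {x. (\<lambda>m. norm (x m) powr real_of_ereal p) summable_on UNIV})"

definition normY :: "ereal \<Rightarrow> (int ^ 'n::finite \<Rightarrow> 'u::real_normed_vector) \<Rightarrow> real"
  where "normY p x =
    (if p = 0 \<or> p = \<infinity> then (SUP m. norm (x m))
     else (\<Sum>\<^sub>\<infinity>m. norm (x m) powr real_of_ereal p) powr (1 / real_of_ereal p))"

type_synonym ('n, 'u) seq_op = "(int ^ 'n \<Rightarrow> 'u) \<Rightarrow> int ^ 'n \<Rightarrow> 'u"

definition bounded_op :: "ereal \<Rightarrow> ('n::finite, 'u::complex_normed_vector) seq_op \<Rightarrow> bool"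
  where "bounded_op p T \<longleftrightarrow>
    T ` Y p \<subseteq> Y p \<and>
    (\<forall>x\<in>Y p. \<forall>y\<in>Y p. T (x + y) = T x + T y) \<and>
    (\<forall>c. \<forall>x\<in>Y p. T (scaleF c x) = scaleF c (T x)) \<and>
    (\<exists>K. \<forall>x\<in>Y p. normY p (T x) \<le> K * normY p x)"

definition invertible_op :: "ereal \<Rightarrow> ('n::finite, 'u::complex_normed_vector) seq_op \<Rightarrow> bool"
  where "invertible_op p T \<longleftrightarrow>
    bounded_op p T \<and>
    (\<exists>B. bounded_op p B \<and> (\<forall>x\<in>Y p. B (T x) = x \<and> T (B x) = x))"

text \<open>Finite-dimensional kernel and cokernel: \<open>Y p\<close> modulo the range of \<open>T\<close> has finite
  dimension iff finitely many vectors together with the range span \<open>Y p\<close>.\<close>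

definition fredholm_op :: "ereal \<Rightarrow> ('n::finite, 'u::complex_normed_vector) seq_op \<Rightarrow> bool"
  where "fredholm_op p T \<longleftrightarrow>
    bounded_op p T \<and>
    (\<exists>B. finite B \<and> cfun.span B = {x \<in> Y p. T x = 0}) \<and>
    (\<exists>B. finite B \<and> cfun.span (T ` Y p \<union> B) = Y p)"

definition spec :: "ereal \<Rightarrow> ('n::finite, 'u::complex_normed_vector) seq_op \<Rightarrow> complex set"
  where "spec p A = {\<mu>. \<not> invertible_op p (scaleF \<mu> - A)}"

definition spec_ess :: "ereal \<Rightarrow> ('n::finite, 'u::complex_normed_vector) seq_op \<Rightarrow> complex set"
  where "spec_ess p A = {\<mu>. \<not> fredholm_op p (scaleF \<mu> - A)}"

definition spec_point :: "ereal \<Rightarrow> ('n::finite, 'u::complex_normed_vector) seq_op \<Rightarrow> complex set"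
  where "spec_point p A = {\<mu>. \<exists>x\<in>Y p. x \<noteq> 0 \<and> A x = scaleF \<mu> x}"

definition laurent :: "(int ^ 'n \<Rightarrow> 'u \<Rightarrow>\<^sub>L 'u) \<Rightarrow> ('n::finite, 'u::complex_normed_vector) seq_op"
  where "laurent \<Lambda> x = (\<lambda>i. \<Sum>\<^sub>\<infinity>j. blinfun_apply (\<Lambda> (i - j)) (x j))"

definition mult_op :: "(int ^ 'n \<Rightarrow> 'u \<Rightarrow>\<^sub>L 'u) \<Rightarrow> ('n::finite, 'u::complex_normed_vector) seq_op"
  where "mult_op b x = (\<lambda>m. blinfun_apply (b m) (x m))"

definition pseudo_ergodic :: "(int ^ 'n::finite \<Rightarrow> 'u::complex_normed_vector \<Rightarrow>\<^sub>L 'u) \<Rightarrow> bool"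
  where "pseudo_ergodic b \<longleftrightarrow>
    (\<forall>\<epsilon>>0. \<forall>S. finite S \<longrightarrow> (\<forall>f \<in> S \<rightarrow> closure (range b).
      \<exists>z. \<forall>s\<in>S. norm (f s - b (z + s)) < \<epsilon>))"

end

theory Submission
  imports Defs
begin

text \<open>
  Fix \<open>\<mu>\<close> and write \<open>T\<^sub>c = \<mu> - L - M\<^sub>c\<close> for \<open>c\<close> with values in \<open>\<Sigma>\<close>. All four sets in the theorem are
  described through their complements, and these agree because of a circle of implications:
  \<open>T\<^sub>b\<close> is Fredholm on \<open>Y p\<close> \<open>\<Longrightarrow>\<close> every \<open>T\<^sub>c\<close> is injective on \<open>Y \<infinity>\<close> \<open>\<Longrightarrow>\<close> every \<open>T\<^sub>c\<close> is invertible on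
  \<open>Y p\<close> \<open>\<Longrightarrow>\<close> \<open>T\<^sub>b\<close> is invertible on \<open>Y p\<close> \<open>\<Longrightarrow>\<close> \<open>T\<^sub>b\<close> is Fredholm on \<open>Y p\<close>. The last two steps are
  immediate, since \<open>b\<close> itself has values in \<open>\<Sigma>\<close>.

  The tool that moves between exponents is localization (\<open>localization\<close>). Let \<open>K\<close> be an operator
  whose matrix is dominated entrywise by a summable function of \<open>i - j\<close>. A lower bound
  \<open>\<parallel>x\<parallel> \<le> C \<parallel>K x\<parallel>\<close> in one of the norms, for finitely supported \<open>x\<close> only, forces \<open>\<parallel>x\<parallel> \<le> C' \<parallel>K x\<parallel>\<close> in
  every one of the norms, for all bounded \<open>x\<close> with \<open>K x\<close> in the space, and puts \<open>x\<close> itself into that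
  space. The reason is that \<open>K\<close> almost commutes with cutoffs to large cubes: applied to cutoffs of \<open>x\<close>
  at scale \<open>n\<close>, the lower bound estimates the local norms of \<open>x\<close> by those of \<open>K x\<close> plus a convolution
  of themselves, with a kernel that is small for large \<open>n\<close>, and this convolution is absorbed by a
  Neumann iteration (\<open>neumann_domination\<close>).

  First implication. By the open mapping argument a Fredholm operator is bounded below modulo its
  finite-dimensional kernel (\<open>fredholm_bounded_below\<close>). Let \<open>x\<close> be finitely supported. Pseudo-ergodicity
  provides arbitrarily many disjoint places where \<open>b\<close> almost coincides with the restriction of \<open>c\<close> to
  the support of \<open>x\<close>, so that \<open>T\<^sub>b\<close> acts on the corresponding translates of \<open>x\<close> almost as \<open>T\<^sub>c\<close> acts on
  \<open>x\<close>. With more translates than the dimension of the kernel, some combination of them is not affected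
  by the kernel, and this gives a lower bound for \<open>T\<^sub>c\<close> on finitely supported sequences
  (\<open>fredholm_imp_lower_bound\<close>). Localization from \<open>p\<close> to \<open>\<infinity>\<close> yields injectivity.

  Second implication. As \<open>U\<close> has finite dimension, \<open>\<Sigma>\<close> is compact, and the family of all \<open>T\<^sub>c\<close> is
  invariant under translations; hence injectivity of all its members on \<open>Y \<infinity>\<close> improves to a lower
  bound that is uniform in \<open>c\<close> (\<open>uniform_lower_bound\<close>). For periodic \<open>c\<close> the operator \<open>T\<^sub>c\<close> acts
  injectively, hence surjectively, on the finite-dimensional space of periodic sequences. Approximating
  \<open>c\<close> and the right-hand side by periodic sequences and passing to a limit with the help of the uniform
  bound shows that every \<open>T\<^sub>c\<close> is onto \<open>Y \<infinity>\<close> (\<open>bounded_below_imp_surj\<close>). Localization from \<open>\<infinity>\<close> to \<open>p\<close>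
  makes the inverse bounded on \<open>Y p\<close>.
\<close>

section \<open>Balls of the sequence spaces\<close>

text \<open>The expression \<open>normY\<close> has a meaning only on the space itself: outside, a divergent sum is \<open>0\<close> and an
  unbounded supremum is arbitrary. Membership and norm bound are therefore stated together.\<close>

definition ballY :: "ereal \<Rightarrow> real \<Rightarrow> (int ^ 'n::finite \<Rightarrow> 'u::real_normed_vector) set"
  where "ballY p R = {x \<in> Y p. normY p x \<le> R}"

lemma exponent_cases:
  fixes p :: ereal
  assumes "p = 0 \<or> 1 \<le> p"
  obtains "p = 0" | "p = \<infinity>" | r where "p = ereal r" "1 \<le> r"
  using assms by (cases p) auto

lemma Y_zero: "x \<in> Y 0 \<longleftrightarrow> (\<forall>\<epsilon>>0. finite {m. norm (x m) \<ge> \<epsilon>})"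
  by (simp add: Y_def)

lemma ballY_infinity: "x \<in> ballY \<infinity> R \<longleftrightarrow> (\<forall>m. norm (x m) \<le> R)"
proof
  assume "x \<in> ballY \<infinity> R"
  then have b: "bounded (range x)" and n: "(SUP m. norm (x m)) \<le> R"
    by (auto simp: ballY_def Y_def normY_def)
  have "bdd_above (range (\<lambda>m. norm (x m)))"
    using b by (force simp: bounded_iff bdd_above_def)
  then show "\<forall>m. norm (x m) \<le> R"
    using n by (meson cSUP_upper UNIV_I order_trans)
next
  assume "\<forall>m. norm (x m) \<le> R"
  then show "x \<in> ballY \<infinity> R"
    by (auto simp: ballY_def Y_def normY_def bounded_iff intro: cSUP_least)
qed

lemma ballY_zero: "x \<in> ballY 0 R \<longleftrightarrow> x \<in> Y 0 \<and> (\<forall>m. norm (x m) \<le> R)"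
proof
  assume x: "x \<in> ballY 0 R"
  then have f: "finite {m. norm (x m) \<ge> 1}" and n: "(SUP m. norm (x m)) \<le> R"
    by (auto simp: ballY_def Y_def normY_def)
  have "norm (x m) \<le> max 1 (Max ((\<lambda>m. norm (x m)) ` {m. norm (x m) \<ge> 1}))" for m
    using f by (cases "norm (x m) \<ge> 1") (auto intro: max.coboundedI2 Max_ge)
  then have "bdd_above (range (\<lambda>m. norm (x m)))"
    by (auto simp: bdd_above_def)
  then have "\<forall>m. norm (x m) \<le> R"
    using n by (meson cSUP_upper UNIV_I order_trans)
  then show "x \<in> Y 0 \<and> (\<forall>m. norm (x m) \<le> R)"
    using x by (simp add: ballY_def)
next
  assume "x \<in> Y 0 \<and> (\<forall>m. norm (x m) \<le> R)"
  then show "x \<in> ballY 0 R"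
    by (auto simp: ballY_def normY_def intro: cSUP_least)
qed

lemma ballY_powr:
  assumes r: "1 \<le> r"
  shows "x \<in> ballY (ereal r) R \<longleftrightarrow>
    0 \<le> R \<and> (\<forall>F. finite F \<longrightarrow> (\<Sum>m\<in>F. norm (x m) powr r) \<le> R powr r)"
proof
  assume "x \<in> ballY (ereal r) R"
  then have s: "(\<lambda>m. norm (x m) powr r) summable_on UNIV"
    and n: "(\<Sum>\<^sub>\<infinity>m. norm (x m) powr r) powr (1 / r) \<le> R"
    using r by (auto simp: ballY_def Y_def normY_def)
  have R: "0 \<le> R" using n powr_ge_zero order_trans by blast
  have "(\<Sum>m\<in>F. norm (x m) powr r) \<le> R powr r" if "finite F" for F
  proof -
    have "(\<Sum>m\<in>F. norm (x m) powr r) \<le> (\<Sum>\<^sub>\<infinity>m. norm (x m) powr r)"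
      using s that by (intro finite_sum_le_infsum) auto
    also have "\<dots> = ((\<Sum>\<^sub>\<infinity>m. norm (x m) powr r) powr (1 / r)) powr r"
      using r by (simp add: powr_powr infsum_nonneg)
    also have "\<dots> \<le> R powr r"
      using n r by (intro powr_mono2) auto
    finally show ?thesis .
  qed
  with R show "0 \<le> R \<and> (\<forall>F. finite F \<longrightarrow> (\<Sum>m\<in>F. norm (x m) powr r) \<le> R powr r)" by blast
next
  assume *: "0 \<le> R \<and> (\<forall>F. finite F \<longrightarrow> (\<Sum>m\<in>F. norm (x m) powr r) \<le> R powr r)"
  have s: "(\<lambda>m. norm (x m) powr r) summable_on UNIV"
    using * by (intro nonneg_bdd_above_summable_on) (auto simp: bdd_above_def)
  have "(\<Sum>\<^sub>\<infinity>m. norm (x m) powr r) \<le> R powr r"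
    using * s by (intro infsum_le_finite_sums) auto
  then have "(\<Sum>\<^sub>\<infinity>m. norm (x m) powr r) powr (1 / r) \<le> (R powr r) powr (1 / r)"
    using r by (intro powr_mono2) (auto intro: infsum_nonneg)
  also have "\<dots> = R" using r * by (simp add: powr_powr)
  finally show "x \<in> ballY (ereal r) R"
    using r s by (auto simp: ballY_def Y_def normY_def)
qed

text \<open>Convexity of \<open>t \<mapsto> t\<^sup>r\<close> with the weights \<open>A / (A + B)\<close> and \<open>B / (A + B)\<close>, without denominators. The
  lemma \<open>powr_convex\<close> concerns positive \<open>s\<close> and \<open>t\<close>; a vanishing one is treated apart.\<close>

lemma powr_convex_combination:
  fixes s t :: real
  assumes r: "1 \<le> r" and st: "0 \<le> s" "0 \<le> t" and A: "0 < A" and B: "0 < B"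
  shows "(A * s + B * t) powr r \<le> (A + B) powr (r - 1) * (A * s powr r + B * t powr r)"
proof -
  have cvx: "(u * s + v * t) powr r \<le> u * s powr r + v * t powr r"
    if uv: "0 < u" "0 < v" "u + v = 1" for u v
  proof (cases "s = 0 \<or> t = 0")
    case False
    have u: "u = 1 - v" using uv by simp
    show ?thesis
      using convex_onD[OF powr_convex[OF r], of v s t] False uv(1,2) st unfolding u by simp
  next
    case True
    have le: "w powr r * q \<le> w * q" if "0 < w" "w \<le> 1" "0 \<le> q" for w q :: real
      using powr_mono'[of 1 r w] r that by (intro mult_right_mono) auto
    from True show ?thesis
      using le[of u "s powr r"] le[of v "t powr r"] uv st r by (auto simp: powr_mult)
  qed
  have "(A * s + B * t) powr r = ((A + B) * (A / (A + B) * s + B / (A + B) * t)) powr r"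
    using A B by (simp add: distrib_left)
  also have "\<dots> = (A + B) powr r * (A / (A + B) * s + B / (A + B) * t) powr r"
    by (rule powr_mult)
  also have "\<dots> \<le> (A + B) powr r * (A / (A + B) * s powr r + B / (A + B) * t powr r)"
    using A B by (intro mult_left_mono cvx) (auto simp: add_divide_distrib[symmetric])
  also have "\<dots> = (A + B) powr (r - 1) * (A * s powr r + B * t powr r)"
    using A B by (simp add: powr_diff distrib_left add_divide_distrib)
  finally show ?thesis .
qed

text \<open>Dividing \<open>f\<close> and \<open>g\<close> by their own bounds \<open>A\<close> and \<open>B\<close> reduces the inequality to convexity term by term.\<close>

lemma minkowski_sum:
  fixes f g :: "'i \<Rightarrow> real"
  assumes r: "1 \<le> r" and nn: "\<And>i. 0 \<le> f i" "\<And>i. 0 \<le> g i"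
    and A: "0 < A" "(\<Sum>i\<in>F. f i powr r) \<le> A powr r"
    and B: "0 < B" "(\<Sum>i\<in>F. g i powr r) \<le> B powr r"
  shows "(\<Sum>i\<in>F. (f i + g i) powr r) \<le> (A + B) powr r"
proof -
  have "(\<Sum>i\<in>F. (f i + g i) powr r) =
      (\<Sum>i\<in>F. (A * (f i / A) + B * (g i / B)) powr r)"
    using A B by simp
  also have "\<dots> \<le> (\<Sum>i\<in>F. (A + B) powr (r - 1) * (A * (f i / A) powr r + B * (g i / B) powr r))"
    using A B nn by (intro sum_mono powr_convex_combination[OF r]) auto
  also have "\<dots> = (A + B) powr (r - 1) *
      (A * ((\<Sum>i\<in>F. f i powr r) / A powr r) + B * ((\<Sum>i\<in>F. g i powr r) / B powr r))"
    using A B nn by (simp add: sum.distrib powr_divide sum_distrib_left[symmetric] sum_divide_distrib[symmetric]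
        times_divide_eq_right[symmetric] del: times_divide_eq_right)
  also have "\<dots> \<le> (A + B) powr (r - 1) * (A * 1 + B * 1)"
    using A B by (intro mult_left_mono add_mono) auto
  also have "\<dots> = (A + B) powr r"
    using A B by (simp add: powr_diff)
  finally show ?thesis .
qed

lemma ballY_mono: "x \<in> ballY p R \<Longrightarrow> R \<le> R' \<Longrightarrow> x \<in> ballY p R'"
  by (auto simp: ballY_def)

lemma ballY_normY: "x \<in> Y p \<Longrightarrow> x \<in> ballY p (normY p x)"
  by (simp add: ballY_def)

locale exponent =
  fixes p :: ereal
  assumes exponent: "p = 0 \<or> 1 \<le> p"
begin

lemma ballY_coord: "x \<in> ballY p R \<Longrightarrow> norm (x m) \<le> R"
proof (rule exponent_cases[OF exponent])
  fix r assume x: "x \<in> ballY p R" and r: "p = ereal r" "1 \<le> r"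
  have "(\<Sum>m\<in>{m}. norm (x m) powr r) \<le> R powr r" and R: "0 \<le> R"
    using x r ballY_powr[of r x R] by blast+
  then show ?thesis
    using r powr_less_mono2[of r R "norm (x m)"] by (force simp: not_less[symmetric])
qed (auto simp: ballY_zero ballY_infinity)

lemma ballY_nonneg: "x \<in> ballY p R \<Longrightarrow> 0 \<le> R"
  using ballY_coord[of x R] norm_ge_zero order_trans by blast

lemma normY_nonneg: "x \<in> Y p \<Longrightarrow> 0 \<le> normY p x"
  using ballY_nonneg ballY_normY by blast

text \<open>A bound for all finite truncations is a bound for the sequence, as the norms are suprema of finite
  expressions; only membership in \<open>c\<^sub>0\<close> cannot be seen from truncations.\<close>

lemma ballY_closed_truncations:
  assumes "0 \<le> R" and c0: "p = 0 \<Longrightarrow> x \<in> Y 0"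
    and trunc: "\<And>F. finite F \<Longrightarrow> (\<lambda>m. if m \<in> F then x m else 0) \<in> ballY p R"
  shows "x \<in> ballY p R"
proof -
  have coord: "norm (x m) \<le> R" for m
    using ballY_coord[OF trunc, of "{m}" m] by simp
  show ?thesis
  proof (rule exponent_cases[OF exponent])
    fix r assume r: "p = ereal r" "1 \<le> r"
    have "(\<Sum>m\<in>F. norm (x m) powr r) \<le> R powr r" if F: "finite F" for F
    proof -
      have "(\<Sum>m\<in>F. norm (if m \<in> F then x m else 0) powr r) \<le> R powr r"
        using trunc[OF F] F unfolding r(1) ballY_powr[OF r(2)] by blast
      also have "(\<Sum>m\<in>F. norm (if m \<in> F then x m else 0) powr r) = (\<Sum>m\<in>F. norm (x m) powr r)"
        by (rule sum.cong) auto
      finally show ?thesis .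
    qed
    then show ?thesis using r \<open>0 \<le> R\<close> by (simp add: ballY_powr)
  qed (use c0 coord in \<open>auto simp: ballY_zero ballY_infinity\<close>)
qed

lemma ballY_scaleR:
  assumes x: "x \<in> ballY p R" and le: "\<And>m. norm (y m) \<le> c * norm (x m)" and c: "0 \<le> c"
  shows "y \<in> ballY p (c * R)"
proof (rule exponent_cases[OF exponent])
  assume p: "p = 0"
  have "finite {m. norm (y m) \<ge> \<epsilon>}" if "\<epsilon> > 0" for \<epsilon>
  proof (rule finite_subset)
    show "finite {m. norm (x m) \<ge> \<epsilon> / (c + 1)}" using x p that c by (auto simp: ballY_zero Y_def)
    show "{m. \<epsilon> \<le> norm (y m)} \<subseteq> {m. \<epsilon> / (c + 1) \<le> norm (x m)}"
    proof safe
      fix m assume "\<epsilon> \<le> norm (y m)"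
      also have "\<dots> \<le> (c + 1) * norm (x m)"
        using le[of m] by (simp add: distrib_right add_increasing2)
      finally show "\<epsilon> / (c + 1) \<le> norm (x m)" using c by (simp add: field_simps)
    qed
  qed
  moreover have "norm (y m) \<le> c * R" for m
    using le[of m] x p c by (meson ballY_zero mult_left_mono order_trans)
  ultimately show ?thesis using p by (auto simp: ballY_zero Y_def)
next
  assume "p = \<infinity>" then show ?thesis using x c le
    by (meson ballY_infinity mult_left_mono order_trans)
next
  fix r assume r: "p = ereal r" "1 \<le> r"
  have R: "0 \<le> R" using x ballY_nonneg by blast
  have "(\<Sum>m\<in>F. norm (y m) powr r) \<le> (c * R) powr r" if F: "finite F" for F
  proof -
    have "(\<Sum>m\<in>F. norm (y m) powr r) \<le> (\<Sum>m\<in>F. (c * norm (x m)) powr r)"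
      using r le by (intro sum_mono powr_mono2) auto
    also have "\<dots> = c powr r * (\<Sum>m\<in>F. norm (x m) powr r)"
      using c by (simp add: powr_mult sum_distrib_left)
    also have "\<dots> \<le> c powr r * R powr r" using x r F by (intro mult_left_mono) (auto simp: ballY_powr)
    also have "\<dots> = (c * R) powr r" using c R by (simp add: powr_mult)
    finally show ?thesis .
  qed
  then show ?thesis using c R r by (simp add: ballY_powr)
qed

lemma ballY_dominated:
  assumes "y \<in> ballY p R" and "\<And>m. norm (x m) \<le> norm (y m)"
  shows "x \<in> ballY p R"
  using ballY_scaleR[of y R x 1] assms by simp

lemma ballY_norm_iff: "(\<lambda>m. norm (x m)) \<in> ballY p R \<longleftrightarrow> x \<in> ballY p R"
  by (auto intro: ballY_dominated)

lemma ballY_finite_support: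
  assumes "finite {m. x m \<noteq> 0}"
  shows "x \<in> Y p"
proof (rule exponent_cases[OF exponent])
  assume "p = 0"
  have "finite {m. norm (x m) \<ge> \<epsilon>}" if "\<epsilon> > 0" for \<epsilon>
    using that by (intro finite_subset[OF _ assms]) auto
  then show ?thesis using \<open>p = 0\<close> by (simp add: Y_def)
next
  assume "p = \<infinity>"
  have "range x \<subseteq> insert 0 (x ` {m. x m \<noteq> 0})" by auto
  then have "finite (range x)" using assms finite_subset by blast
  then show ?thesis using \<open>p = \<infinity>\<close> by (simp add: Y_def finite_imp_bounded)
next
  fix r assume r: "p = ereal r" "1 \<le> r"
  have "(\<lambda>m. norm (x m) powr r) summable_on {m. x m \<noteq> 0}" using assms by simp
  then have "(\<lambda>m. norm (x m) powr r) summable_on UNIV"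
    by (rule summable_on_cong_neutral[THEN iffD1, rotated -1]) auto
  then show ?thesis using r by (auto simp: Y_def)
qed

lemma ballY_add:
  fixes x y z :: "int ^ 'n::finite \<Rightarrow> 'u::real_normed_vector"
  assumes x: "x \<in> ballY p A" and y: "y \<in> ballY p B" and le: "\<And>m. norm (z m) \<le> norm (x m) + norm (y m)"
  shows "z \<in> ballY p (A + B)"
proof (rule exponent_cases[OF exponent])
  assume p: "p = 0"
  have "finite {m. norm (z m) \<ge> \<epsilon>}" if "\<epsilon> > 0" for \<epsilon>
  proof (rule finite_subset)
    show "finite ({m. norm (x m) \<ge> \<epsilon> / 2} \<union> {m. norm (y m) \<ge> \<epsilon> / 2})"
      using x y p half_gt_zero[OF that] unfolding p ballY_zero Y_zero by blast
    show "{m. \<epsilon> \<le> norm (z m)} \<subseteq> {m. norm (x m) \<ge> \<epsilon> / 2} \<union> {m. norm (y m) \<ge> \<epsilon> / 2}"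
      using le by (auto simp: not_le) (smt (verit) field_sum_of_halves)
  qed
  moreover have "norm (z m) \<le> A + B" for m
    using le[of m] x y p by (meson ballY_zero add_mono order_trans)
  ultimately show ?thesis using p by (auto simp: ballY_zero Y_def)
next
  assume "p = \<infinity>" then show ?thesis using x y le
    by (meson ballY_infinity add_mono order_trans)
next
  fix r assume r: "p = ereal r" "1 \<le> r"
  have nn: "0 \<le> A" "0 \<le> B" using x y ballY_nonneg by blast+
  have *: "(\<Sum>m\<in>F. norm (z m) powr r) powr (1 / r) \<le> A + B" if F: "finite F" for F
  proof (rule field_le_epsilon)
    fix e :: real assume "e > 0"
    have "(\<Sum>m\<in>F. norm (x m) powr r) \<le> A powr r" "A powr r \<le> (A + e / 2) powr r"
      "(\<Sum>m\<in>F. norm (y m) powr r) \<le> B powr r" "B powr r \<le> (B + e / 2) powr r"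
      using x y F r nn \<open>e > 0\<close> by (auto simp: ballY_powr intro: powr_mono2)
    then have "(\<Sum>m\<in>F. (norm (x m) + norm (y m)) powr r) \<le> ((A + e / 2) + (B + e / 2)) powr r"
      using nn \<open>e > 0\<close> by (intro minkowski_sum[OF r(2)]) auto
    moreover have "(\<Sum>m\<in>F. norm (z m) powr r) \<le> (\<Sum>m\<in>F. (norm (x m) + norm (y m)) powr r)"
      using r le by (intro sum_mono powr_mono2) auto
    ultimately have "(\<Sum>m\<in>F. norm (z m) powr r) \<le> (A + B + e) powr r" by (simp add: algebra_simps)
    then have "(\<Sum>m\<in>F. norm (z m) powr r) powr (1 / r) \<le> ((A + B + e) powr r) powr (1 / r)"
      using r by (intro powr_mono2) (auto intro: sum_nonneg)
    also have "\<dots> = A + B + e" using r nn \<open>e > 0\<close> by (simp add: powr_powr)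
    finally show "(\<Sum>m\<in>F. norm (z m) powr r) powr (1 / r) \<le> A + B + e" .
  qed
  have "(\<Sum>m\<in>F. norm (z m) powr r) \<le> (A + B) powr r" if F: "finite F" for F
  proof -
    have "(\<Sum>m\<in>F. norm (z m) powr r) = ((\<Sum>m\<in>F. norm (z m) powr r) powr (1 / r)) powr r"
      using r by (simp add: powr_powr sum_nonneg)
    also have "\<dots> \<le> (A + B) powr r" using *[OF F] r by (intro powr_mono2) auto
    finally show ?thesis .
  qed
  then show ?thesis using r nn by (simp add: ballY_powr)
qed

lemma ballY_translate:
  assumes x: "x \<in> ballY p R"
  shows "(\<lambda>m. x (m + t)) \<in> ballY p R"
proof (rule exponent_cases[OF exponent])
  assume p: "p = 0"
  have "finite {m. \<epsilon> \<le> norm (x (m + t))}" if "\<epsilon> > 0" for \<epsilon>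
  proof (rule finite_subset)
    show "finite ((\<lambda>m. m - t) ` {m. \<epsilon> \<le> norm (x m)})" using x p that by (simp add: ballY_zero Y_def)
    show "{m. \<epsilon> \<le> norm (x (m + t))} \<subseteq> (\<lambda>m. m - t) ` {m. \<epsilon> \<le> norm (x m)}"
      by (force simp: image_iff intro: exI[of _ "_ + t"])
  qed
  then show ?thesis using x p by (auto simp: ballY_zero Y_def)
next
  assume "p = \<infinity>" then show ?thesis using x by (auto simp: ballY_infinity)
next
  fix r assume r: "p = ereal r" "1 \<le> r"
  have "(\<Sum>m\<in>F. norm (x (m + t)) powr r) \<le> R powr r" if F: "finite F" for F
  proof -
    have "(\<Sum>m\<in>F. norm (x (m + t)) powr r) = (\<Sum>m\<in>(\<lambda>m. m + t) ` F. norm (x m) powr r)"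
      by (subst sum.reindex) (auto simp: inj_on_def)
    also have "\<dots> \<le> R powr r" using x r F by (auto simp: ballY_powr)
    finally show ?thesis .
  qed
  then show ?thesis using x r by (simp add: ballY_powr)
qed

text \<open>Infinite sums and completeness both rest on this closedness. A uniform error is needed to keep \<open>c\<^sub>0\<close> closed; for the
  other exponents the truncations absorb it, since on a finite set the constant \<open>\<epsilon>\<close> has small norm.\<close>

lemma ballY_approximable:
  fixes x :: "int ^ 'n::finite \<Rightarrow> 'u::real_normed_vector"
  assumes approx: "\<And>\<epsilon>. \<epsilon> > 0 \<Longrightarrow> \<exists>g::int ^ 'n \<Rightarrow> real. g \<in> ballY p R \<and> (\<forall>m. norm (x m) \<le> norm (g m) + \<epsilon>)"
  shows "x \<in> ballY p R"
proof (rule ballY_closed_truncations)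
  show "0 \<le> R" using approx[of 1] ballY_nonneg by force
next
  assume p: "p = 0"
  have "finite {m. \<epsilon> \<le> norm (x m)}" if \<epsilon>: "\<epsilon> > 0" for \<epsilon>
  proof -
    obtain g :: "int ^ 'n \<Rightarrow> real" where g: "g \<in> ballY p R" "\<And>m. norm (x m) \<le> norm (g m) + \<epsilon> / 2"
      using approx[of "\<epsilon> / 2"] \<epsilon> by auto
    show ?thesis
    proof (rule finite_subset)
      show "finite {m. \<epsilon> / 2 \<le> norm (g m)}" using g(1) half_gt_zero[OF \<epsilon>] unfolding p ballY_zero Y_zero by blast
      show "{m. \<epsilon> \<le> norm (x m)} \<subseteq> {m. \<epsilon> / 2 \<le> norm (g m)}"
      proof safe
        fix m assume "\<epsilon> \<le> norm (x m)" then show "\<epsilon> / 2 \<le> norm (g m)" using g(2)[of m] by simp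
      qed
    qed
  qed
  then show "x \<in> Y 0" by (simp add: Y_def)
next
  fix F :: "(int ^ 'n) set" assume F: "finite F"
  define x' where "x' m = (if m \<in> F then x m else 0)" for m
  define u :: "int ^ 'n \<Rightarrow> real" where "u m = (if m \<in> F then 1 else 0)" for m
  have "finite {m. u m \<noteq> 0}" "finite {m. x' m \<noteq> 0}"
    using F by (auto simp: u_def x'_def intro: finite_subset[of _ F])
  then have u: "u \<in> ballY p (normY p u)" and x': "x' \<in> Y p"
    using ballY_finite_support ballY_normY by blast+
  have "normY p x' \<le> R"
  proof (rule field_le_epsilon)
    fix e :: real assume "e > 0"
    define \<epsilon> where "\<epsilon> = e / (normY p u + 1)"
    have nu: "0 \<le> normY p u" using u ballY_nonneg by blast
    then have \<epsilon>: "\<epsilon> > 0" using \<open>e > 0\<close> by (simp add: \<epsilon>_def)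
    obtain g :: "int ^ 'n \<Rightarrow> real" where g: "g \<in> ballY p R" "\<And>m. norm (x m) \<le> norm (g m) + \<epsilon>"
      using approx[OF \<epsilon>] by auto
    have "(\<lambda>m. \<epsilon> * u m) \<in> ballY p (\<epsilon> * normY p u)"
      using \<epsilon> by (intro ballY_scaleR[OF u]) (auto simp: abs_mult)
    from ballY_add[OF g(1) this, where z = "\<lambda>m. norm (x' m)"]
    have "x' \<in> ballY p (R + \<epsilon> * normY p u)"
      using g(2) \<epsilon> by (simp add: ballY_norm_iff x'_def[abs_def] u_def)
    moreover have "\<epsilon> * normY p u \<le> e"
      using nu \<open>e > 0\<close> by (simp add: \<epsilon>_def field_simps)
    ultimately show "normY p x' \<le> R + e" by (simp add: ballY_def)
  qed
  with x' show "(\<lambda>m. if m \<in> F then x m else 0) \<in> ballY p R"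
    by (simp add: ballY_def x'_def[abs_def])
qed

lemma ballY_sum:
  fixes g :: "'i \<Rightarrow> int ^ 'n::finite \<Rightarrow> real"
  assumes "finite F" and "\<And>i. i \<in> F \<Longrightarrow> g i \<in> ballY p (G i)"
  shows "(\<lambda>m. \<Sum>i\<in>F. norm (g i m)) \<in> ballY p (\<Sum>i\<in>F. G i)"
  using assms
proof (induction F rule: finite_induct)
  case empty
  have "(\<lambda>m. 0::real) \<in> ballY p 0"
    by (rule ballY_approximable[where x = "\<lambda>m. 0::real"], rule exI[of _ "\<lambda>m. 0"])
       (use exponent in \<open>auto simp: ballY_def Y_def normY_def\<close>)
  then show ?case by simp
next
  case (insert i F)
  then show ?case
    using ballY_add[of "g i" "G i" "\<lambda>m. \<Sum>i\<in>F. norm (g i m)" "\<Sum>i\<in>F. G i"]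
    by (simp add: sum_nonneg)
qed

text \<open>Minkowski's inequality for infinite sums. Coordinates are bounded by the norm, so the tail of the sum
  is a uniform error. For the weighted translates of a single sequence this is Young's inequality.\<close>

lemma ballY_infsum:
  fixes g :: "'i \<Rightarrow> int ^ 'n::finite \<Rightarrow> real" and x :: "int ^ 'n \<Rightarrow> 'u::real_normed_vector"
  assumes g: "\<And>i. i \<in> I \<Longrightarrow> g i \<in> ballY p (G i)" and G: "G summable_on I"
    and x: "\<And>m. norm (x m) \<le> (\<Sum>\<^sub>\<infinity>i\<in>I. norm (g i m))"
  shows "x \<in> ballY p (\<Sum>\<^sub>\<infinity>i\<in>I. G i)"
proof (rule ballY_approximable)
  fix \<epsilon> :: real assume "\<epsilon> > 0"
  have G0: "0 \<le> G i" if "i \<in> I" for i using g[OF that] ballY_nonneg by blast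
  have gG: "norm (g i m) \<le> G i" if "i \<in> I" for i m using g[OF that] ballY_coord by blast
  have sg: "(\<lambda>i. norm (g i m)) summable_on I" for m
    by (rule summable_on_comparison_test[OF G]) (use gG in auto)
  obtain F where F: "finite F" "F \<subseteq> I" "dist (sum G F) (infsum G I) \<le> \<epsilon>"
    using infsum_finite_approximation[OF G \<open>\<epsilon> > 0\<close>] by blast
  have split: "infsum h I = sum h F + infsum h (I - F)" if "h summable_on I" for h :: "'i \<Rightarrow> real"
  proof -
    have "infsum h (F \<union> (I - F)) = infsum h F + infsum h (I - F)"
      using that F by (intro infsum_Un_disjoint) (auto intro: summable_on_subset_banach)
    then show ?thesis using F by (simp add: Un_absorb1 infsum_finite)
  qed
  have tail: "infsum G (I - F) \<le> \<epsilon>" and 1: "sum G F \<le> infsum G I"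
    using F(3) split[OF G] infsum_nonneg[of "I - F" G] G0 by (auto simp: dist_real_def)
  have "(\<lambda>m. \<Sum>i\<in>F. norm (g i m)) \<in> ballY p (infsum G I)"
    using ballY_mono[OF ballY_sum[OF F(1)] 1] F(2) g by blast
  moreover have "norm (x m) \<le> norm (\<Sum>i\<in>F. norm (g i m)) + \<epsilon>" for m
  proof -
    have "infsum (\<lambda>i. norm (g i m)) (I - F) \<le> infsum G (I - F)"
      using sg[of m] G gG by (intro infsum_mono) (auto intro: summable_on_subset_banach)
    then show ?thesis using x[of m] split[OF sg[of m]] tail by (simp add: sum_nonneg)
  qed
  ultimately show "\<exists>g::int ^ 'n \<Rightarrow> real. g \<in> ballY p (infsum G I) \<and> (\<forall>m. norm (x m) \<le> norm (g m) + \<epsilon>)"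
    by (intro exI[of _ "\<lambda>m. \<Sum>i\<in>F. norm (g i m)"]) simp
qed

end

section \<open>Convolution-dominated matrices\<close>

definition matop :: "(int ^ 'n::finite \<Rightarrow> int ^ 'n \<Rightarrow> 'u::banach \<Rightarrow>\<^sub>L 'u) \<Rightarrow> (int ^ 'n \<Rightarrow> 'u) \<Rightarrow> int ^ 'n \<Rightarrow> 'u"
  where "matop K x = (\<lambda>i. \<Sum>\<^sub>\<infinity>j. blinfun_apply (K i j) (x j))"

definition conv_dominated :: "(int ^ 'n::finite \<Rightarrow> real) \<Rightarrow> (int ^ 'n::finite \<Rightarrow> int ^ 'n \<Rightarrow> 'u::banach \<Rightarrow>\<^sub>L 'u) \<Rightarrow> bool"
  where "conv_dominated a K \<longleftrightarrow> a summable_on UNIV \<and> (\<forall>i j. norm (K i j) \<le> a (i - j))"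

lemma bij_betw_diff_left: "bij_betw (\<lambda>j. i - j) UNIV (UNIV :: 'a::ab_group_add set)"
  by (rule bij_betw_byWitness[where f' = "\<lambda>j. i - j"]) auto

lemma infsum_diff_left: "(\<Sum>\<^sub>\<infinity>j. f (i - j)) = (\<Sum>\<^sub>\<infinity>m. f (m :: 'a::ab_group_add))"
  by (rule infsum_reindex_bij_betw[OF bij_betw_diff_left])

lemma summable_on_diff_left: "(\<lambda>j. f (i - j)) summable_on UNIV \<longleftrightarrow> f summable_on (UNIV :: 'a::ab_group_add set)"
  by (rule summable_on_reindex_bij_betw[OF bij_betw_diff_left])

lemma conv_dominated_nonneg:
  assumes "conv_dominated a K"
  shows "0 \<le> a k"
proof -
  have "norm (K k 0) \<le> a (k - 0)" using assms unfolding conv_dominated_def by blast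
  then show ?thesis using norm_ge_zero[of "K k 0"] by (simp del: norm_ge_zero)
qed

lemma matop_abs_summable:
  assumes K: "conv_dominated a K" and x: "\<And>m. norm (x m) \<le> R"
  shows "(\<lambda>j. norm (blinfun_apply (K i j) (x j))) summable_on UNIV"
proof (rule summable_on_comparison_test)
  have "a summable_on UNIV" using K by (simp add: conv_dominated_def)
  then show "(\<lambda>j. a (i - j) * R) summable_on UNIV"
    by (intro summable_on_cmult_left) (simp add: summable_on_diff_left)
  fix j
  have "norm (blinfun_apply (K i j) (x j)) \<le> norm (K i j) * norm (x j)" by (rule norm_blinfun)
  also have "\<dots> \<le> a (i - j) * R"
    using K x conv_dominated_nonneg[OF K] by (intro mult_mono) (auto simp: conv_dominated_def)
  finally show "norm (blinfun_apply (K i j) (x j)) \<le> a (i - j) * R" .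
qed auto

lemma matop_summable:
  assumes "conv_dominated a K" and "\<And>m. norm (x m) \<le> R"
  shows "(\<lambda>j. blinfun_apply (K i j) (x j)) summable_on UNIV"
  using abs_summable_summable[OF matop_abs_summable[OF assms]] .

lemma norm_infsum_kernel_le:
  fixes f :: "'i \<Rightarrow> 'u::banach"
  assumes g: "g summable_on UNIV" and le: "\<And>j. norm (f j) \<le> g j"
  shows "norm (\<Sum>\<^sub>\<infinity>j. f j) \<le> (\<Sum>\<^sub>\<infinity>j. g j)"
proof -
  have s: "(\<lambda>j. norm (f j)) summable_on UNIV"
    by (rule summable_on_comparison_test[OF g]) (use le in auto)
  have "norm (\<Sum>\<^sub>\<infinity>j. f j) \<le> (\<Sum>\<^sub>\<infinity>j. norm (f j))" by (rule norm_infsum_bound[OF s])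
  also have "\<dots> \<le> (\<Sum>\<^sub>\<infinity>j. g j)" by (rule infsum_mono[OF s g]) (use le in auto)
  finally show ?thesis .
qed

lemma matop_norm_le:
  assumes K: "conv_dominated a K" and x: "\<And>m. norm (x m) \<le> R"
  shows "norm (matop K x i) \<le> (\<Sum>\<^sub>\<infinity>m. a m * norm (x (i - m)))"
proof -
  have a: "a summable_on UNIV" using K by (simp add: conv_dominated_def)
  have s: "(\<lambda>j. a (i - j) * norm (x j)) summable_on UNIV"
  proof (rule summable_on_comparison_test)
    show "(\<lambda>j. a (i - j) * R) summable_on UNIV"
      using a by (intro summable_on_cmult_left) (simp add: summable_on_diff_left)
  qed (use x conv_dominated_nonneg[OF K] in \<open>auto intro: mult_left_mono\<close>)
  have "norm (matop K x i) \<le> (\<Sum>\<^sub>\<infinity>j. a (i - j) * norm (x j))"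
    unfolding matop_def
  proof (rule norm_infsum_kernel_le[OF s])
    fix j
    show "norm (blinfun_apply (K i j) (x j)) \<le> a (i - j) * norm (x j)"
      using norm_blinfun[of "K i j" "x j"] K
      by (meson conv_dominated_def mult_right_mono norm_ge_zero order_trans)
  qed
  also have "\<dots> = (\<Sum>\<^sub>\<infinity>m. a m * norm (x (i - m)))"
    using infsum_diff_left[of "\<lambda>m. a m * norm (x (i - m))" i] by simp
  finally show ?thesis .
qed

lemma (in exponent) matop_ballY:
  fixes x :: "int ^ 'n::finite \<Rightarrow> 'u::banach"
  assumes K: "conv_dominated a K" and x: "x \<in> ballY p R"
  shows "matop K x \<in> ballY p (infsum a UNIV * R)"
proof -
  have a: "a summable_on UNIV" using K by (simp add: conv_dominated_def)
  have a0: "0 \<le> a k" for k using conv_dominated_nonneg[OF K] .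
  have g: "(\<lambda>i. a m * norm (x (i - m))) \<in> ballY p (a m * R)" for m
    using ballY_translate[OF x, of "- m"] a0[of m] by (intro ballY_scaleR) (auto simp: abs_mult)
  have "matop K x \<in> ballY p (\<Sum>\<^sub>\<infinity>m. a m * R)"
  proof (rule ballY_infsum[OF g])
    show "(\<lambda>m. a m * R) summable_on UNIV" using a by (rule summable_on_cmult_left)
    show "norm (matop K x i) \<le> (\<Sum>\<^sub>\<infinity>m. norm (a m * norm (x (i - m))))" for i
      using matop_norm_le[OF K, of x R i] ballY_coord[OF x] a0 by (simp add: abs_mult)
  qed
  then show ?thesis by (simp add: infsum_cmult_left' a)
qed

lemma matop_add:
  assumes K: "conv_dominated a K" and x: "\<And>m. norm (x m) \<le> R" and y: "\<And>m. norm (y m) \<le> R'"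
  shows "matop K (\<lambda>m. x m + y m) i = matop K x i + matop K y i"
  unfolding matop_def
  by (simp add: blinfun.add_right infsum_add matop_summable[OF K x] matop_summable[OF K y])

section \<open>Localization\<close>

definition csize :: "int ^ 'n::finite \<Rightarrow> int"
  where "csize m = Max (range (\<lambda>i. \<bar>m $ i\<bar>))"

lemma csize_le_iff: "csize m \<le> r \<longleftrightarrow> (\<forall>i. \<bar>m $ i\<bar> \<le> r)"
  by (auto simp: csize_def)

lemma abs_nth_le_csize: "\<bar>m $ i\<bar> \<le> csize m"
  using csize_le_iff by blast

lemma csize_nonneg: "0 \<le> csize m"
  using abs_nth_le_csize[of m undefined] by linarith

lemma csize_minus: "csize (- m) = csize m"
  by (simp add: csize_def)

lemma csize_triangle: "csize (k + m) \<le> csize k + csize m"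
  unfolding csize_le_iff
  using abs_nth_le_csize[of k] abs_nth_le_csize[of m] by (smt (verit) vector_add_component)

lemma csize_zero [simp]: "csize 0 = 0"
  by (simp add: csize_def)

lemma finite_csize_le: "finite {m :: int ^ 'n::finite. csize m \<le> r}"
proof (rule finite_subset)
  show "finite (vec_lambda ` PiE (UNIV :: 'n set) (\<lambda>_. {- r..r}))"
    by (intro finite_imageI finite_PiE) auto
  show "{m :: int ^ 'n. csize m \<le> r} \<subseteq> vec_lambda ` PiE UNIV (\<lambda>_. {- r..r})"
  proof
    fix m :: "int ^ 'n" assume "m \<in> {m. csize m \<le> r}"
    then have "vec_nth m \<in> PiE UNIV (\<lambda>_. {- r..r})" by (auto simp: csize_le_iff abs_le_iff minus_le_iff)
    then show "m \<in> vec_lambda ` PiE UNIV (\<lambda>_. {- r..r})" by (metis image_eqI vec_nth_inverse)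
  qed
qed

text \<open>The trapezoid that is \<open>1\<close> on the cube of radius \<open>n\<close> and \<open>0\<close> off the cube of radius \<open>2 n\<close>.\<close>

definition cutoff :: "nat \<Rightarrow> int ^ 'n::finite \<Rightarrow> real"
  where "cutoff n m = max 0 (min 1 (2 - csize m / n))"

lemma cutoff_lipschitz:
  assumes "n > 0"
  shows "\<bar>cutoff n k - cutoff n m\<bar> \<le> min 1 (csize (k - m) / n)"
proof -
  have "\<bar>real_of_int (csize k) - csize m\<bar> \<le> csize (k - m)"
    using csize_triangle[of m "k - m"] csize_triangle[of k "m - k"] csize_minus[of "k - m"] by simp
  then have "\<bar>csize k / n - csize m / n\<bar> \<le> csize (k - m) / n"
    using assms by (simp add: diff_divide_distrib[symmetric] divide_right_mono)
  then show ?thesis unfolding cutoff_def by (smt (verit))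
qed

lemma cutoff_eq_1: "n > 0 \<Longrightarrow> csize m \<le> int n \<Longrightarrow> cutoff n m = 1"
  by (simp add: cutoff_def field_simps max_def min_def)

lemma cutoff_eq_0: "n > 0 \<Longrightarrow> csize m \<ge> 2 * int n \<Longrightarrow> cutoff n m = 0"
  by (simp add: cutoff_def field_simps max_def min_def)

lemma cutoff_bounds: "0 \<le> cutoff n m" "cutoff n m \<le> 1"
  by (auto simp: cutoff_def)

definition grid :: "nat \<Rightarrow> int ^ 'n::finite \<Rightarrow> int ^ 'n"
  where "grid n e = (\<chi> i. int n * e $ i)"

text \<open>The cube of radius \<open>2 n\<close> is covered by translates of the cube of radius \<open>n\<close>, and their number is
  independent of \<open>n\<close>. The scale can thus be chosen large after the number of cubes is known.\<close>

lemma grid_cover: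
  fixes m :: "int ^ 'n::finite"
  assumes "csize m \<le> 2 * int n"
  shows "\<exists>e. csize e \<le> 1 \<and> csize (m - grid n e) \<le> int n"
proof (intro exI conjI)
  let ?e = "(\<chi> i. if m $ i > int n then 1 else if m $ i < - int n then - 1 else 0) :: int ^ 'n"
  show "csize ?e \<le> 1" by (simp add: csize_le_iff)
  show "csize (m - grid n ?e) \<le> int n"
    using assms by (auto simp: csize_le_iff grid_def abs_le_iff)
qed

text \<open>These sums dominate the commutators with cutoffs of scale \<open>n\<close>. The bulk of \<open>a\<close> lies on a finite set,
  where the weights are of order \<open>1 / n\<close>; on the rest they are at most \<open>1\<close>.\<close>

lemma small_weighted_sum:
  fixes a :: "int ^ 'n::finite \<Rightarrow> real"
  assumes a: "a summable_on UNIV" and a0: "\<And>m. 0 \<le> a m" and "\<epsilon> > 0"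
  obtains n where "n > 0" "(\<Sum>\<^sub>\<infinity>m. a m * min 1 (csize m / real n)) \<le> \<epsilon>"
proof -
  have "\<epsilon> / 2 > 0" using \<open>\<epsilon> > 0\<close> by simp
  then obtain F where F: "finite F" "dist (sum a F) (infsum a UNIV) \<le> \<epsilon> / 2"
    using infsum_finite_approximation[OF a] by blast
  define M where "M = (\<Sum>m\<in>F. a m * csize m)"
  have M: "M \<ge> 0" unfolding M_def by (intro sum_nonneg mult_nonneg_nonneg a0) (simp add: csize_nonneg)
  obtain n where n: "real n > 2 * M / \<epsilon>" using reals_Archimedean2 by blast
  have n0: "n > 0" using n M \<open>\<epsilon> > 0\<close> by (cases n) (auto simp: divide_less_0_iff)
  define w where "w m = a m * min 1 (csize m / real n)" for m
  have w: "0 \<le> w m" "w m \<le> a m" "w m \<le> a m * csize m / n" for m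
    using a0[of m] csize_nonneg[of m] n0 mult_left_mono[of "min 1 (csize m / real n)" "csize m / real n" "a m"]
    by (auto simp: w_def mult_left_le)
  have sw: "w summable_on A" and sa: "a summable_on A" for A
  proof -
    show sa: "a summable_on A" using a by (rule summable_on_subset_banach) auto
    show "w summable_on A" by (rule summable_on_comparison_test[OF sa]) (use w in auto)
  qed
  have split: "infsum h UNIV = sum h F + infsum h (- F)" if "\<And>A. h summable_on A" for h :: "_ \<Rightarrow> real"
    using infsum_Un_disjoint[of h F "- F"] that F by (simp add: infsum_finite)
  have "infsum w UNIV = sum w F + infsum w (- F)" by (rule split[OF sw])
  also have "sum w F \<le> (\<Sum>m\<in>F. a m * csize m / n)" by (intro sum_mono w)
  also have "\<dots> = M / n" by (simp add: M_def sum_divide_distrib)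
  also have "\<dots> \<le> \<epsilon> / 2" using n n0 \<open>\<epsilon> > 0\<close> by (simp add: field_simps)
  also have "infsum w (- F) \<le> infsum a (- F)" by (rule infsum_mono[OF sw sa]) (rule w)
  also have "infsum a (- F) \<le> \<epsilon> / 2" using F split[OF sa] by (simp add: dist_real_def abs_le_iff)
  finally have "infsum w UNIV \<le> \<epsilon>" by simp
  with n0 that show ?thesis unfolding w_def by blast
qed

text \<open>The positive operator on the right-hand side multiplies norms and constants by at most \<open>1 / 2\<close>.
  Starting from \<open>0\<close>, the iterates of \<open>G \<mapsto> \<bar>g\<bar> + E G\<close> therefore stay in the ball of radius \<open>2 R\<close>, while
  they fall short of \<open>X\<close> by at most \<open>S / 2\<^sup>J\<close>. Boundedness of \<open>X\<close> alone thus yields its membership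
  in \<open>Y p\<close>.\<close>

lemma (in exponent) neumann_domination:
  fixes X g w :: "int ^ 'n::finite \<Rightarrow> real" and t :: "'d \<Rightarrow> int ^ 'n"
  assumes w: "w summable_on UNIV" and w0: "\<And>m. 0 \<le> w m"
    and D: "finite D" and small: "4 * card D * infsum w UNIV \<le> 1"
    and X: "\<And>k. 0 \<le> X k" "\<And>k. X k \<le> S"
    and g: "g \<in> ballY p R"
    and le: "\<And>k. X k \<le> \<bar>g k\<bar> + (\<Sum>\<^sub>\<infinity>m. w m * ((\<Sum>e\<in>D. X (k - m + t e)) + (\<Sum>e\<in>D. X (k + t e))))"
  shows "X \<in> ballY p (2 * R)"
proof (rule ballY_approximable)
  define H where "H G k m = (\<Sum>e\<in>D. G (k - m + t e)) + (\<Sum>e\<in>D. G (k + t e))"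
    for G :: "int ^ 'n \<Rightarrow> real" and k m
  define E where "E G k = (\<Sum>\<^sub>\<infinity>m. w m * H G k m)" for G k
  have R: "0 \<le> R" using g ballY_nonneg by blast
  have S: "0 \<le> S" using X(1,2) order_trans by blast
  have H_bound: "0 \<le> H G k m" "H G k m \<le> 2 * card D * T"
    if "\<And>k. 0 \<le> G k" "\<And>k. G k \<le> T" for G k m and T :: real
  proof -
    have s: "(\<Sum>e\<in>D. G (f e)) \<le> card D * T" for f
      using sum_bounded_above[of D "\<lambda>e. G (f e)" T] that by simp
    show "0 \<le> H G k m" using that by (auto simp: H_def intro!: add_nonneg_nonneg sum_nonneg)
    show "H G k m \<le> 2 * card D * T"
      using s[of "\<lambda>e. k - m + t e"] s[of "\<lambda>e. k + t e"] by (simp add: H_def)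
  qed
  have E_summable: "(\<lambda>m. w m * H G k m) summable_on UNIV"
    if "\<And>k. 0 \<le> G k" "\<And>k. G k \<le> T" for G k and T :: real
  proof (rule summable_on_comparison_test[OF summable_on_cmult_left[OF w, of "2 * card D * T"]])
    fix m show "w m * H G k m \<le> w m * (2 * card D * T)"
      using w0 H_bound(2)[OF that] by (intro mult_left_mono)
    show "0 \<le> w m * H G k m" using w0 H_bound(1)[OF that] by simp
  qed
  have E_ball: "E G \<in> ballY p (T / 2)" if G: "G \<in> ballY p T" "\<And>k. 0 \<le> G k" for G T
  proof -
    have T: "0 \<le> T" using G ballY_nonneg by blast
    have tr: "(\<lambda>k. G (k + v)) \<in> ballY p T" for v using ballY_translate[OF G(1)] .
    have s1: "(\<lambda>k. \<Sum>e\<in>D. norm (G (k - m + t e))) \<in> ballY p (\<Sum>e\<in>D. T)" for m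
      using tr[of "t _ - m"] by (intro ballY_sum[OF D]) (simp add: algebra_simps)
    have s2: "(\<lambda>k. \<Sum>e\<in>D. norm (G (k + t e))) \<in> ballY p (\<Sum>e\<in>D. T)" for m
      using tr by (intro ballY_sum[OF D])
    have HB: "(\<lambda>k. H G k m) \<in> ballY p (2 * card D * T)" for m
      using ballY_add[OF s1 s2, of "\<lambda>k. H G k m" m] G(2)
      by (simp add: H_def sum_nonneg algebra_simps)
    have "E G \<in> ballY p (\<Sum>\<^sub>\<infinity>m. w m * (2 * card D * T))"
    proof (rule ballY_infsum)
      show "(\<lambda>k. w m * H G k m) \<in> ballY p (w m * (2 * card D * T))" for m
        using w0[of m] by (intro ballY_scaleR[OF HB]) (auto simp: abs_mult)
      show "(\<lambda>m. w m * (2 * card D * T)) summable_on UNIV" using w by (rule summable_on_cmult_left)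
      show "norm (E G k) \<le> (\<Sum>\<^sub>\<infinity>m. norm (w m * H G k m))" for k
      proof -
        have GT: "G k \<le> T" for k using ballY_coord[OF G(1), of k] G(2)[of k] by simp
        have "0 \<le> w m * H G k m" for m using w0 H_bound(1)[OF G(2) GT] by simp
        then show ?thesis by (simp add: E_def infsum_nonneg)
      qed
    qed
    moreover have "(\<Sum>\<^sub>\<infinity>m. w m * (2 * card D * T)) \<le> T / 2"
    proof -
      have "(\<Sum>\<^sub>\<infinity>m. w m * (2 * card D * T)) = infsum w UNIV * (2 * card D * T)"
        by (rule infsum_cmult_left) (rule w)
      then show ?thesis
        using mult_right_mono[OF small T] by (simp add: mult.commute mult.left_commute)
    qed
    ultimately show ?thesis using ballY_mono by blast
  qed
  have iter: "\<exists>G. G \<in> ballY p (2 * R) \<and> (\<forall>k. 0 \<le> G k) \<and> (\<forall>k. X k \<le> G k + S / 2 ^ J)" for J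
  proof (induction J)
    case 0
    have "(\<lambda>m :: int ^ 'n. 0::real) \<in> ballY p (0 * R)" by (rule ballY_scaleR[OF g]) auto
    then have "(\<lambda>m :: int ^ 'n. 0::real) \<in> ballY p (2 * R)" by (rule ballY_mono) (use R in simp)
    then show ?case using X by (intro exI[of _ "\<lambda>m. 0"]) auto
  next
    case (Suc J)
    then obtain G where G: "G \<in> ballY p (2 * R)" "\<And>k. 0 \<le> G k" "\<And>k. X k \<le> G k + S / 2 ^ J" by blast
    define s where "s = S / 2 ^ J"
    have s: "0 \<le> s" using S by (simp add: s_def)
    have GT: "G k \<le> 2 * R" for k using ballY_coord[OF G(1), of k] G(2)[of k] by simp
    have E0: "0 \<le> E G k" for k
      unfolding E_def using w0 H_bound(1)[OF G(2) GT] by (intro infsum_nonneg) auto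
    have "E X k \<le> E G k + s / 2" for k
    proof -
      have "E X k \<le> (\<Sum>\<^sub>\<infinity>m. w m * H G k m + w m * (2 * card D * s))"
        unfolding E_def
      proof (rule infsum_mono)
        show "(\<lambda>m. w m * H X k m) summable_on UNIV" by (rule E_summable[OF X])
        show "(\<lambda>m. w m * H G k m + w m * (2 * card D * s)) summable_on UNIV"
          by (intro summable_on_add summable_on_cmult_left w E_summable[OF G(2) GT])
        fix m
        have "(\<Sum>e\<in>D. X (f e)) \<le> (\<Sum>e\<in>D. G (f e)) + card D * s" for f
          using sum_mono[of D "\<lambda>e. X (f e)" "\<lambda>e. G (f e) + s"] G(3)
          by (simp add: sum.distrib s_def)
        from this[of "\<lambda>e. k - m + t e"] this[of "\<lambda>e. k + t e"]
        have "H X k m \<le> H G k m + 2 * card D * s" by (simp add: H_def)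
        then show "w m * H X k m \<le> w m * H G k m + w m * (2 * card D * s)"
          using w0 by (simp add: distrib_left[symmetric] mult_left_mono)
      qed
      also have "\<dots> = E G k + infsum w UNIV * (2 * card D * s)"
        unfolding E_def
        by (subst infsum_add) (auto intro!: summable_on_cmult_left w E_summable[OF G(2) GT] simp: infsum_cmult_left')
      also have "infsum w UNIV * (2 * card D * s) \<le> s / 2"
        using mult_right_mono[OF small s] by (simp add: mult.commute mult.left_commute)
      finally show ?thesis by simp
    qed
    moreover have "X k \<le> \<bar>g k\<bar> + E X k" for k using le[of k] by (simp add: E_def H_def)
    ultimately have "X k \<le> \<bar>g k\<bar> + (E G k + s / 2)" for k by (meson add_left_mono order_trans)
    then have "X k \<le> \<bar>g k\<bar> + E G k + S / 2 ^ Suc J" for k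
      by (simp add: s_def add.assoc mult.commute)
    moreover have "(\<lambda>k. \<bar>g k\<bar> + E G k) \<in> ballY p (R + R)"
      using ballY_add[OF g E_ball[OF G(1,2)], of "\<lambda>k. \<bar>g k\<bar> + E G k"] E0 by simp
    ultimately show ?case using E0 by (intro exI[of _ "\<lambda>k. \<bar>g k\<bar> + E G k"]) simp
  qed
  fix \<epsilon> :: real assume "\<epsilon> > 0"
  obtain J where J: "S / 2 ^ J < \<epsilon>"
  proof -
    obtain J :: nat where "S / \<epsilon> < 2 ^ J" using real_arch_pow[of 2 "S / \<epsilon>"] by auto
    then show ?thesis using that \<open>\<epsilon> > 0\<close> by (auto simp: field_simps)
  qed
  obtain G where G: "G \<in> ballY p (2 * R)" "\<And>k. 0 \<le> G k" "\<And>k. X k \<le> G k + S / 2 ^ J"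
    using iter by blast
  have "norm (X m) \<le> norm (G m) + \<epsilon>" for m using G(2,3)[of m] X(1)[of m] J by simp
  then show "\<exists>G::int ^ 'n \<Rightarrow> real. G \<in> ballY p (2 * R) \<and> (\<forall>m. norm (X m) \<le> norm (G m) + \<epsilon>)"
    using G(1) by blast
qed

text \<open>Let \<open>X r k\<close> be the norm of \<open>x\<close> on the cube of radius \<open>r\<close> around \<open>k\<close>. The lower bound, applied to the
  product of \<open>x\<close> with the cutoff \<open>\<phi>\<close> around \<open>k\<close>, bounds \<open>X n k\<close> by the norm of \<open>K x\<close> on the cube of radius
  \<open>2 n\<close> and a commutator. The entries of the commutator are \<open>(\<phi> j - \<phi> i) K i j\<close>; they are bounded by
  \<open>a m \<rho> m\<close> with \<open>m = i - j\<close>, and they vanish unless \<open>i\<close> or \<open>j\<close> lies in the cube of radius \<open>2 n\<close> around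
  \<open>k\<close>, so the commutator is bounded by the sum of \<open>a m \<rho> m (X (2 n) (k - m) + X (2 n) k)\<close> over \<open>m\<close>.
  After \<open>X (2 n)\<close> has been estimated by translates of \<open>X n\<close>, this is an inequality for \<open>X n\<close> alone, to
  which the Neumann iteration applies in the norm with exponent \<open>q\<close>.\<close>

theorem (in exponent) localization:
  fixes K :: "int ^ 'n::finite \<Rightarrow> int ^ 'n \<Rightarrow> 'u::banach \<Rightarrow>\<^sub>L 'u"
  assumes K: "conv_dominated a K" and C: "0 < C"
    and lower: "\<And>x. finite {m. x m \<noteq> 0} \<Longrightarrow> normY p x \<le> C * normY p (matop K x)"
  shows "\<exists>c. \<forall>q x B R. exponent q \<longrightarrow> (\<forall>m. norm (x m) \<le> B) \<longrightarrow>
    matop K x \<in> ballY q R \<longrightarrow> x \<in> ballY q (c * R)"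
proof -
  have a: "a summable_on UNIV" using K by (simp add: conv_dominated_def)
  have a0: "0 \<le> a k" for k using conv_dominated_nonneg[OF K] .
  define D :: "(int ^ 'n) set" where "D = {e. csize e \<le> 1}"
  have D: "finite D" unfolding D_def by (rule finite_csize_le)
  have "0 \<in> D" by (simp add: D_def)
  then have cD: "0 < card D" using D by (auto simp: card_gt_0_iff)
  \<comment> \<open>The scale makes the total mass of the commutator kernel at most \<open>1 / 4\<close> after multiplication
    by \<open>C\<close> and the number of cubes, as the iteration requires.\<close>
  obtain n where n: "n > 0" and sn: "(\<Sum>\<^sub>\<infinity>m. a m * min 1 (csize m / real n)) \<le> 1 / (4 * C * card D)"
    using small_weighted_sum[OF a a0, of "1 / (4 * C * card D)"] C cD by (auto simp: zero_less_divide_iff)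
  define \<rho> where "\<rho> m = min 1 (csize m / real n)" for m :: "int ^ 'n"
  define w where "w m = C * (a m * \<rho> m)" for m
  have \<rho>: "0 \<le> \<rho> m" "\<rho> m \<le> 1" for m by (auto simp: \<rho>_def csize_nonneg)
  have sa\<rho>: "(\<lambda>m. a m * \<rho> m) summable_on UNIV"
    by (rule summable_on_comparison_test[OF a]) (use a0 \<rho> in \<open>auto simp: mult_left_le\<close>)
  have w: "w summable_on UNIV" unfolding w_def using sa\<rho> by (rule summable_on_cmult_right)
  have w0: "0 \<le> w m" for m using a0 \<rho> C by (simp add: w_def)
  have "infsum w UNIV = C * (\<Sum>\<^sub>\<infinity>m. a m * \<rho> m)"
    unfolding w_def by (rule infsum_cmult_right) (rule sa\<rho>)
  also have "\<dots> \<le> C * (1 / (4 * C * card D))"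
    using sn C by (intro mult_left_mono) (auto simp: \<rho>_def)
  finally have small: "4 * card D * infsum w UNIV \<le> 1" using C cD by (simp add: field_simps)
  define V :: "(int ^ 'n) set" where "V = {v. csize v \<le> 2 * int n}"
  have V: "finite V" unfolding V_def by (rule finite_csize_le)
  \<comment> \<open>The norm of a unit sequence, which bounds norms over a cube by sums over the cube.\<close>
  define \<delta> where "\<delta> = normY p (\<lambda>i :: int ^ 'n. if i = 0 then 1 else 0 :: real)"
  have \<delta>: "(\<lambda>i :: int ^ 'n. if i = 0 then 1 else 0 :: real) \<in> ballY p \<delta>"
    unfolding \<delta>_def by (intro ballY_normY ballY_finite_support) simp
  have \<delta>0: "0 \<le> \<delta>" using ballY_nonneg[OF \<delta>] .
  show ?thesis
  proof (intro exI allI impI)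
    fix q R B and x :: "int ^ 'n \<Rightarrow> 'u"
    assume q: "exponent q" and x': "\<forall>m. norm (x m) \<le> B" and y: "matop K x \<in> ballY q R"
    have x: "norm (x m) \<le> B" for m using x' by blast
    define y where "y = matop K x"
    define ind :: "int \<Rightarrow> int ^ 'n \<Rightarrow> real" where "ind r m = (if csize m \<le> r then 1 else 0)" for r m
    have ind: "0 \<le> ind r m" "ind r m \<le> 1" for r m by (auto simp: ind_def)
    have fin_ind: "finite {m. ind r (m - k) * f m \<noteq> 0}" for r k and f :: "int ^ 'n \<Rightarrow> real"
    proof (rule finite_subset)
      show "finite ((\<lambda>v. v + k) ` {v. csize v \<le> r})" by (intro finite_imageI finite_csize_le)
      show "{m. ind r (m - k) * f m \<noteq> 0} \<subseteq> (\<lambda>v. v + k) ` {v. csize v \<le> r}"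
        by (auto simp: ind_def image_iff split: if_splits) (metis diff_add_cancel)
    qed
    define X where "X r k = normY p (\<lambda>i. ind r (i - k) * norm (x i))" for r k
    define Z where "Z k = normY p (\<lambda>i. ind (2 * int n) (i - k) * norm (y i))" for k
    have X: "(\<lambda>i. ind r (i - k) * norm (x i)) \<in> ballY p (X r k)" for r k
      unfolding X_def by (intro ballY_normY ballY_finite_support fin_ind)
    have Z: "(\<lambda>i. ind (2 * int n) (i - k) * norm (y i)) \<in> ballY p (Z k)" for k
      unfolding Z_def by (intro ballY_normY ballY_finite_support fin_ind)
    have X0: "0 \<le> X r k" for r k using ballY_nonneg[OF X] .
    have B: "0 \<le> B" using x[of 0] norm_ge_zero order_trans by blast
    have X_bounded: "X r k \<le> B * normY p (ind r)" for r k
    proof -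
      have "ind r \<in> ballY p (normY p (ind r))"
        using fin_ind[of r 0 "\<lambda>_. 1"] by (intro ballY_normY ballY_finite_support) simp
      from ballY_translate[OF this, of "- k"]
      have "(\<lambda>i. ind r (i - k)) \<in> ballY p (normY p (ind r))" by simp
      then have "(\<lambda>i. ind r (i - k) * norm (x i)) \<in> ballY p (B * normY p (ind r))"
        by (rule ballY_scaleR) (use x B ind(1) in \<open>auto simp: abs_mult mult.commute intro: mult_right_mono\<close>)
      then show ?thesis by (simp add: ballY_def X_def)
    qed
    let ?e = "\<lambda>k m. a m * \<rho> m * (X (2 * int n) (k - m) + X (2 * int n) k)"
    let ?E = "\<lambda>k. \<Sum>\<^sub>\<infinity>m. ?e k m"
    have e_summable: "?e k summable_on UNIV" for k
    proof (rule summable_on_comparison_test[OF summable_on_cmult_left[OF sa\<rho>]])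
      fix m
      show "a m * \<rho> m * (X (2 * int n) (k - m) + X (2 * int n) k)
          \<le> a m * \<rho> m * (B * normY p (ind (2 * int n)) + B * normY p (ind (2 * int n)))"
        using a0 \<rho> X_bounded by (intro mult_left_mono add_mono) auto
    qed (use a0 \<rho> X0 in auto)
    have X_double: "X (2 * int n) k \<le> (\<Sum>e\<in>D. X n (k + grid n e))" for k
    proof -
      have "(\<lambda>i. \<Sum>e\<in>D. norm (ind n (i - (k + grid n e)) * norm (x i))) \<in> ballY p (\<Sum>e\<in>D. X n (k + grid n e))"
        by (intro ballY_sum D X)
      then have "(\<lambda>i. ind (2 * int n) (i - k) * norm (x i)) \<in> ballY p (\<Sum>e\<in>D. X n (k + grid n e))"
      proof (rule ballY_dominated)
        fix i
        have "ind (2 * int n) (i - k) \<le> (\<Sum>e\<in>D. ind n (i - (k + grid n e)))"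
        proof (cases "csize (i - k) \<le> 2 * int n")
          case True
          then obtain e where e: "e \<in> D" "csize (i - k - grid n e) \<le> int n"
            using grid_cover unfolding D_def by blast
          have "ind n (i - (k + grid n e)) \<le> (\<Sum>e\<in>D. ind n (i - (k + grid n e)))"
            using e(1) D ind by (intro member_le_sum) auto
          then show ?thesis using e(2) True by (simp add: ind_def algebra_simps)
        qed (auto simp: ind_def intro: sum_nonneg)
        then have "ind (2 * int n) (i - k) * norm (x i) \<le> (\<Sum>e\<in>D. ind n (i - (k + grid n e))) * norm (x i)"
          by (rule mult_right_mono) simp
        then show "norm (ind (2 * int n) (i - k) * norm (x i))
            \<le> norm (\<Sum>e\<in>D. norm (ind n (i - (k + grid n e)) * norm (x i)))"
          using ind by (simp add: abs_mult sum_nonneg sum_distrib_right)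
      qed
      then show ?thesis by (simp add: ballY_def X_def)
    qed
    have Z_le: "Z k \<le> (\<Sum>v\<in>V. \<delta> * norm (y (k + v)))" for k
    proof -
      define h where "h v i = norm (y (k + v)) * (if i - (k + v) = 0 then 1 else 0 :: real)" for v i
      have "h v \<in> ballY p (\<delta> * norm (y (k + v)))" for v
        using ballY_translate[OF \<delta>, of "- (k + v)"]
          ballY_scaleR[of "\<lambda>i. if i - (k + v) = 0 then 1 else 0 :: real" \<delta> "h v" "norm (y (k + v))"]
        by (simp add: h_def abs_mult mult.commute algebra_simps)
      then have "(\<lambda>i. \<Sum>v\<in>V. norm (h v i)) \<in> ballY p (\<Sum>v\<in>V. \<delta> * norm (y (k + v)))"
        by (intro ballY_sum V)
      then have "(\<lambda>i. ind (2 * int n) (i - k) * norm (y i)) \<in> ballY p (\<Sum>v\<in>V. \<delta> * norm (y (k + v)))"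
      proof (rule ballY_dominated)
        fix i
        show "norm (ind (2 * int n) (i - k) * norm (y i)) \<le> norm (\<Sum>v\<in>V. norm (h v i))"
        proof (cases "csize (i - k) \<le> 2 * int n")
          case True
          then have "norm (h (i - k) i) \<le> (\<Sum>v\<in>V. norm (h v i))"
            using V by (intro member_le_sum) (auto simp: V_def)
          then show ?thesis using True by (simp add: ind_def h_def sum_nonneg)
        qed (simp add: ind_def)
      qed
      then show ?thesis by (simp add: ballY_def Z_def)
    qed
    have key: "X n k \<le> C * (Z k + ?E k)" for k
    proof -
      define \<phi> where "\<phi> i = cutoff n (i - k)" for i :: "int ^ 'n"
      have \<phi>: "0 \<le> \<phi> i" "\<phi> i \<le> 1" for i by (auto simp: \<phi>_def cutoff_bounds)
      have \<phi>_ind: "\<phi> i \<le> ind (2 * int n) (i - k)" "ind n (i - k) \<le> \<phi> i" for i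
        using n cutoff_eq_0[of n "i - k"] cutoff_eq_1[of n "i - k"] \<phi>[of i] by (auto simp: ind_def \<phi>_def)
      have \<phi>_lip: "\<bar>\<phi> j - \<phi> i\<bar> \<le> \<rho> (i - j) * (ind (2 * int n) (i - k) + ind (2 * int n) (j - k))" for i j
      proof (cases "csize (i - k) \<le> 2 * int n \<or> csize (j - k) \<le> 2 * int n")
        case True
        have "\<bar>\<phi> j - \<phi> i\<bar> \<le> \<rho> (i - j)"
          using cutoff_lipschitz[OF n, of "i - k" "j - k"] by (simp add: \<phi>_def \<rho>_def abs_minus_commute)
        moreover have "\<rho> (i - j) * 1 \<le> \<rho> (i - j) * (ind (2 * int n) (i - k) + ind (2 * int n) (j - k))"
          using True \<rho> by (intro mult_left_mono) (auto simp: ind_def)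
        ultimately show ?thesis by simp
      next
        case False
        then show ?thesis using n cutoff_eq_0[of n "i - k"] cutoff_eq_0[of n "j - k"] by (simp add: \<phi>_def ind_def)
      qed
      define u where "u i = \<phi> i *\<^sub>R x i" for i
      have "norm (u i) \<le> ind (2 * int n) (i - k) * norm (x i)" for i
        using \<phi>[of i] \<phi>_ind(1)[of i] by (simp add: u_def mult_right_mono)
      then have uX: "u \<in> ballY p (X (2 * int n) k)"
        by (intro ballY_dominated[OF X[of "2 * int n" k]]) (simp add: ind abs_mult)
      have u_fin: "finite {m. u m \<noteq> 0}"
      proof (rule finite_subset[OF _ fin_ind[of "2 * int n" k "\<lambda>_. 1"]], rule subsetI)
        fix m assume "m \<in> {m. u m \<noteq> 0}"
        then show "m \<in> {m. ind (2 * int n) (m - k) * 1 \<noteq> 0}"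
          using \<phi>(1)[of m] \<phi>_ind(1)[of m] by (auto simp: u_def)
      qed
      define g where "g m i = a m * \<rho> m *
        (ind (2 * int n) (i - k) * norm (x (i - m)) + ind (2 * int n) (i - m - k) * norm (x (i - m)))" for m i
      have g0: "0 \<le> g m i" for m i using a0 \<rho> ind by (simp add: g_def)
      have g: "g m \<in> ballY p (?e k m)" for m
      proof (rule ballY_scaleR)
        have 1: "(\<lambda>i. ind (2 * int n) (i - k) * norm (x (i - m))) \<in> ballY p (X (2 * int n) (k - m))"
          using ballY_translate[OF X[of "2 * int n" "k - m"], of "- m"] by (simp add: algebra_simps)
        have 2: "(\<lambda>i. ind (2 * int n) (i - m - k) * norm (x (i - m))) \<in> ballY p (X (2 * int n) k)"
          using ballY_translate[OF X[of "2 * int n" k], of "- m"] by (simp add: algebra_simps)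
        show "(\<lambda>i. ind (2 * int n) (i - k) * norm (x (i - m)) + ind (2 * int n) (i - m - k) * norm (x (i - m)))
            \<in> ballY p (X (2 * int n) (k - m) + X (2 * int n) k)"
          by (rule ballY_add[OF 1 2]) simp
      qed (use a0 \<rho> in \<open>auto simp: g_def abs_mult\<close>)
      have commutator: "norm (matop K u i) \<le> norm (ind (2 * int n) (i - k) * norm (y i)) + norm (\<Sum>\<^sub>\<infinity>m. g m i)" for i
      proof -
        have s1: "(\<lambda>j. blinfun_apply (K i j) (x j)) summable_on UNIV" by (rule matop_summable[OF K x])
        have s2: "(\<lambda>j. blinfun_apply (K i j) (u j)) summable_on UNIV"
          by (rule matop_summable[OF K ballY_coord[OF uX]])
        have sg: "(\<lambda>m. g m i) summable_on UNIV"
          by (rule summable_on_comparison_test[OF e_summable]) (use g0 ballY_coord[OF g, of _ i] in \<open>auto simp: abs_le_iff\<close>)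
        have "matop K u i - \<phi> i *\<^sub>R y i = (\<Sum>\<^sub>\<infinity>j. blinfun_apply (K i j) (u j)) + (\<Sum>\<^sub>\<infinity>j. (- \<phi> i) *\<^sub>R blinfun_apply (K i j) (x j))"
          by (simp add: matop_def y_def infsum_scaleR_right infsum_uminus)
        also have "\<dots> = (\<Sum>\<^sub>\<infinity>j. blinfun_apply (K i j) (u j) + (- \<phi> i) *\<^sub>R blinfun_apply (K i j) (x j))"
          by (rule infsum_add[symmetric, OF s2 summable_on_scaleR_right[OF s1]])
        also have "\<dots> = (\<Sum>\<^sub>\<infinity>j. (\<phi> j - \<phi> i) *\<^sub>R blinfun_apply (K i j) (x j))"
          by (simp add: u_def blinfun.scaleR_right scaleR_left_diff_distrib)
        finally have eq: "matop K u i - \<phi> i *\<^sub>R y i = (\<Sum>\<^sub>\<infinity>j. (\<phi> j - \<phi> i) *\<^sub>R blinfun_apply (K i j) (x j))" .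
        have "norm (\<Sum>\<^sub>\<infinity>j. (\<phi> j - \<phi> i) *\<^sub>R blinfun_apply (K i j) (x j)) \<le> (\<Sum>\<^sub>\<infinity>j. g (i - j) i)"
        proof (rule norm_infsum_kernel_le)
          show "(\<lambda>j. g (i - j) i) summable_on UNIV" using sg by (simp add: summable_on_diff_left[of "\<lambda>m. g m i"])
          fix j
          have "norm ((\<phi> j - \<phi> i) *\<^sub>R blinfun_apply (K i j) (x j)) \<le> \<bar>\<phi> j - \<phi> i\<bar> * (a (i - j) * norm (x j))"
            using norm_blinfun[of "K i j" "x j"] K
            by (auto simp: conv_dominated_def intro!: mult_left_mono order_trans[OF norm_blinfun] mult_right_mono)
          also have "\<dots> \<le> (\<rho> (i - j) * (ind (2 * int n) (i - k) + ind (2 * int n) (j - k))) * (a (i - j) * norm (x j))"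
            using a0 by (intro mult_right_mono \<phi>_lip) auto
          also have "\<dots> = g (i - j) i" by (simp add: g_def algebra_simps)
          finally show "norm ((\<phi> j - \<phi> i) *\<^sub>R blinfun_apply (K i j) (x j)) \<le> g (i - j) i" .
        qed
        also have "(\<Sum>\<^sub>\<infinity>j. g (i - j) i) = (\<Sum>\<^sub>\<infinity>m. g m i)" by (rule infsum_diff_left)
        finally have "norm (matop K u i - \<phi> i *\<^sub>R y i) \<le> (\<Sum>\<^sub>\<infinity>m. g m i)" unfolding eq .
        moreover have "norm (\<phi> i *\<^sub>R y i) \<le> ind (2 * int n) (i - k) * norm (y i)"
          using \<phi>[of i] \<phi>_ind(1)[of i] by (simp add: mult_right_mono)
        ultimately have "norm (matop K u i) \<le> ind (2 * int n) (i - k) * norm (y i) + (\<Sum>\<^sub>\<infinity>m. g m i)"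
          using norm_triangle_sub[of "matop K u i" "\<phi> i *\<^sub>R y i"] by linarith
        then show ?thesis using ind g0 by (simp add: abs_mult infsum_nonneg)
      qed
      have "(\<lambda>i. \<Sum>\<^sub>\<infinity>m. g m i) \<in> ballY p (?E k)"
        by (rule ballY_infsum[OF g e_summable]) (use g0 in \<open>simp add: infsum_nonneg\<close>)
      then have "(\<lambda>i. norm (matop K u i)) \<in> ballY p (Z k + ?E k)"
        by (rule ballY_add[OF Z]) (use commutator in simp)
      then have "normY p (matop K u) \<le> Z k + ?E k"
        unfolding ballY_norm_iff by (simp add: ballY_def)
      then have "C * normY p (matop K u) \<le> C * (Z k + ?E k)"
        using C by simp
      moreover have "X n k \<le> normY p u"
      proof -
        have "u \<in> ballY p (normY p u)" using ballY_normY ballY_finite_support[OF u_fin] by blast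
        then have "(\<lambda>i. ind n (i - k) * norm (x i)) \<in> ballY p (normY p u)"
          by (rule ballY_dominated)
             (use \<phi> \<phi>_ind(2) ind in \<open>auto simp: u_def abs_mult intro: mult_right_mono\<close>)
        then show ?thesis by (simp add: ballY_def X_def)
      qed
      ultimately show ?thesis using lower[OF u_fin] by linarith
    qed
    interpret q: exponent q by (rule q)
    define g where "g k = C * (\<Sum>v\<in>V. \<delta> * norm (y (k + v)))" for k
    have "(\<lambda>k. \<Sum>v\<in>V. norm (\<delta> * norm (y (k + v)))) \<in> ballY q (\<Sum>v\<in>V. \<delta> * R)"
    proof (rule q.ballY_sum[OF V])
      fix v
      show "(\<lambda>k. \<delta> * norm (y (k + v))) \<in> ballY q (\<delta> * R)"
        by (rule q.ballY_scaleR[OF q.ballY_translate[OF y, of v]]) (use \<delta>0 in \<open>auto simp: y_def abs_mult\<close>)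
    qed
    then have g: "g \<in> ballY q (C * (card V * (\<delta> * R)))"
      by (rule q.ballY_scaleR[where c = C, THEN ballY_mono]) (use C \<delta>0 in \<open>auto simp: g_def abs_mult sum_nonneg\<close>)
    have "X n \<in> ballY q (2 * (C * (card V * (\<delta> * R))))"
    proof (rule q.neumann_domination[OF w w0 D small X0 X_bounded g])
      fix k
      have "C * ?E k =
          (\<Sum>\<^sub>\<infinity>m. w m * (X (2 * int n) (k - m) + X (2 * int n) k))"
        using infsum_cmult_right[OF e_summable[of k], of C] by (simp add: w_def mult.assoc)
      also have "\<dots> \<le> (\<Sum>\<^sub>\<infinity>m. w m * ((\<Sum>e\<in>D. X n (k - m + grid n e)) + (\<Sum>e\<in>D. X n (k + grid n e))))"
      proof (rule infsum_mono)
        show "(\<lambda>m. w m * (X (2 * int n) (k - m) + X (2 * int n) k)) summable_on UNIV"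
          using summable_on_cmult_right[OF e_summable[of k], of C] by (simp add: w_def mult.assoc)
        show "(\<lambda>m. w m * ((\<Sum>e\<in>D. X n (k - m + grid n e)) + (\<Sum>e\<in>D. X n (k + grid n e)))) summable_on UNIV"
        proof (rule summable_on_comparison_test[OF summable_on_cmult_left[OF w]])
          fix m
          show "w m * ((\<Sum>e\<in>D. X n (k - m + grid n e)) + (\<Sum>e\<in>D. X n (k + grid n e)))
              \<le> w m * ((\<Sum>e\<in>D. B * normY p (ind n)) + (\<Sum>e\<in>D. B * normY p (ind n)))"
            using w0 X_bounded by (intro mult_left_mono add_mono sum_mono) auto
        qed (use w0 X0 in \<open>auto intro!: mult_nonneg_nonneg add_nonneg_nonneg sum_nonneg\<close>)
      qed (use w0 X_double in \<open>auto intro!: mult_left_mono add_mono\<close>)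
      finally have "C * ?E k
          \<le> (\<Sum>\<^sub>\<infinity>m. w m * ((\<Sum>e\<in>D. X n (k - m + grid n e)) + (\<Sum>e\<in>D. X n (k + grid n e))))" .
      moreover have "C * Z k \<le> \<bar>g k\<bar>"
        unfolding g_def using C by (intro order_trans[OF mult_left_mono[OF Z_le] abs_ge_self]) simp
      ultimately show "X n k \<le> \<bar>g k\<bar> + (\<Sum>\<^sub>\<infinity>m. w m * ((\<Sum>e\<in>D. X n (k - m + grid n e)) + (\<Sum>e\<in>D. X n (k + grid n e))))"
        using key[of k] by (simp add: distrib_left)
    qed
    then have "x \<in> ballY q (2 * (C * (card V * (\<delta> * R))))"
    proof (rule q.ballY_dominated)
      fix k show "norm (x k) \<le> norm (X n k)"
        using ballY_coord[OF X[of n k], of k] X0[of n k] by (simp add: ind_def)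
    qed
    then show "x \<in> ballY q ((2 * C * card V * \<delta>) * R)" by (simp add: mult.assoc)
  qed
qed

section \<open>Finite-dimensional spaces and compactness\<close>

text \<open>Induction on the spanning set. If \<open>b\<close> is not in the span \<open>V\<close> of the previous vectors, then it has a
  positive distance \<open>d\<close> from \<open>V\<close>, as \<open>V\<close> is closed. Hence \<open>\<bar>t\<bar> \<le> r / d\<close> whenever \<open>v + t b\<close> has norm at
  most \<open>r\<close>, and the new ball lies in the continuous image of a product of two compact sets.\<close>

lemma compact_cball_span:
  fixes B :: "'a::real_normed_vector set"
  assumes "finite B"
  shows "compact (cball 0 r \<inter> span B)"
  using assms
proof (induction B arbitrary: r rule: finite_induct)
  case empty
  have "cball (0::'a) r \<inter> span {} = {} \<or> cball (0::'a) r \<inter> span {} = {0}" by auto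
  then show ?case by (metis compact_empty compact_sing)
next
  case (insert b B)
  show ?case
  proof (cases "b \<in> span B")
    case True
    then show ?thesis using insert.IH by (simp add: span_redundant)
  next
    case False
    have "closed (span B)"
      unfolding closed_sequential_limits
    proof safe
      fix x l assume x: "\<forall>n. x n \<in> span B" "x \<longlonglongrightarrow> l"
      obtain R where R: "\<And>n. norm (x n) \<le> R"
        using convergent_imp_Bseq[of x] x(2) by (auto simp: convergent_def Bseq_def)
      have "closed (cball 0 R \<inter> span B)" using insert.IH compact_imp_closed by blast
      then have "l \<in> cball 0 R \<inter> span B"
        by (rule closed_sequentially[where f = x]) (use x R in auto)
      then show "l \<in> span B" by simp
    qed
    then have "open (- span B)" by auto
    then obtain d where d: "d > 0" "ball b d \<subseteq> - span B"
      using False by (meson ComplI openE)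
    have far: "d \<le> norm (b - v)" if "v \<in> span B" for v
      using d that by (force simp: dist_norm)
    have coeff: "\<bar>t\<bar> * d \<le> norm (v + t *\<^sub>R b)" if "v \<in> span B" for v t
    proof (cases "t = 0")
      case False
      have "norm (v + t *\<^sub>R b) = norm (t *\<^sub>R (b - (- inverse t) *\<^sub>R v))"
        using False by (simp add: scaleR_add_right add.commute)
      also have "\<dots> = \<bar>t\<bar> * norm (b - (- inverse t) *\<^sub>R v)" by simp
      also have "\<dots> \<ge> \<bar>t\<bar> * d" using that by (intro mult_left_mono far span_scale) auto
      finally show ?thesis .
    qed simp
    define S where "S = (\<lambda>(v, t). v + t *\<^sub>R b) ` ((cball 0 (r + r / d * norm b) \<inter> span B) \<times> {- r / d..r / d})"
    have "compact S"
      unfolding S_def using insert.IH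
      by (intro compact_continuous_image compact_Times) (auto simp: case_prod_unfold intro!: continuous_intros)
    moreover have "cball 0 r \<inter> span (insert b B) = cball 0 r \<inter> S"
    proof (intro equalityI subsetI)
      fix x assume x: "x \<in> cball 0 r \<inter> span (insert b B)"
      then obtain t where t: "x - t *\<^sub>R b \<in> span B" by (auto simp: span_insert)
      have "\<bar>t\<bar> * d \<le> r" using coeff[OF t, of t] x by simp
      then have tr: "\<bar>t\<bar> \<le> r / d" using d by (simp add: field_simps)
      have "norm (x - t *\<^sub>R b) \<le> norm x + \<bar>t\<bar> * norm b" using norm_triangle_ineq4[of x "t *\<^sub>R b"] by simp
      also have "\<dots> \<le> r + r / d * norm b" using x tr by (intro add_mono mult_right_mono) auto
      finally have "(x - t *\<^sub>R b, t) \<in> (cball 0 (r + r / d * norm b) \<inter> span B) \<times> {- r / d..r / d}"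
        using t tr by (auto simp: abs_le_iff)
      then have "(\<lambda>(v, t). v + t *\<^sub>R b) (x - t *\<^sub>R b, t) \<in> S" unfolding S_def by (rule imageI)
      then show "x \<in> cball 0 r \<inter> S" using x by simp
    next
      fix x assume x: "x \<in> cball 0 r \<inter> S"
      then obtain v t where "x = v + t *\<^sub>R b" "v \<in> span B" by (auto simp: S_def)
      then have "x - t *\<^sub>R b \<in> span B" by simp
      then show "x \<in> cball 0 r \<inter> span (insert b B)"
        using x unfolding span_insert by blast
    qed
    ultimately show ?thesis by (simp add: closed_Int_compact)
  qed
qed

lemma compact_if_finite_span:
  fixes S :: "'a::real_normed_vector set"
  assumes "finite B" "span B = (UNIV :: 'a set)" "closed S" "bounded S"
  shows "compact S"
proof -
  obtain r where "\<forall>x\<in>S. norm x \<le> r" using assms(4) bounded_iff by blast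
  then have "S \<subseteq> cball 0 r" by auto
  then have "S = S \<inter> (cball 0 r \<inter> span B)" using assms(2) by auto
  then show ?thesis using closed_Int_compact[OF assms(3) compact_cball_span[OF assms(1), of r]] by simp
qed

lemma real_span_of_complex_span:
  assumes "cvec.span B = (UNIV :: 'u::complex_normed_vector set)"
  shows "span (B \<union> (\<lambda>b. \<i> *\<^sub>C b) ` B) = (UNIV :: 'u set)"
proof -
  have "c *\<^sub>C b \<in> span (B \<union> (\<lambda>b. \<i> *\<^sub>C b) ` B)" if "b \<in> B" for c b
  proof -
    have "c *\<^sub>C b = complex_of_real (Re c) *\<^sub>C b + complex_of_real (Im c) *\<^sub>C (\<i> *\<^sub>C b)"
      by (simp add: scaleC_scaleC scaleC_add_left[symmetric] complex_eq[of c, symmetric] mult.commute)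
    also have "\<dots> = Re c *\<^sub>R b + Im c *\<^sub>R (\<i> *\<^sub>C b)" by (simp only: scaleC_of_real)
    also have "\<dots> \<in> span (B \<union> (\<lambda>b. \<i> *\<^sub>C b) ` B)"
      using that by (intro span_add span_scale span_base) auto
    finally show ?thesis .
  qed
  then have "cvec.span B \<subseteq> span (B \<union> (\<lambda>b. \<i> *\<^sub>C b) ` B)"
    by (auto simp: cvec.span_explicit intro: span_sum)
  then show ?thesis using assms by auto
qed

text \<open>The coordinate functionals \<open>f b\<close> of a basis are bounded, since each \<open>b\<close> has a positive distance from
  the span of the others. The operators \<open>x \<mapsto> f b x b'\<close> then span all bounded operators.\<close>

lemma finite_span_blinfun:
  assumes "finite B0" "span B0 = (UNIV :: 'a::real_normed_vector set)"
  shows "\<exists>E. finite E \<and> span E = (UNIV :: ('a \<Rightarrow>\<^sub>L 'a) set)"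
proof -
  obtain B where B: "B \<subseteq> B0" "independent B" "span B = (UNIV :: 'a set)"
    using maximal_independent_subset[of B0] assms(2)
    by (metis span_mono span_span top.extremum_unique)
  have fB: "finite B" using B assms finite_subset by blast
  define f where "f b x = representation B x b" for b x
  have repr: "(\<Sum>b\<in>B. f b x *\<^sub>R b) = x" for x
    unfolding f_def using B fB by (intro real_vector.sum_representation_eq) auto
  have f_lin: "linear (f b)" for b
    unfolding f_def using B by (intro linearI) (auto simp: real_vector.representation_add real_vector.representation_scale)
  have f_bl: "bounded_linear (f b)" if b: "b \<in> B" for b
  proof -
    have nb: "b \<notin> span (B - {b})" using B b by (auto simp: dependent_def)
    have "compact (cball 0 (norm b + 1) \<inter> span (B - {b}))" using fB by (intro compact_cball_span) auto
    then have "open (- (cball 0 (norm b + 1) \<inter> span (B - {b})))" using compact_imp_closed by blast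
    then obtain d0 where d0: "d0 > 0" "ball b d0 \<subseteq> - (cball 0 (norm b + 1) \<inter> span (B - {b}))"
      using nb by (meson ComplI IntD2 openE)
    define d where "d = min d0 1"
    have d: "d > 0" using d0 by (simp add: d_def)
    have far: "d \<le> norm (b - v)" if v: "v \<in> span (B - {b})" for v
    proof (rule ccontr)
      assume "\<not> d \<le> norm (b - v)"
      then have *: "norm (b - v) < d0" "norm (b - v) < 1" by (auto simp: d_def)
      have "norm v \<le> norm b + 1" using norm_triangle_sub[of v b] * by (simp add: norm_minus_commute)
      then show False using v * d0 by (auto simp: dist_norm)
    qed
    have "norm (f b x) \<le> norm x * (1 / d)" for x
    proof (cases "f b x = 0")
      case False
      define v where "v = (\<Sum>b'\<in>B - {b}. f b' x *\<^sub>R b')"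
      have v: "v \<in> span (B - {b})" unfolding v_def by (intro span_sum span_scale span_base)
      have "x = f b x *\<^sub>R b + v" using repr[of x] fB b by (simp add: v_def sum.remove)
      also have "\<dots> = f b x *\<^sub>R (b - (- inverse (f b x)) *\<^sub>R v)"
        using False by (simp add: scaleR_add_right)
      finally have "norm x = norm (f b x) * norm (b - (- inverse (f b x)) *\<^sub>R v)" by (metis norm_scaleR real_norm_def)
      moreover have "norm (f b x) * d \<le> norm (f b x) * norm (b - (- inverse (f b x)) *\<^sub>R v)"
        using v by (intro mult_left_mono far span_scale) auto
      ultimately show ?thesis using d by (simp add: field_simps)
    qed (use d in simp)
    then show ?thesis
      by (intro bounded_linear_intro[of "f b" "1 / d"]) (auto simp: linear_add[OF f_lin] linear_scale[OF f_lin])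
  qed
  define E where "E = (\<lambda>(b, b' :: 'a). Blinfun (\<lambda>x. f b x *\<^sub>R b'))"
  have E: "blinfun_apply (E (b, b')) x = f b x *\<^sub>R b'" if "b \<in> B" for b b' x
  proof -
    have "bounded_linear (\<lambda>x. f b x *\<^sub>R b')"
      by (rule bounded_linear_compose[OF bounded_linear_scaleR_left f_bl[OF that]])
    then show ?thesis by (simp add: E_def bounded_linear_Blinfun_apply)
  qed
  have "T \<in> span (E ` (B \<times> B))" for T
  proof -
    have "T = (\<Sum>b\<in>B. \<Sum>b'\<in>B. f b' (blinfun_apply T b) *\<^sub>R E (b, b'))"
    proof (rule blinfun_eqI)
      fix x
      have "blinfun_apply T x = blinfun_apply T (\<Sum>b\<in>B. f b x *\<^sub>R b)" by (simp add: repr)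
      also have "\<dots> = (\<Sum>b\<in>B. f b x *\<^sub>R blinfun_apply T b)"
        by (simp only: blinfun.sum_right blinfun.scaleR_right)
      also have "\<dots> = (\<Sum>b\<in>B. f b x *\<^sub>R (\<Sum>b'\<in>B. f b' (blinfun_apply T b) *\<^sub>R b'))"
        by (simp only: repr)
      also have "\<dots> = (\<Sum>b\<in>B. \<Sum>b'\<in>B. f b' (blinfun_apply T b) *\<^sub>R (f b x *\<^sub>R b'))"
        by (simp add: scaleR_sum_right mult.commute)
      finally show "blinfun_apply T x = blinfun_apply (\<Sum>b\<in>B. \<Sum>b'\<in>B. f b' (blinfun_apply T b) *\<^sub>R E (b, b')) x"
        by (simp add: blinfun.sum_left blinfun.scaleR_left E)
    qed
    also have "\<dots> \<in> span (E ` (B \<times> B))"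
      by (intro span_sum span_scale span_base) auto
    finally show ?thesis .
  qed
  then show ?thesis using fB by (intro exI[of _ "E ` (B \<times> B)"]) auto
qed

lemma bounded_linear_scaleC: "bounded_linear (\<lambda>x :: 'u::complex_normed_vector. c *\<^sub>C x)"
  by (rule bounded_linear_intro[where K = "cmod c"])
     (auto simp: scaleC_add_right norm_scaleC scaleC_scaleC scaleC_of_real[symmetric] mult.commute)

lemma closed_clin_ops: "closed (clin_ops :: ('u::complex_normed_vector \<Rightarrow>\<^sub>L 'u) set)"
proof -
  have cont: "continuous_on UNIV (\<lambda>v :: 'u. c *\<^sub>C v)" for c
    by (intro linear_continuous_on bounded_linear_scaleC)
  have c1: "continuous_on UNIV (\<lambda>T :: 'u \<Rightarrow>\<^sub>L 'u. blinfun_apply T x)" for x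
    by (intro continuous_intros)
  have c2: "continuous_on UNIV (\<lambda>T :: 'u \<Rightarrow>\<^sub>L 'u. c *\<^sub>C blinfun_apply T x)" for c x
    by (rule continuous_on_compose2[OF cont c1]) auto
  show ?thesis unfolding clin_ops_def by (intro closed_Collect_all closed_Collect_eq c1 c2)
qed

text \<open>Tychonoff's theorem, with a finer filter in place of a subsequence. Filters can be refined one after
  the other, which gives simultaneous limits of coefficients and of sequences.\<close>

lemma pointwise_cluster_point:
  fixes f :: "nat \<Rightarrow> 'i::countable \<Rightarrow> 'a::metric_space"
  assumes C: "compact C" and f: "\<And>n i. f n i \<in> C" and F: "F \<noteq> bot"
  obtains G l where "G \<noteq> bot" "G \<le> F" "\<And>i. l i \<in> C" "\<And>i. ((\<lambda>n. f n i) \<longlongrightarrow> l i) G"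
proof -
  have "compact (PiE UNIV (\<lambda>_::'i. C))"
    unfolding compactin_euclidean_iff[symmetric] euclidean_product_topology[symmetric] compactin_PiE
    using C by simp
  moreover have "filtermap f F \<noteq> bot" using F by (simp add: filtermap_bot_iff)
  moreover have "\<forall>\<^sub>F g in filtermap f F. g \<in> PiE UNIV (\<lambda>_. C)" using f by (simp add: eventually_filtermap PiE_iff)
  ultimately obtain l where l: "l \<in> PiE UNIV (\<lambda>_. C)" "inf (nhds l) (filtermap f F) \<noteq> bot"
    unfolding compact_filter by blast
  define G where "G = inf F (filtercomap f (nhds l))"
  have G: "G \<noteq> bot"
  proof
    assume "G = bot"
    then have "eventually (\<lambda>_. False) G" by simp
    then obtain P Q where PQ: "eventually P F" "eventually Q (nhds l)" "\<And>n. P n \<Longrightarrow> Q (f n) \<Longrightarrow> False"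
      unfolding G_def eventually_inf eventually_filtercomap by blast
    have "eventually (\<lambda>g. \<not> Q g) (filtermap f F)"
      unfolding eventually_filtermap using PQ(1) by (rule eventually_mono) (use PQ(3) in blast)
    then have "eventually (\<lambda>_. False) (inf (nhds l) (filtermap f F))"
      unfolding eventually_inf using PQ(2) by blast
    with l(2) show False by (simp add: eventually_False)
  qed
  have "(f \<longlongrightarrow> l) G"
    unfolding filterlim_def G_def by (meson filtermap_filtercomap filtermap_mono inf_le2 order_trans)
  then have "((\<lambda>n. f n i) \<longlongrightarrow> l i) G" for i
    by (rule isCont_tendsto_compose[rotated])
       (rule continuous_on_eq_continuous_at[THEN iffD1, OF open_UNIV continuous_on_product_coordinates, THEN bspec], simp)
  with G show thesis using that[of G l] l(1) by (auto simp: G_def PiE_iff)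
qed

text \<open>Dominated convergence for sums along an arbitrary filter.\<close>

lemma infsum_dominated_tendsto:
  fixes f :: "'n \<Rightarrow> 'i \<Rightarrow> 'u::banach"
  assumes g: "g summable_on UNIV" and le: "\<And>n j. norm (f n j) \<le> g j"
    and lim: "\<And>j. ((\<lambda>n. f n j) \<longlongrightarrow> l j) G" and G: "G \<noteq> bot"
  shows "((\<lambda>n. \<Sum>\<^sub>\<infinity>j. f n j) \<longlongrightarrow> (\<Sum>\<^sub>\<infinity>j. l j)) G"
proof (rule tendstoI)
  fix e :: real assume "e > 0"
  have lel: "norm (l j) \<le> g j" for j
    by (rule tendsto_upperbound[OF tendsto_norm[OF lim]]) (use le G in auto)
  have g0: "0 \<le> g j" for j using lel[of j] norm_ge_zero order_trans by blast
  have sum_h: "h summable_on A" if "\<And>j. norm (h j) \<le> g j" for h :: "'i \<Rightarrow> 'u" and A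
  proof -
    have "(\<lambda>j. norm (h j)) summable_on UNIV"
      by (rule summable_on_comparison_test[OF g]) (use that in auto)
    then have "h summable_on UNIV" by (rule abs_summable_summable)
    then show ?thesis by (rule summable_on_subset_banach) simp
  qed
  have gA: "g summable_on A" for A using g by (rule summable_on_subset_banach) auto
  obtain F where F: "finite F" "dist (sum g F) (infsum g UNIV) \<le> e / 4"
    using infsum_finite_approximation[OF g, of "e / 4"] \<open>e > 0\<close> by auto
  have "infsum g UNIV = sum g F + infsum g (- F)"
    using infsum_Un_disjoint[of g F "- F"] F gA by (simp add: infsum_finite)
  then have tail: "infsum g (- F) \<le> e / 4" using F by (simp add: dist_real_def abs_le_iff)
  have split: "norm (infsum h UNIV - sum h F) \<le> e / 4" if h: "\<And>j. norm (h j) \<le> g j" for h :: "'i \<Rightarrow> 'u"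
  proof -
    have "infsum h UNIV = sum h F + infsum h (- F)"
      using infsum_Un_disjoint[of h F "- F"] F sum_h[OF h] by (simp add: infsum_finite)
    moreover have "norm (infsum h (- F)) \<le> infsum g (- F)"
      by (rule norm_infsum_le[where f = h and g = g and X = "- F"]) (use sum_h[OF h] gA h in auto)
    ultimately show ?thesis using tail by simp
  qed
  have "((\<lambda>n. \<Sum>j\<in>F. f n j) \<longlongrightarrow> (\<Sum>j\<in>F. l j)) G" by (intro tendsto_sum lim)
  then have "\<forall>\<^sub>F n in G. dist (\<Sum>j\<in>F. f n j) (\<Sum>j\<in>F. l j) < e / 4"
    using \<open>e > 0\<close> by (intro tendstoD) auto
  then show "\<forall>\<^sub>F n in G. dist (\<Sum>\<^sub>\<infinity>j. f n j) (\<Sum>\<^sub>\<infinity>j. l j) < e"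
  proof (rule eventually_mono)
    fix n assume n: "dist (\<Sum>j\<in>F. f n j) (\<Sum>j\<in>F. l j) < e / 4"
    have "norm ((\<Sum>\<^sub>\<infinity>j. f n j) - (\<Sum>\<^sub>\<infinity>j. l j)) =
      norm (((\<Sum>\<^sub>\<infinity>j. f n j) - (\<Sum>j\<in>F. f n j)) + ((\<Sum>j\<in>F. f n j) - (\<Sum>j\<in>F. l j)) - ((\<Sum>\<^sub>\<infinity>j. l j) - (\<Sum>j\<in>F. l j)))"
      by simp
    also have "\<dots> \<le> e / 4 + norm ((\<Sum>j\<in>F. f n j) - (\<Sum>j\<in>F. l j)) + e / 4"
      by (intro order_trans[OF norm_triangle_ineq4] add_mono order_trans[OF norm_triangle_ineq] split le lel order_refl)
    also have "\<dots> < e" using n \<open>e > 0\<close> by (simp add: dist_norm)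
    finally show "dist (\<Sum>\<^sub>\<infinity>j. f n j) (\<Sum>\<^sub>\<infinity>j. l j) < e" by (simp add: dist_norm)
  qed
qed

lemma matop_tendsto:
  assumes K: "\<And>n. conv_dominated a (K n)" and x: "\<And>n m. norm (x n m) \<le> R"
    and Klim: "\<And>j. ((\<lambda>n. K n i j) \<longlongrightarrow> K' i j) G" and xlim: "\<And>j. ((\<lambda>n. x n j) \<longlongrightarrow> x' j) G" and G: "G \<noteq> bot"
  shows "((\<lambda>n. matop (K n) (x n) i) \<longlongrightarrow> matop K' x' i) G"
  unfolding matop_def
proof (rule infsum_dominated_tendsto[OF _ _ _ G])
  have "a summable_on UNIV" using K by (simp add: conv_dominated_def)
  then show "(\<lambda>j. a (i - j) * R) summable_on UNIV"
    by (intro summable_on_cmult_left) (simp add: summable_on_diff_left)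
  fix n j
  have "norm (blinfun_apply (K n i j) (x n j)) \<le> norm (K n i j) * norm (x n j)" by (rule norm_blinfun)
  also have "\<dots> \<le> a (i - j) * R"
    using K x conv_dominated_nonneg[OF K] by (intro mult_mono) (auto simp: conv_dominated_def)
  finally show "norm (blinfun_apply (K n i j) (x n j)) \<le> a (i - j) * R" .
  show "((\<lambda>n. blinfun_apply (K n i j) (x n j)) \<longlongrightarrow> blinfun_apply (K' i j) (x' j)) G"
    by (intro tendsto_intros Klim xlim)
qed

section \<open>The matrices of the resolvent and their limits\<close>

text \<open>The matrix of \<open>\<mu> - L - M\<^sub>c\<close>. Its entries form a bounded family for \<open>c\<close> with values in a bounded set, and
  they depend continuously on \<open>c\<close>.\<close>

definition pencil :: "(int ^ 'n \<Rightarrow> 'u \<Rightarrow>\<^sub>L 'u) \<Rightarrow> complex \<Rightarrow> (int ^ 'n \<Rightarrow> 'u \<Rightarrow>\<^sub>L 'u)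
    \<Rightarrow> int ^ 'n::finite \<Rightarrow> int ^ 'n \<Rightarrow> 'u::{complex_normed_vector,banach} \<Rightarrow>\<^sub>L 'u"
  where "pencil \<Lambda> \<mu> c i j = (if i = j then Blinfun (\<lambda>x. \<mu> *\<^sub>C x) - c i else 0) - \<Lambda> (i - j)"

lemma pencil_norm_le:
  fixes c \<Lambda> :: "int ^ 'n::finite \<Rightarrow> 'u::{complex_normed_vector,banach} \<Rightarrow>\<^sub>L 'u"
  assumes "\<And>m. norm (c m) \<le> S"
  shows "norm (pencil \<Lambda> \<mu> c i j) \<le> norm (\<Lambda> (i - j)) + (if i - j = 0 then norm (Blinfun (\<lambda>x. \<mu> *\<^sub>C x) :: 'u \<Rightarrow>\<^sub>L 'u) + S else 0)"
  using assms[of i] norm_triangle_ineq4[of "Blinfun (\<lambda>x. \<mu> *\<^sub>C x) - c i" "\<Lambda> 0"]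
    norm_triangle_ineq4[of "Blinfun (\<lambda>x. \<mu> *\<^sub>C x)" "c i"]
  by (auto simp: pencil_def)

lemma pencil_dominated:
  fixes \<Lambda> :: "int ^ 'n::finite \<Rightarrow> 'u::{complex_normed_vector,banach} \<Rightarrow>\<^sub>L 'u"
  assumes \<Lambda>: "(\<lambda>k. norm (\<Lambda> k)) summable_on UNIV"
  obtains a where "\<And>c. (\<And>m. norm (c m) \<le> S) \<Longrightarrow> conv_dominated a (pencil \<Lambda> \<mu> c)"
proof
  define s where "s = norm (Blinfun (\<lambda>x. \<mu> *\<^sub>C x) :: 'u \<Rightarrow>\<^sub>L 'u) + S"
  have "(\<lambda>k::int ^ 'n. if k = 0 then s else 0) summable_on {0}" by simp
  then have "(\<lambda>k::int ^ 'n. if k = 0 then s else 0) summable_on UNIV"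
    by (rule summable_on_cong_neutral[THEN iffD1, rotated -1]) auto
  then have "(\<lambda>k. norm (\<Lambda> k) + (if k = 0 then s else 0)) summable_on UNIV"
    by (intro summable_on_add \<Lambda>)
  then show "conv_dominated (\<lambda>k. norm (\<Lambda> k) + (if k = 0 then s else 0)) (pencil \<Lambda> \<mu> c)"
    if "\<And>m. norm (c m) \<le> S" for c
    using pencil_norm_le[of c S \<Lambda> \<mu>] that unfolding conv_dominated_def s_def by blast
qed

text \<open>Boundedness of \<open>x\<close> makes the sums over \<open>j\<close> converge, so that the terms of \<open>\<mu> - L - M\<^sub>c\<close> can be
  combined into a single sum.\<close>

lemma resolvent_eq_matop:
  fixes \<Lambda> :: "int ^ 'n::finite \<Rightarrow> 'u::{complex_normed_vector,banach} \<Rightarrow>\<^sub>L 'u"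
  assumes \<Lambda>: "(\<lambda>k. norm (\<Lambda> k)) summable_on UNIV" and x: "\<And>m. norm (x m) \<le> R"
  shows "(scaleF \<mu> - (laurent \<Lambda> + mult_op c)) x = matop (pencil \<Lambda> \<mu> c) x"
proof
  fix i
  have "conv_dominated (\<lambda>k. norm (\<Lambda> k)) (\<lambda>i j. \<Lambda> (i - j))" using \<Lambda> by (simp add: conv_dominated_def)
  then have s: "(\<lambda>j. blinfun_apply (\<Lambda> (i - j)) (x j)) summable_on UNIV" by (rule matop_summable[OF _ x])
  define D where "D = Blinfun (\<lambda>x. \<mu> *\<^sub>C x) - c i"
  have D: "blinfun_apply D v = \<mu> *\<^sub>C v - blinfun_apply (c i) v" for v
    by (simp add: D_def blinfun.diff_left bounded_linear_Blinfun_apply bounded_linear_scaleC)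
  have "((\<lambda>j. blinfun_apply (if i = j then D else 0) (x j)) has_sum (\<Sum>j\<in>{i}. blinfun_apply D (x j))) UNIV"
    by (rule has_sum_cong_neutral[THEN iffD1, OF _ _ _ has_sum_finite[of "{i}"]]) auto
  moreover have "((\<lambda>j. - blinfun_apply (\<Lambda> (i - j)) (x j)) has_sum - laurent \<Lambda> x i) UNIV"
    using s unfolding laurent_def by (simp add: has_sum_uminus)
  ultimately have "((\<lambda>j. blinfun_apply (if i = j then D else 0) (x j) + - blinfun_apply (\<Lambda> (i - j)) (x j))
      has_sum (\<Sum>j\<in>{i}. blinfun_apply D (x j)) + - laurent \<Lambda> x i) UNIV"
    by (rule has_sum_add)
  moreover have "blinfun_apply (if i = j then D else 0) (x j) + - blinfun_apply (\<Lambda> (i - j)) (x j)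
      = blinfun_apply (pencil \<Lambda> \<mu> c i j) (x j)" for j
    by (simp add: pencil_def D_def blinfun.diff_left)
  ultimately have "((\<lambda>j. blinfun_apply (pencil \<Lambda> \<mu> c i j) (x j)) has_sum (blinfun_apply D (x i) - laurent \<Lambda> x i)) UNIV"
    by simp
  then show "(scaleF \<mu> - (laurent \<Lambda> + mult_op c)) x i = matop (pencil \<Lambda> \<mu> c) x i"
    unfolding matop_def by (simp add: infsumI D scaleF_def mult_op_def)
qed

text \<open>A translation only moves the coefficients \<open>c\<close>; this is where the Laurent property enters.\<close>

lemma matop_translate:
  "matop (pencil \<Lambda> \<mu> (\<lambda>m. c (m + t))) (\<lambda>m. x (m + t)) i = matop (pencil \<Lambda> \<mu> c) x (i + t)"
proof -
  have "bij_betw (\<lambda>j. j + t) UNIV UNIV" by (rule bij_betw_byWitness[where f' = "\<lambda>j. j - t"]) auto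
  from infsum_reindex_bij_betw[OF this, of "\<lambda>j. blinfun_apply (pencil \<Lambda> \<mu> c (i + t) j) (x j)"]
  show ?thesis unfolding matop_def pencil_def by simp
qed

lemma matop_scaleR: "matop K (\<lambda>m. r *\<^sub>R x m) i = r *\<^sub>R matop K x i"
  by (simp add: matop_def blinfun.scaleR_right infsum_scaleR_right)

lemma matop_pencil_tendsto:
  fixes \<Lambda> :: "int ^ 'n::finite \<Rightarrow> 'u::{complex_normed_vector,banach} \<Rightarrow>\<^sub>L 'u"
  assumes \<Lambda>: "(\<lambda>k. norm (\<Lambda> k)) summable_on UNIV" and c: "\<And>n m. norm (c n m) \<le> S"
    and x: "\<And>n m. norm (x n m) \<le> R"
    and clim: "\<And>j. ((\<lambda>n. c n j) \<longlongrightarrow> c' j) G" and xlim: "\<And>j. ((\<lambda>n. x n j) \<longlongrightarrow> x' j) G" and G: "G \<noteq> bot"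
  shows "((\<lambda>n. matop (pencil \<Lambda> \<mu> (c n)) (x n) i) \<longlongrightarrow> matop (pencil \<Lambda> \<mu> c') x' i) G"
proof -
  obtain a where a: "\<And>c. (\<And>m. norm (c m) \<le> S) \<Longrightarrow> conv_dominated a (pencil \<Lambda> \<mu> c)"
    using pencil_dominated[OF \<Lambda>] by blast
  show ?thesis
  proof (rule matop_tendsto[OF a[OF c] x _ xlim G])
    fix j show "((\<lambda>n. pencil \<Lambda> \<mu> (c n) i j) \<longlongrightarrow> pencil \<Lambda> \<mu> c' i j) G"
      unfolding pencil_def using clim by (cases "i = j") (auto intro!: tendsto_intros)
  qed
qed

text \<open>If there is no such constant, there are sequences whose images are small in comparison. Translating a
  nearly maximal coordinate to the origin and normalizing it, one obtains a cluster point that is a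
  nonzero bounded sequence annihilated by some \<open>T\<^sub>c\<close>.\<close>

theorem uniform_lower_bound:
  fixes \<Lambda> :: "int ^ 'n::finite \<Rightarrow> 'u::{complex_normed_vector,banach} \<Rightarrow>\<^sub>L 'u"
  assumes \<Lambda>: "(\<lambda>k. norm (\<Lambda> k)) summable_on UNIV" and \<Sigma>: "compact \<Sigma>"
    and U: "\<And>r. compact (cball (0::'u) r)"
    and inj: "\<forall>c x R. range c \<subseteq> \<Sigma> \<longrightarrow> (\<forall>m. norm (x m) \<le> R) \<longrightarrow>
      matop (pencil \<Lambda> \<mu> c) x = (\<lambda>_. 0) \<longrightarrow> x = (\<lambda>_. 0)"
  shows "\<exists>\<kappa>>0. \<forall>c x B R. range c \<subseteq> \<Sigma> \<longrightarrow> (\<forall>m. norm (x m) \<le> B) \<longrightarrow>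
    (\<forall>m. norm (matop (pencil \<Lambda> \<mu> c) x m) \<le> R) \<longrightarrow> (\<forall>m. norm (x m) \<le> \<kappa> * R)"
proof (rule ccontr)
  assume none: "\<not> ?thesis"
  have "\<exists>c x. range c \<subseteq> \<Sigma> \<and> (\<forall>m. norm (x m) \<le> 2) \<and> norm (x 0) = 1 \<and>
      (\<forall>m. norm (matop (pencil \<Lambda> \<mu> c) x m) \<le> 2 / real (Suc n))" for n
  proof -
    obtain c x B R k where c: "range c \<subseteq> \<Sigma>" and x: "\<And>m. norm (x m) \<le> B"
      and Kx: "\<And>m. norm (matop (pencil \<Lambda> \<mu> c) x m) \<le> R" and k: "norm (x k) > real (Suc n) * R"
    proof -
      have "\<not> (\<forall>c x B R. range c \<subseteq> \<Sigma> \<longrightarrow> (\<forall>m. norm (x m) \<le> B) \<longrightarrow>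
          (\<forall>m. norm (matop (pencil \<Lambda> \<mu> c) x m) \<le> R) \<longrightarrow> (\<forall>m. norm (x m) \<le> real (Suc n) * R))"
        using none of_nat_0_less_iff zero_less_Suc by blast
      then show ?thesis using that unfolding not_all not_imp not_le by blast
    qed
    have R: "0 \<le> R" using Kx[of 0] norm_ge_zero order_trans by blast
    define s where "s = (SUP m. norm (x m))"
    have bdd: "bdd_above (range (\<lambda>m. norm (x m)))" using x by (auto simp: bdd_above_def)
    have xs: "norm (x m) \<le> s" for m unfolding s_def by (rule cSUP_upper[OF _ bdd]) simp
    have s: "s > real (Suc n) * R" using k xs[of k] by simp
    then have s0: "s > 0" using R by (smt (verit) mult_nonneg_nonneg of_nat_0_le_iff)
    then have "s / 2 < s" by simp
    \<comment> \<open>The supremum need not be attained; half of it suffices, and causes the factor \<open>2\<close>.\<close>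
    then obtain t where t: "s / 2 < norm (x t)"
      unfolding s_def using less_cSUP_iff[OF UNIV_not_empty bdd] by blast
    have xt: "norm (x t) > 0" using t s0 by linarith
    define z where "z m = (1 / norm (x t)) *\<^sub>R x (m + t)" for m
    have "norm (z m) \<le> 2" for m using xs[of "m + t"] t xt by (simp add: z_def pos_divide_le_eq del: zero_less_norm_iff)
    moreover have "norm (z 0) = 1" using xt by (simp add: z_def)
    moreover have "norm (matop (pencil \<Lambda> \<mu> (\<lambda>m. c (m + t))) z m) \<le> 2 / real (Suc n)" for m
    proof -
      have "norm (matop (pencil \<Lambda> \<mu> (\<lambda>m. c (m + t))) z m) = norm (matop (pencil \<Lambda> \<mu> c) x (m + t)) / norm (x t)"
        unfolding z_def matop_scaleR matop_translate by simp
      also have "\<dots> \<le> R / (s / 2)" using Kx t s0 R by (intro frac_le) auto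
      also have "\<dots> \<le> 2 / real (Suc n)" using s s0 by (simp add: field_simps)
      finally show ?thesis .
    qed
    moreover have "range (\<lambda>m. c (m + t)) \<subseteq> \<Sigma>" using c by auto
    ultimately show ?thesis by blast
  qed
  then obtain c x where c: "\<And>n. range (c n) \<subseteq> \<Sigma>" and x: "\<And>n m. norm (x n m) \<le> 2" "\<And>n. norm (x n 0) = 1"
    and Kx: "\<And>n m. norm (matop (pencil \<Lambda> \<mu> (c n)) (x n) m) \<le> 2 / real (Suc n)"
    by metis
  obtain G1 c' where G1: "G1 \<noteq> bot" "G1 \<le> sequentially" and c': "\<And>i. c' i \<in> \<Sigma>" "\<And>i. ((\<lambda>n. c n i) \<longlongrightarrow> c' i) G1"
    by (rule pointwise_cluster_point[OF \<Sigma>, of c sequentially]) (use c in \<open>auto dest: range_subsetD\<close>)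
  obtain G x' where G: "G \<noteq> bot" "G \<le> G1" and x': "\<And>i. x' i \<in> cball 0 2" "\<And>i. ((\<lambda>n. x n i) \<longlongrightarrow> x' i) G"
    by (rule pointwise_cluster_point[OF U, of x 2 G1]) (use x(1) G1 in auto)
  obtain S where S: "\<And>v. v \<in> \<Sigma> \<Longrightarrow> norm v \<le> S" using compact_imp_bounded[OF \<Sigma>] by (auto simp: bounded_iff)
  have "((\<lambda>n. matop (pencil \<Lambda> \<mu> (c n)) (x n) i) \<longlongrightarrow> matop (pencil \<Lambda> \<mu> c') x' i) G" for i
    by (rule matop_pencil_tendsto[OF \<Lambda> _ x(1) tendsto_mono[OF G(2) c'(2)] x'(2) G(1), where S = S])
       (use S c in blast)
  moreover have "((\<lambda>n. matop (pencil \<Lambda> \<mu> (c n)) (x n) i) \<longlongrightarrow> 0) G" for i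
  proof (rule Lim_null_comparison)
    show "\<forall>\<^sub>F n in G. norm (matop (pencil \<Lambda> \<mu> (c n)) (x n) i) \<le> 2 / real (Suc n)" using Kx by simp
    have "(\<lambda>n. 2 / real (Suc n)) \<longlonglongrightarrow> 0" by (rule LIMSEQ_Suc[OF lim_const_over_n])
    then show "((\<lambda>n. 2 / real (Suc n)) \<longlongrightarrow> 0) G" using G G1 by (meson order_trans tendsto_mono)
  qed
  ultimately have "matop (pencil \<Lambda> \<mu> c') x' = (\<lambda>_. 0)" using tendsto_unique[OF G(1)] by blast
  then have "x' = (\<lambda>_. 0)" using inj[rule_format, of c' x' 2] c'(1) x'(1) by auto
  moreover have "((\<lambda>n. norm (x n 0)) \<longlongrightarrow> norm (x' 0)) G" by (rule tendsto_norm[OF x'(2)])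
  ultimately show False using x(2) tendsto_unique[OF G(1) tendsto_const] by force
qed

section \<open>Periodization\<close>

lemma injective_endomorphism_surj:
  fixes f :: "('i \<Rightarrow> 'u::complex_normed_vector) \<Rightarrow> 'i \<Rightarrow> 'u"
  assumes f: "module_hom scaleF scaleF f" and V: "cfun.subspace V" "V \<subseteq> cfun.span T" "finite T"
    and fV: "f ` V \<subseteq> V" and inj: "\<And>x. x \<in> V \<Longrightarrow> f x = 0 \<Longrightarrow> x = 0"
  shows "V \<subseteq> f ` V"
proof -
  obtain S where S: "S \<subseteq> V" "cfun.independent S" "V \<subseteq> cfun.span S"
    by (rule cfun.maximal_independent_subset)
  have spanS: "cfun.span S = V" using S V by (intro antisym cfun.span_minimal) auto
  have fS: "finite S" using cfun.independent_span_bound[OF V(3) S(2)] S(1) V(2) by blast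
  have injV: "inj_on f V"
    using module_hom.inj_on_iff_eq_0[OF f V(1)] inj by auto
  have ind: "cfun.independent (f ` S)"
    using module_hom.independent_injective_image[OF f S(2)] injV spanS by simp
  have card: "card (f ` S) = card S" using card_image inj_on_subset[OF injV S(1)] by blast
  have "V \<subseteq> cfun.span (f ` S)"
  proof
    fix v assume v: "v \<in> V"
    show "v \<in> cfun.span (f ` S)"
    proof (rule ccontr)
      assume nv: "v \<notin> cfun.span (f ` S)"
      then have "cfun.independent (insert v (f ` S))" using ind by (rule cfun.independent_insertI)
      moreover have "insert v (f ` S) \<subseteq> cfun.span S" using v fV S(1) spanS by auto
      ultimately have "card (insert v (f ` S)) \<le> card S" using cfun.independent_span_bound[OF fS] by blast
      moreover have "v \<notin> f ` S" using nv cfun.span_base by blast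
      ultimately show False using fS card by simp
    qed
  qed
  also have "cfun.span (f ` S) = f ` V" using module_hom.span_image[OF f, of S] spanS by simp
  finally show ?thesis .
qed

text \<open>The representative modulo \<open>2 n\<close> in the cube with coordinates from \<open>- n\<close> to \<open>n - 1\<close>. As the cube is
  centred at the origin, \<open>x \<circ> wrap n\<close> converges to \<open>x\<close> pointwise.\<close>

definition wrap :: "nat \<Rightarrow> int ^ 'n::finite \<Rightarrow> int ^ 'n"
  where "wrap n m = (\<chi> i. (m $ i + int n) mod (2 * int n) - int n)"

lemma csize_wrap_le:
  assumes "n > 0" shows "csize (wrap n m) \<le> int n"
proof -
  have "0 \<le> (m $ i + int n) mod (2 * int n)" "(m $ i + int n) mod (2 * int n) < 2 * int n" for i
    using assms by auto
  then show ?thesis by (auto simp: csize_le_iff wrap_def abs_le_iff) (smt (verit))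
qed

lemma wrap_eq_self: "csize m < int n \<Longrightarrow> wrap n m = m"
proof -
  assume *: "csize m < int n"
  have "\<bar>m $ i\<bar> < int n" for i using abs_nth_le_csize[of m i] * by simp
  then have "(m $ i + int n) mod (2 * int n) = m $ i + int n" for i
    by (intro mod_pos_pos_trivial) (smt (verit))+
  then show ?thesis by (simp add: wrap_def vec_eq_iff)
qed

lemma wrap_add: "wrap n (j + (wrap n i - i)) = wrap n j"
proof -
  have "(x + ((y + k) mod (2 * k) - k - y) + k) mod (2 * k) = (x + k) mod (2 * k)" for x y k :: int
  proof -
    have "(x + ((y + k) mod (2 * k) - k - y) + k) mod (2 * k) = ((x - y) + (y + k) mod (2 * k)) mod (2 * k)"
      by (simp add: algebra_simps)
    also have "\<dots> = ((x - y) + (y + k)) mod (2 * k)" by (rule mod_add_right_eq)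
    finally show ?thesis by (simp add: algebra_simps)
  qed
  then show ?thesis by (simp add: wrap_def vec_eq_iff)
qed

lemma wrap_wrap: "wrap n (wrap n i) = wrap n i"
  using wrap_add[of n i i] by simp

definition periodic :: "nat \<Rightarrow> (int ^ 'n::finite \<Rightarrow> 'a) set"
  where "periodic n = {x. \<forall>m. x (wrap n m) = x m}"

lemma periodic_translate:
  assumes "x \<in> periodic n" shows "x (m + (wrap n i - i)) = x m"
  using assms wrap_add[of n m i] unfolding periodic_def mem_Collect_eq by metis

lemma compose_wrap_periodic: "(\<lambda>m. x (wrap n m)) \<in> periodic n"
  by (simp add: periodic_def wrap_wrap)

lemma matop_periodic:
  assumes "c \<in> periodic n" "x \<in> periodic n"
  shows "matop (pencil \<Lambda> \<mu> c) x \<in> periodic n"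
  unfolding periodic_def
proof (clarify)
  fix i
  show "matop (pencil \<Lambda> \<mu> c) x (wrap n i) = matop (pencil \<Lambda> \<mu> c) x i"
    using matop_translate[of \<Lambda> \<mu> c "wrap n i - i" x i] assms by (simp add: periodic_translate)
qed

lemma periodic_bounded:
  assumes "n > 0" "x \<in> periodic n"
  obtains R where "\<And>m. norm (x m) \<le> R"
proof
  fix m
  have "finite ((\<lambda>m. norm (x m)) ` {m. csize m \<le> int n})" by (intro finite_imageI finite_csize_le)
  moreover have "norm (x m) \<in> (\<lambda>m. norm (x m)) ` {m. csize m \<le> int n}"
    using assms csize_wrap_le[of n m] by (auto simp: periodic_def intro!: image_eqI[of _ _ "wrap n m"])
  ultimately show "norm (x m) \<le> Max ((\<lambda>m. norm (x m)) ` {m. csize m \<le> int n})" by (rule Max_ge)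
qed

lemma sum_fun_apply: "(\<Sum>v\<in>A. f v) m = (\<Sum>v\<in>A. f v m)"
  by (induction A rule: infinite_finite_induct) auto

lemma subspace_periodic: "cfun.subspace (periodic n)"
  by (auto simp: cfun.subspace_def periodic_def scaleF_def)

text \<open>A periodic sequence is determined by its values on one cube.\<close>

lemma finite_span_periodic:
  fixes B :: "'u::complex_normed_vector set"
  assumes n: "n > 0" and B: "finite B" "cvec.span B = UNIV"
  shows "\<exists>T. finite T \<and> (periodic n :: (int ^ 'n::finite \<Rightarrow> 'u) set) \<subseteq> cfun.span T"
proof (intro exI conjI subsetI)
  let ?box = "{v :: int ^ 'n. csize v \<le> int n}"
  define e :: "int ^ 'n \<Rightarrow> 'u \<Rightarrow> int ^ 'n \<Rightarrow> 'u" where "e v u m = (if wrap n m = v then u else 0)" for v u m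
  let ?T = "(\<lambda>(v, b). e v b) ` (?box \<times> B)"
  show "finite ?T" using B finite_csize_le by (intro finite_imageI finite_cartesian_product) auto
  have e: "e v u \<in> cfun.span ?T" if v: "v \<in> ?box" for v u
  proof -
    have "cvec.subspace {u. e v u \<in> cfun.span ?T}"
      unfolding cvec.subspace_def
    proof (intro conjI ballI allI; clarify)
      have "e v 0 = 0" by (auto simp: e_def)
      then show "e v 0 \<in> cfun.span ?T" by (simp add: cfun.span_zero)
    next
      fix x y assume "e v x \<in> cfun.span ?T" "e v y \<in> cfun.span ?T"
      moreover have "e v (x + y) = e v x + e v y" by (auto simp: e_def fun_eq_iff)
      ultimately show "e v (x + y) \<in> cfun.span ?T" by (simp add: cfun.span_add)
    next
      fix c x assume "e v x \<in> cfun.span ?T"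
      moreover have "e v (c *\<^sub>C x) = scaleF c (e v x)" by (auto simp: e_def fun_eq_iff scaleF_def)
      ultimately show "e v (c *\<^sub>C x) \<in> cfun.span ?T" by (simp add: cfun.span_scale)
    qed
    moreover have "B \<subseteq> {u. e v u \<in> cfun.span ?T}" using v by (auto intro!: cfun.span_base)
    ultimately have "cvec.span B \<subseteq> {u. e v u \<in> cfun.span ?T}" by (rule cvec.span_minimal[rotated])
    then show ?thesis using B by auto
  qed
  fix x :: "int ^ 'n \<Rightarrow> 'u" assume x: "x \<in> periodic n"
  have "x = (\<Sum>v\<in>?box. e v (x v))"
  proof
    fix m
    have "(\<Sum>v\<in>?box. e v (x v)) m = (\<Sum>v\<in>?box. if wrap n m = v then x v else 0)"
      by (simp add: sum_fun_apply e_def)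
    also have "\<dots> = x (wrap n m)" using csize_wrap_le[OF n, of m] finite_csize_le by (subst sum.delta') auto
    finally show "x m = (\<Sum>v\<in>?box. e v (x v)) m" using x by (simp add: periodic_def)
  qed
  also have "\<dots> \<in> cfun.span ?T" using e by (intro cfun.span_sum) auto
  finally show "x \<in> cfun.span ?T" .
qed

lemma matop_scaleC:
  fixes x :: "int ^ 'n::finite \<Rightarrow> 'u::{complex_normed_vector,banach}"
  assumes K: "conv_dominated a K" and lin: "\<And>i j. K i j \<in> clin_ops" and x: "\<And>m. norm (x m) \<le> R"
  shows "matop K (scaleF r x) = scaleF r (matop K x)"
proof
  fix i
  have "((\<lambda>j. r *\<^sub>C blinfun_apply (K i j) (x j)) has_sum r *\<^sub>C matop K x i) UNIV"
    unfolding matop_def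
    by (rule has_sum_bounded_linear[OF bounded_linear_scaleC]) (rule has_sum_infsum[OF matop_summable[OF K x]])
  then show "matop K (scaleF r x) i = scaleF r (matop K x) i"
    using lin by (simp add: matop_def scaleF_def clin_ops_def infsumI)
qed

lemma pencil_clin_ops:
  fixes \<Lambda> c :: "int ^ 'n::finite \<Rightarrow> 'u::{complex_normed_vector,banach} \<Rightarrow>\<^sub>L 'u"
  assumes "range \<Lambda> \<subseteq> clin_ops" "range c \<subseteq> clin_ops"
  shows "pencil \<Lambda> \<mu> c i j \<in> clin_ops"
proof -
  have diff: "S - T \<in> clin_ops" if "S \<in> clin_ops" "T \<in> clin_ops" for S T :: "'u \<Rightarrow>\<^sub>L 'u"
    using that by (auto simp: clin_ops_def blinfun.diff_left cvec.scale_right_diff_distrib)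
  have "Blinfun (\<lambda>x. \<mu> *\<^sub>C x) \<in> (clin_ops :: ('u \<Rightarrow>\<^sub>L 'u) set)"
    by (auto simp: clin_ops_def bounded_linear_Blinfun_apply bounded_linear_scaleC scaleC_scaleC mult.commute)
  moreover have "0 \<in> (clin_ops :: ('u \<Rightarrow>\<^sub>L 'u) set)" by (simp add: clin_ops_def)
  moreover have "c i \<in> clin_ops" "\<Lambda> (i - j) \<in> clin_ops" using assms by auto
  ultimately show ?thesis unfolding pencil_def by (intro diff) (auto intro: diff)
qed

text \<open>For periodic coefficients the operator preserves the finite-dimensional space of periodic sequences.
  Being injective there, it is onto. The lower bound keeps the periodic solutions bounded, and a
  pointwise cluster point of them solves the original equation.\<close>

theorem bounded_below_imp_surj:
  fixes \<Lambda> c :: "int ^ 'n::finite \<Rightarrow> 'u::{complex_normed_vector,banach} \<Rightarrow>\<^sub>L 'u"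
  assumes B: "finite B" "cvec.span B = (UNIV :: 'u set)"
    and \<Lambda>: "(\<lambda>k. norm (\<Lambda> k)) summable_on UNIV" "range \<Lambda> \<subseteq> clin_ops"
    and \<Sigma>: "bounded \<Sigma>" "\<Sigma> \<subseteq> clin_ops"
    and U: "\<And>r. compact (cball (0::'u) r)"
    and below: "\<forall>c x B R. range c \<subseteq> \<Sigma> \<longrightarrow> (\<forall>m. norm (x m) \<le> B) \<longrightarrow>
      (\<forall>m. norm (matop (pencil \<Lambda> \<mu> c) x m) \<le> R) \<longrightarrow> (\<forall>m. norm (x m) \<le> \<kappa> * R)"
    and c: "range c \<subseteq> \<Sigma>" and y: "\<forall>m. norm (y m) \<le> R"
  shows "\<exists>x. (\<forall>m. norm (x m) \<le> \<kappa> * R) \<and> matop (pencil \<Lambda> \<mu> c) x = y"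
proof -
  obtain S where S: "\<And>v. v \<in> \<Sigma> \<Longrightarrow> norm v \<le> S" using \<Sigma>(1) by (auto simp: bounded_iff)
  obtain a where a: "\<And>c. (\<And>m. norm (c m) \<le> S) \<Longrightarrow> conv_dominated a (pencil \<Lambda> \<mu> c)"
    using pencil_dominated[OF \<Lambda>(1)] by blast
  have "\<exists>x. (\<forall>m. norm (x m) \<le> \<kappa> * R) \<and> matop (pencil \<Lambda> \<mu> (\<lambda>m. c (wrap (Suc n) m))) x = (\<lambda>m. y (wrap (Suc n) m))" for n
  proof -
    define N where "N = Suc n"
    have N: "N > 0" by (simp add: N_def)
    define c' where "c' m = c (wrap N m)" for m
    have c': "range c' \<subseteq> \<Sigma>" "c' \<in> periodic N"
      using c compose_wrap_periodic[of c N] by (auto simp: c'_def[abs_def])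
    have K: "conv_dominated a (pencil \<Lambda> \<mu> c')" using c'(1) S by (intro a) blast
    have lin: "pencil \<Lambda> \<mu> c' i j \<in> clin_ops" for i j using \<Lambda>(2) c'(1) \<Sigma>(2) by (intro pencil_clin_ops) auto
    \<comment> \<open>Composition with \<open>wrap\<close> makes every argument bounded, so that this map is linear on the space of
      all functions; on periodic sequences it is the operator.\<close>
    define f where "f x = matop (pencil \<Lambda> \<mu> c') (\<lambda>m. x (wrap N m))" for x
    have f_eq: "f x = matop (pencil \<Lambda> \<mu> c') x" if "x \<in> periodic N" for x
      using that by (simp add: f_def periodic_def)
    have bdd: "\<exists>R. \<forall>m. norm (x (wrap N m)) \<le> R" for x :: "int ^ 'n \<Rightarrow> 'u"
      using periodic_bounded[OF N compose_wrap_periodic[of x N]] by blast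
    have hom: "module_hom scaleF scaleF f"
    proof (intro module_hom.intro module_hom_axioms.intro cfun.module_axioms)
      fix x y :: "int ^ 'n \<Rightarrow> 'u"
      obtain R R' where "\<And>m. norm (x (wrap N m)) \<le> R" "\<And>m. norm (y (wrap N m)) \<le> R'" using bdd by metis
      from matop_add[OF K this] show "f (x + y) = f x + f y" by (simp add: f_def fun_eq_iff)
    next
      fix r and x :: "int ^ 'n \<Rightarrow> 'u"
      obtain R where "\<And>m. norm (x (wrap N m)) \<le> R" using bdd by metis
      from matop_scaleC[OF K lin this, of r] show "f (scaleF r x) = scaleF r (f x)"
        by (simp add: f_def scaleF_def)
    qed
    obtain T where T: "finite T" "(periodic N :: (int ^ 'n \<Rightarrow> 'u) set) \<subseteq> cfun.span T"
      using finite_span_periodic[OF N B] by blast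
    have "periodic N \<subseteq> f ` periodic N"
    proof (rule injective_endomorphism_surj[OF hom subspace_periodic T(2,1)])
      show "f ` periodic N \<subseteq> periodic N" using matop_periodic[OF c'(2)] f_eq by auto
      fix x assume x: "x \<in> periodic N" "f x = 0"
      obtain R where R: "\<And>m. norm (x m) \<le> R" using periodic_bounded[OF N x(1)] by blast
      have "norm (x m) \<le> \<kappa> * 0" for m
        using below[rule_format, OF c'(1), of x R 0 m] R x f_eq by simp
      then show "x = 0" by (auto simp: fun_eq_iff)
    qed
    then obtain x where x: "x \<in> periodic N" "f x = (\<lambda>m. y (wrap N m))"
      using compose_wrap_periodic[of y N] by (metis imageE subsetD)
    obtain R' where R': "\<And>m. norm (x m) \<le> R'" using periodic_bounded[OF N x(1)] by blast
    have "norm (x m) \<le> \<kappa> * R" for m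
      using below[rule_format, OF c'(1), of x R' R m] R' x f_eq[OF x(1)] y by simp
    then show ?thesis using x f_eq unfolding c'_def N_def by metis
  qed
  then obtain x where x: "\<And>n m. norm (x n m) \<le> \<kappa> * R"
    and Kx: "\<And>n. matop (pencil \<Lambda> \<mu> (\<lambda>m. c (wrap (Suc n) m))) (x n) = (\<lambda>m. y (wrap (Suc n) m))" by metis
  obtain G x' where G: "G \<noteq> bot" "G \<le> sequentially" and x': "\<And>i. x' i \<in> cball 0 (\<kappa> * R)" "\<And>i. ((\<lambda>n. x n i) \<longlongrightarrow> x' i) G"
    by (rule pointwise_cluster_point[OF U, of x "\<kappa> * R" sequentially]) (use x in auto)
  have ev: "eventually (\<lambda>n. wrap (Suc n) m = m) G" for m :: "int ^ 'n"
  proof (rule filter_leD[OF G(2)])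
    show "eventually (\<lambda>n. wrap (Suc n) m = m) sequentially"
      using eventually_ge_at_top[of "nat (csize m)"] by eventually_elim (rule wrap_eq_self, linarith)
  qed
  have "matop (pencil \<Lambda> \<mu> c) x' i = y i" for i
  proof (rule tendsto_unique[OF G(1)])
    show "((\<lambda>n. matop (pencil \<Lambda> \<mu> (\<lambda>m. c (wrap (Suc n) m))) (x n) i) \<longlongrightarrow> matop (pencil \<Lambda> \<mu> c) x' i) G"
    proof (rule matop_pencil_tendsto[OF \<Lambda>(1) _ x _ x'(2) G(1)])
      show "norm (c (wrap (Suc n) m)) \<le> S" for n m using S c by blast
      show "((\<lambda>n. c (wrap (Suc n) j)) \<longlongrightarrow> c j) G" for j
        by (rule tendsto_eventually, rule eventually_mono[OF ev[of j]]) simp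
    qed
    show "((\<lambda>n. matop (pencil \<Lambda> \<mu> (\<lambda>m. c (wrap (Suc n) m))) (x n) i) \<longlongrightarrow> y i) G"
      unfolding Kx by (rule tendsto_eventually, rule eventually_mono[OF ev[of i]]) simp
  qed
  then show ?thesis using x'(1) by (intro exI[of _ x']) auto
qed

section \<open>The open mapping argument for Fredholm operators\<close>

context exponent
begin

lemma zero_in_Y: "0 \<in> Y p"
  by (rule ballY_finite_support) simp

lemma normY_zero: "normY p (0 :: int ^ 'n::finite \<Rightarrow> 'u::real_normed_vector) = 0"
proof -
  have "(0 :: int ^ 'n \<Rightarrow> 'u) \<in> ballY p (0 * normY p (0 :: int ^ 'n \<Rightarrow> 'u))"
    by (rule ballY_scaleR[OF ballY_normY[OF zero_in_Y]]) auto
  moreover have "0 \<le> normY p (0 :: int ^ 'n \<Rightarrow> 'u)" by (rule normY_nonneg[OF zero_in_Y])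
  ultimately show ?thesis by (simp add: ballY_def)
qed

lemma normY_eq_0D: "x \<in> Y p \<Longrightarrow> normY p x = 0 \<Longrightarrow> x = 0"
  using ballY_coord[OF ballY_normY] by (fastforce simp: fun_eq_iff)

lemma Y_add:
  assumes "x \<in> Y p" "y \<in> Y p"
  shows "x + y \<in> Y p" "normY p (x + y) \<le> normY p x + normY p y"
  using ballY_add[OF ballY_normY[OF assms(1)] ballY_normY[OF assms(2)], of "x + y"]
  by (auto simp: ballY_def norm_triangle_ineq)

lemma Y_diff:
  assumes "x \<in> Y p" "y \<in> Y p"
  shows "x - y \<in> Y p" "normY p (x - y) \<le> normY p x + normY p y"
  using ballY_add[OF ballY_normY[OF assms(1)] ballY_normY[OF assms(2)], of "x - y"]
  by (auto simp: ballY_def norm_triangle_ineq4)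

lemma Y_scaleF:
  assumes "x \<in> Y p"
  shows "scaleF r x \<in> Y p" "normY p (scaleF r x) \<le> cmod r * normY p x"
  using ballY_scaleR[OF ballY_normY[OF assms], of "scaleF r x" "cmod r"]
  by (auto simp: ballY_def scaleF_def norm_scaleC)

lemma Y_sum:
  fixes f :: "'i \<Rightarrow> int ^ 'n::finite \<Rightarrow> 'u::real_normed_vector"
  assumes "finite I" "\<And>i. i \<in> I \<Longrightarrow> f i \<in> Y p"
  shows "(\<Sum>i\<in>I. f i) \<in> Y p" "normY p (\<Sum>i\<in>I. f i) \<le> (\<Sum>i\<in>I. normY p (f i))"
proof -
  have "(\<Sum>i\<in>I. f i) \<in> Y p \<and> normY p (\<Sum>i\<in>I. f i) \<le> (\<Sum>i\<in>I. normY p (f i))"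
    using assms
  proof (induction I rule: finite_induct)
    case empty
    have "sum f {} \<in> Y p \<and> normY p (sum f {}) \<le> (\<Sum>i\<in>{}. normY p (f i))"
      by (simp add: zero_in_Y normY_zero)
    then show ?case .
  next
    case (insert i I)
    then have fi: "f i \<in> Y p" and IH: "sum f I \<in> Y p" "normY p (sum f I) \<le> (\<Sum>i\<in>I. normY p (f i))" by auto
    have e: "sum f (insert i I) = f i + sum f I" using insert.hyps by (rule sum.insert)
    have "sum f (insert i I) \<in> Y p \<and> normY p (sum f (insert i I)) \<le> (\<Sum>i\<in>insert i I. normY p (f i))"
      unfolding e sum.insert[OF insert.hyps] using Y_add[OF fi IH(1)] IH(2) by simp
    then show ?case .
  qed
  then show "(\<Sum>i\<in>I. f i) \<in> Y p" "normY p (\<Sum>i\<in>I. f i) \<le> (\<Sum>i\<in>I. normY p (f i))" by auto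
qed

lemma subspace_Y: "cfun.subspace (Y p)"
  using zero_in_Y Y_add Y_scaleF by (auto simp: cfun.subspace_def)

lemma normY_minus_commute: "normY p (x - y) = normY p (y - x)"
  by (simp add: normY_def norm_minus_commute)

text \<open>A Cauchy sequence converges uniformly, hence pointwise. The difference to the limit is, up to a small
  uniform error, a difference of two members of the sequence.\<close>

lemma Y_complete:
  fixes \<sigma> :: "nat \<Rightarrow> int ^ 'n::finite \<Rightarrow> 'u::banach"
  assumes \<sigma>: "\<And>n. \<sigma> n \<in> Y p" and cauchy: "\<And>\<epsilon>. \<epsilon> > 0 \<Longrightarrow> \<exists>N. \<forall>m\<ge>N. \<forall>n\<ge>N. normY p (\<sigma> m - \<sigma> n) < \<epsilon>"
  obtains x where "x \<in> Y p" "\<And>\<epsilon>. \<epsilon> > 0 \<Longrightarrow> \<exists>N. \<forall>n\<ge>N. normY p (\<sigma> n - x) \<le> \<epsilon>"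
proof -
  have coord: "norm (\<sigma> m k - \<sigma> n k) \<le> normY p (\<sigma> m - \<sigma> n)" for m n k
    using ballY_coord[OF ballY_normY[OF Y_diff(1)[OF \<sigma> \<sigma>]], of m n k] by simp
  have "Cauchy (\<lambda>n. \<sigma> n k)" for k
  proof (rule CauchyI)
    fix e :: real assume "e > 0"
    from cauchy[OF this] coord show "\<exists>M. \<forall>m\<ge>M. \<forall>n\<ge>M. norm (\<sigma> m k - \<sigma> n k) < e" by (meson le_less_trans)
  qed
  then have "\<exists>l. (\<lambda>n. \<sigma> n k) \<longlonglongrightarrow> l" for k by (simp add: Cauchy_convergent_iff convergent_def)
  then obtain x where x: "\<And>k. (\<lambda>n. \<sigma> n k) \<longlonglongrightarrow> x k" by metis
  have unif: "norm (\<sigma> n k - x k) \<le> \<epsilon>" if "\<And>m. m \<ge> N \<Longrightarrow> normY p (\<sigma> n - \<sigma> m) \<le> \<epsilon>" for n k \<epsilon> N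
  proof (rule tendsto_upperbound)
    show "(\<lambda>m. norm (\<sigma> n k - \<sigma> m k)) \<longlonglongrightarrow> norm (\<sigma> n k - x k)" by (intro tendsto_intros x)
    show "\<forall>\<^sub>F m in sequentially. norm (\<sigma> n k - \<sigma> m k) \<le> \<epsilon>"
      using eventually_ge_at_top[of N] by eventually_elim (use that coord order_trans in blast)
  qed simp
  have conv: "\<sigma> n - x \<in> ballY p \<epsilon>" if n: "\<And>m. m \<ge> N \<Longrightarrow> normY p (\<sigma> n - \<sigma> m) \<le> \<epsilon>" for n \<epsilon> N
  proof (rule ballY_approximable)
    fix \<delta> :: real assume "\<delta> > 0"
    from cauchy[OF this] obtain N' where N': "\<And>m m'. m \<ge> N' \<Longrightarrow> m' \<ge> N' \<Longrightarrow> normY p (\<sigma> m - \<sigma> m') < \<delta>" by blast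
    define m where "m = max N N'"
    have m: "norm (\<sigma> m k - x k) \<le> \<delta>" for k
      by (rule unif[of N']) (use N' in \<open>auto simp: m_def less_imp_le\<close>)
    have "\<sigma> n - \<sigma> m \<in> ballY p \<epsilon>" using n[of m] Y_diff(1)[OF \<sigma> \<sigma>] by (simp add: ballY_def m_def)
    then have "(\<lambda>k. norm ((\<sigma> n - \<sigma> m) k)) \<in> ballY p \<epsilon>" by (simp only: ballY_norm_iff)
    moreover have "norm ((\<sigma> n - x) k) \<le> norm (norm ((\<sigma> n - \<sigma> m) k)) + \<delta>" for k
      using norm_triangle_ineq[of "\<sigma> n k - \<sigma> m k" "\<sigma> m k - x k"] m[of k] by simp
    ultimately show "\<exists>g::int ^ 'n \<Rightarrow> real. g \<in> ballY p \<epsilon> \<and> (\<forall>k. norm ((\<sigma> n - x) k) \<le> norm (g k) + \<delta>)" by blast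
  qed
  have conv': "\<exists>N. \<forall>n\<ge>N. \<sigma> n - x \<in> ballY p \<epsilon>" if "\<epsilon> > 0" for \<epsilon>
    using cauchy[OF that] conv less_imp_le by meson
  obtain n where "\<sigma> n - x \<in> ballY p 1" using conv'[of 1] by auto
  then have "\<sigma> n - x \<in> Y p" by (simp add: ballY_def)
  then have "\<sigma> n - (\<sigma> n - x) \<in> Y p" by (rule Y_diff(1)[OF \<sigma>])
  then have "x \<in> Y p" by simp
  moreover have "\<exists>N. \<forall>n\<ge>N. normY p (\<sigma> n - x) \<le> \<epsilon>" if "\<epsilon> > 0" for \<epsilon>
    using conv'[OF that] unfolding ballY_def by blast
  ultimately show thesis using that by blast
qed

text \<open>A metric has to be nonnegative for all arguments, also outside the space; hence the absolute value.\<close>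

definition distY :: "(int ^ 'n::finite \<Rightarrow> 'u::real_normed_vector) \<Rightarrow> (int ^ 'n \<Rightarrow> 'u) \<Rightarrow> real"
  where "distY x y = \<bar>normY p (x - y)\<bar>"

lemma distY_eq: "x \<in> Y p \<Longrightarrow> y \<in> Y p \<Longrightarrow> distY x y = normY p (x - y)"
  unfolding distY_def by (rule abs_of_nonneg[OF normY_nonneg[OF Y_diff(1)]])

lemma Metric_space_Y: "Metric_space (Y p) distY"
proof
  fix x y z :: "int ^ 'n::finite \<Rightarrow> 'u::real_normed_vector"
  show "0 \<le> distY x y" by (simp add: distY_def)
  show "distY x y = distY y x" by (simp add: distY_def normY_minus_commute)
  assume xy: "x \<in> Y p" "y \<in> Y p"
  then show "distY x y = 0 \<longleftrightarrow> x = y"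
    using normY_eq_0D[OF Y_diff(1)[OF xy]] by (auto simp: distY_def normY_zero)
  assume z: "z \<in> Y p"
  show "distY x z \<le> distY x y + distY y z"
    using xy z Y_add(2)[OF Y_diff(1)[OF xy] Y_diff(1)[OF xy(2) z]] by (simp add: distY_eq)
qed

lemma mcomplete_Y: "Metric_space.mcomplete (Y p :: (int ^ 'n::finite \<Rightarrow> 'u::banach) set) distY"
proof -
  interpret M: Metric_space "Y p :: (int ^ 'n \<Rightarrow> 'u) set" distY by (rule Metric_space_Y)
  show ?thesis
    unfolding M.mcomplete_def
  proof (intro allI impI)
    fix \<sigma> :: "nat \<Rightarrow> int ^ 'n \<Rightarrow> 'u"
    assume "M.MCauchy \<sigma>"
    then have \<sigma>: "\<And>n. \<sigma> n \<in> Y p" and c: "\<And>\<epsilon>. \<epsilon> > 0 \<Longrightarrow> \<exists>N. \<forall>n n'. N \<le> n \<longrightarrow> N \<le> n' \<longrightarrow> distY (\<sigma> n) (\<sigma> n') < \<epsilon>"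
      unfolding M.MCauchy_def by auto
    have c': "\<exists>N. \<forall>m\<ge>N. \<forall>n\<ge>N. normY p (\<sigma> m - \<sigma> n) < \<epsilon>" if "\<epsilon> > 0" for \<epsilon>
      using c[OF that] \<sigma> by (simp add: distY_eq)
    obtain x where x: "x \<in> Y p" "\<And>\<epsilon>. \<epsilon> > 0 \<Longrightarrow> \<exists>N. \<forall>n\<ge>N. normY p (\<sigma> n - x) \<le> \<epsilon>"
      using Y_complete[OF \<sigma> c'] by blast
    have "limitin M.mtopology \<sigma> x sequentially"
      unfolding M.limitin_metric
    proof (intro conjI allI impI x(1))
      fix \<epsilon> :: real assume "\<epsilon> > 0"
      then obtain N where "\<forall>n\<ge>N. normY p (\<sigma> n - x) \<le> \<epsilon> / 2" using x(2)[of "\<epsilon> / 2"] by auto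
      then show "\<forall>\<^sub>F n in sequentially. \<sigma> n \<in> Y p \<and> distY (\<sigma> n) x < \<epsilon>"
        using \<sigma> x(1) \<open>\<epsilon> > 0\<close> unfolding eventually_sequentially by (force simp: distY_eq)
    qed
    then show "\<exists>x. limitin M.mtopology \<sigma> x sequentially" by blast
  qed
qed

text \<open>Let \<open>B\<close> be a finite set that spans \<open>Y p\<close> together with the range \<open>R\<close> of \<open>T\<close>, of least cardinality; then
  the span of \<open>B\<close> meets \<open>R\<close> only in \<open>0\<close>. The map from \<open>Y p\<close> and coefficient vectors \<open>\<beta>\<close> to \<open>Y p\<close> given by
  \<open>T u + s \<beta>\<close>, with \<open>s \<beta>\<close> the combination of \<open>B\<close>, is onto, so the open mapping argument provides
  solutions of \<open>y = T u + s \<beta>\<close> that are bounded by the norm of \<open>y\<close>. For \<open>y\<close> in \<open>R\<close> the second summand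
  vanishes.\<close>

lemma fredholm_bounded_below:
  fixes T :: "('n::finite, 'u::{complex_normed_vector,banach}) seq_op"
  assumes "fredholm_op p T"
  shows "\<exists>K\<ge>0. \<forall>x\<in>Y p. \<exists>u\<in>Y p. T u = T x \<and> normY p u \<le> K * normY p (T x)"
proof -
  have T_Y: "T x \<in> Y p" if "x \<in> Y p" for x
    using assms that by (auto simp: fredholm_op_def bounded_op_def)
  have T_add: "T (x + y) = T x + T y" if "x \<in> Y p" "y \<in> Y p" for x y
    using assms that by (auto simp: fredholm_op_def bounded_op_def)
  have T_scale: "T (scaleF c x) = scaleF c (T x)" if "x \<in> Y p" for c x
    using assms that by (auto simp: fredholm_op_def bounded_op_def)
  have T_diff: "T (x - y) = T x - T y" if "x \<in> Y p" "y \<in> Y p" for x y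
    using T_add[OF Y_diff(1)[OF that] that(2)] by (simp add: eq_diff_eq)
  obtain KT where KT: "\<And>x. x \<in> Y p \<Longrightarrow> normY p (T x) \<le> KT * normY p x"
    using assms unfolding fredholm_op_def bounded_op_def by blast
  define R where "R = T ` Y p"
  have R: "cfun.subspace R"
    unfolding cfun.subspace_def
  proof (intro conjI ballI allI)
    have "T 0 = 0" using T_scale[OF zero_in_Y, of 0] by simp
    then show "0 \<in> R" unfolding R_def using zero_in_Y by (metis imageI)
  next
    fix x y assume "x \<in> R" "y \<in> R"
    then obtain u v where uv: "x = T u" "y = T v" "u \<in> Y p" "v \<in> Y p" unfolding R_def by blast
    then have "x + y = T (u + v)" by (simp add: T_add)
    then show "x + y \<in> R" unfolding R_def using Y_add(1)[OF uv(3,4)] by blast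
  next
    fix c x assume "x \<in> R"
    then obtain u where u: "x = T u" "u \<in> Y p" unfolding R_def by blast
    then have "scaleF c x = T (scaleF c u)" by (simp add: T_scale)
    then show "scaleF c x \<in> R" unfolding R_def using Y_scaleF(1)[OF u(2)] by blast
  qed
  obtain B0 where "finite B0 \<and> cfun.span (R \<union> B0) = Y p" using assms by (auto simp: fredholm_op_def R_def)
  from ex_has_least_nat[of "\<lambda>B. finite B \<and> cfun.span (R \<union> B) = Y p", OF this, of card]
  obtain B where B: "finite B" "cfun.span (R \<union> B) = Y p"
    and least: "\<And>B'. finite B' \<Longrightarrow> cfun.span (R \<union> B') = Y p \<Longrightarrow> card B \<le> card B'" by auto
  have BY: "b \<in> Y p" if "b \<in> B" for b using B(2) cfun.span_base[of b "R \<union> B"] that by blast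
  define s where "s \<beta> = (\<Sum>b\<in>B. scaleF (\<beta> b) b)" for \<beta>
  have s_Y: "s \<beta> \<in> Y p" for \<beta> unfolding s_def by (intro Y_sum(1) B(1) Y_scaleF(1) BY)
  \<comment> \<open>Otherwise some element of \<open>B\<close> lies in the span of \<open>R\<close> and the other elements.\<close>
  have transversal: "s \<beta> = 0" if sR: "s \<beta> \<in> R" for \<beta>
  proof (rule ccontr)
    assume "s \<beta> \<noteq> 0"
    then obtain b where b: "b \<in> B" "\<beta> b \<noteq> 0"
      unfolding s_def by (metis (mono_tags, lifting) cfun.scale_eq_0_iff sum.neutral)
    let ?B = "B - {b}"
    have "s \<beta> = scaleF (\<beta> b) b + (\<Sum>b\<in>?B. scaleF (\<beta> b) b)"
      unfolding s_def using B(1) b(1) by (rule sum.remove)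
    then have "scaleF (\<beta> b) b = s \<beta> - (\<Sum>b\<in>?B. scaleF (\<beta> b) b)" by simp
    also have "\<dots> \<in> cfun.span (R \<union> ?B)"
      using sR by (intro cfun.span_diff cfun.span_sum cfun.span_scale cfun.span_base) auto
    finally have "scaleF (inverse (\<beta> b)) (scaleF (\<beta> b) b) \<in> cfun.span (R \<union> ?B)" by (rule cfun.span_scale)
    then have "b \<in> cfun.span (R \<union> ?B)" using b by simp
    then have "cfun.span (insert b (R \<union> ?B)) = cfun.span (R \<union> ?B)" by (rule cfun.span_redundant)
    moreover have "insert b (R \<union> ?B) = R \<union> B" using b by auto
    ultimately have "card B \<le> card ?B" using least[of ?B] B by simp
    then show False using b B(1) by (metis card_Diff1_less not_less)
  qed
  define Q where "Q n = {T u + s \<beta> | u \<beta>. u \<in> Y p \<and> normY p u \<le> real n \<and> (\<forall>b\<in>B. cmod (\<beta> b) \<le> real n)}" for n :: nat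
  have Q_Y: "Q n \<subseteq> Y p" for n unfolding Q_def using T_Y s_Y Y_add(1) by auto
  have cover: "Y p = (\<Union>n. Q n)"
  proof (intro equalityI subsetI)
    fix y :: "int ^ 'n \<Rightarrow> 'u" assume "y \<in> Y p"
    then have "y \<in> cfun.span (R \<union> B)" using B by simp
    then obtain v w where vw: "y = v + w" "v \<in> cfun.span R" "w \<in> cfun.span B" by (auto simp: cfun.span_Un)
    obtain \<beta> where w: "w = s \<beta>" using vw(3) B(1) by (auto simp: cfun.span_finite s_def)
    have "v \<in> R" using vw(2) R cfun.span_eq_iff by blast
    then obtain u where u: "v = T u" "u \<in> Y p" by (auto simp: R_def)
    obtain n where n: "normY p u + (\<Sum>b\<in>B. cmod (\<beta> b)) \<le> real n" using real_arch_simple by blast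
    have "cmod (\<beta> b) \<le> (\<Sum>b\<in>B. cmod (\<beta> b))" if "b \<in> B" for b using B(1) that by (intro member_le_sum) auto
    moreover have "0 \<le> normY p u" "0 \<le> (\<Sum>b\<in>B. cmod (\<beta> b))" using normY_nonneg u by (auto intro: sum_nonneg)
    ultimately have "y \<in> Q n" unfolding Q_def using vw(1) w u n by fastforce
    then show "y \<in> (\<Union>n. Q n)" by blast
  qed (use Q_Y in blast)
  interpret M: Metric_space "Y p :: (int ^ 'n \<Rightarrow> 'u) set" distY by (rule Metric_space_Y)
  have "\<exists>n. M.mtopology interior_of (M.mtopology closure_of (Q n)) \<noteq> {}"
  proof (rule ccontr)
    assume "\<not> ?thesis"
    then have "M.mtopology interior_of (\<Union>(range (\<lambda>n. M.mtopology closure_of (Q n)))) = {}"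
      by (intro M.metric_Baire_category_alt mcomplete_Y) auto
    moreover have "(\<Union>(range (\<lambda>n. M.mtopology closure_of (Q n)))) = Y p"
    proof (rule antisym)
      show "(\<Union>(range (\<lambda>n. M.mtopology closure_of (Q n)))) \<subseteq> Y p"
        using closure_of_subset_topspace[of M.mtopology] by auto
      show "Y p \<subseteq> (\<Union>(range (\<lambda>n. M.mtopology closure_of (Q n))))"
      proof
        fix y :: "int ^ 'n \<Rightarrow> 'u" assume "y \<in> Y p"
        then obtain n where "y \<in> Q n" using cover by blast
        moreover have "Q n \<subseteq> M.mtopology closure_of (Q n)" using Q_Y by (intro closure_of_subset) simp
        ultimately show "y \<in> (\<Union>(range (\<lambda>n. M.mtopology closure_of (Q n))))" by blast
      qed
    qed
    ultimately have "M.mtopology interior_of (Y p) = {}" by simp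
    then show False using interior_of_topspace[of M.mtopology] zero_in_Y by auto
  qed
  then obtain n y0 where int: "y0 \<in> M.mtopology interior_of (M.mtopology closure_of (Q n))" by blast
  have "openin M.mtopology (M.mtopology interior_of (M.mtopology closure_of (Q n)))" by (rule openin_interior_of)
  then obtain r where r0: "r > 0" "M.mball y0 r \<subseteq> M.mtopology interior_of (M.mtopology closure_of (Q n))"
    and y0: "y0 \<in> Y p"
    unfolding M.openin_mtopology using int by blast
  then have r: "r > 0" "M.mball y0 r \<subseteq> M.mtopology closure_of (Q n)"
    using interior_of_subset[of M.mtopology "M.mtopology closure_of (Q n)"] by blast+
  \<comment> \<open>By Baire's theorem the closure of some \<open>Q n\<close> contains a ball. Differences of its elements
    approximate all small vectors, which scales to the approximate solvability \<open>approx\<close>.\<close>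
  have near: "\<exists>q\<in>Q n. normY p (z - q) < \<epsilon>" if z: "z \<in> Y p" "normY p (z - y0) < r" and "\<epsilon> > 0" for z \<epsilon>
  proof -
    have "z \<in> M.mball y0 r" using z y0 by (simp add: M.in_mball distY_eq normY_minus_commute[of z])
    then have "z \<in> M.mtopology closure_of (Q n)" using r by blast
    then obtain q where "q \<in> Q n" "q \<in> M.mball z \<epsilon>" using \<open>\<epsilon> > 0\<close> by (auto simp: M.metric_closure_of)
    then show ?thesis using z by (auto simp: M.in_mball distY_eq)
  qed
  define K0 where "K0 = 4 * real n / r"
  have K0: "K0 \<ge> 0" using r by (simp add: K0_def)
  have approx: "\<exists>u \<beta>. u \<in> Y p \<and> normY p u \<le> K0 * normY p y \<and> (\<forall>b\<in>B. cmod (\<beta> b) \<le> K0 * normY p y) \<and>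
      normY p (y - (T u + s \<beta>)) \<le> normY p y / 2" if y: "y \<in> Y p" for y
  proof (cases "normY p y = 0")
    case True
    then have "y = 0" using normY_eq_0D y by blast
    moreover have "s (\<lambda>_. 0) = 0" by (simp add: s_def)
    moreover have "T 0 = 0" using T_scale[OF zero_in_Y, of 0] by simp
    ultimately show ?thesis
      by (intro exI[of _ 0] exI[of _ "\<lambda>_. 0"]) (simp add: zero_in_Y normY_zero)
  next
    case False
    then have ny: "normY p y > 0" using normY_nonneg[OF y] by simp
    define t where "t = r / (2 * normY p y)"
    have t: "t > 0" using r ny by (simp add: t_def)
    define z where "z = scaleF (complex_of_real t) y"
    have z: "z \<in> Y p" "normY p z \<le> r / 2"
    proof -
      have "normY p z \<le> t * normY p y"
        unfolding z_def using Y_scaleF(2)[OF y, of "complex_of_real t"] t by simp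
      also have "\<dots> = r / 2" using ny by (simp add: t_def)
      finally show "normY p z \<le> r / 2" .
    qed (simp add: z_def Y_scaleF(1)[OF y])
    obtain q1 where q1: "q1 \<in> Q n" "normY p (y0 + z - q1) < r / 8"
      using near[of "y0 + z" "r / 8"] Y_add(1)[OF y0 z(1)] z(2) r by auto
    obtain q2 where q2: "q2 \<in> Q n" "normY p (y0 - q2) < r / 8"
      using near[of y0 "r / 8"] y0 r by (auto simp: normY_zero)
    obtain u1 \<beta>1 where 1: "q1 = T u1 + s \<beta>1" "u1 \<in> Y p" "normY p u1 \<le> real n" "\<And>b. b \<in> B \<Longrightarrow> cmod (\<beta>1 b) \<le> real n"
      using q1 by (auto simp: Q_def)
    obtain u2 \<beta>2 where 2: "q2 = T u2 + s \<beta>2" "u2 \<in> Y p" "normY p u2 \<le> real n" "\<And>b. b \<in> B \<Longrightarrow> cmod (\<beta>2 b) \<le> real n"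
      using q2 by (auto simp: Q_def)
    have q12: "q1 - q2 = T (u1 - u2) + s (\<lambda>b. \<beta>1 b - \<beta>2 b)"
      using 1 2 by (simp add: T_diff s_def cfun.scale_left_diff_distrib sum_subtractf)
    have qY: "q1 \<in> Y p" "q2 \<in> Y p" using q1 q2 Q_Y by auto
    have zeq: "z - (q1 - q2) = (y0 + z - q1) - (y0 - q2)" by (simp add: fun_eq_iff)
    have "normY p (z - (q1 - q2)) \<le> normY p (y0 + z - q1) + normY p (y0 - q2)"
      unfolding zeq by (rule Y_diff(2)[OF Y_diff(1)[OF Y_add(1)[OF y0 z(1)] qY(1)] Y_diff(1)[OF y0 qY(2)]])
    then have zq: "normY p (z - (q1 - q2)) \<le> r / 4" using q1(2) q2(2) by linarith
    define u where "u = scaleF (complex_of_real (1 / t)) (u1 - u2)"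
    define \<beta> where "\<beta> b = complex_of_real (1 / t) * (\<beta>1 b - \<beta>2 b)" for b
    have tt: "1 / t = 2 * normY p y / r" by (simp add: t_def)
    have "u \<in> Y p" unfolding u_def by (intro Y_scaleF(1) Y_diff(1) 1 2)
    moreover have "normY p u \<le> K0 * normY p y"
    proof -
      have "normY p u \<le> cmod (complex_of_real (1 / t)) * normY p (u1 - u2)"
        unfolding u_def by (rule Y_scaleF(2)[OF Y_diff(1)[OF 1(2) 2(2)]])
      also have "\<dots> \<le> (1 / t) * (real n + real n)"
        using t 1 2 Y_diff(2)[OF 1(2) 2(2)] by (intro mult_mono) (auto intro!: normY_nonneg Y_diff(1) simp: norm_divide)
      also have "\<dots> = K0 * normY p y" unfolding tt by (simp add: K0_def)
      finally show ?thesis .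
    qed
    moreover have "cmod (\<beta> b) \<le> K0 * normY p y" if "b \<in> B" for b
    proof -
      have "cmod (\<beta> b) = (1 / t) * cmod (\<beta>1 b - \<beta>2 b)" using t by (simp add: \<beta>_def norm_mult norm_divide)
      also have "\<dots> \<le> (1 / t) * (real n + real n)"
        using t 1(4)[OF that] 2(4)[OF that] norm_triangle_ineq4[of "\<beta>1 b" "\<beta>2 b"] by (intro mult_left_mono) auto
      also have "\<dots> = K0 * normY p y" unfolding tt by (simp add: K0_def)
      finally show ?thesis .
    qed
    moreover have "normY p (y - (T u + s \<beta>)) \<le> normY p y / 2"
    proof -
      have "y = scaleF (complex_of_real (1 / t)) z" using t by (simp add: z_def)
      moreover have "T u = scaleF (complex_of_real (1 / t)) (T (u1 - u2))"
        unfolding u_def by (rule T_scale[OF Y_diff(1)[OF 1(2) 2(2)]])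
      moreover have "s \<beta> = scaleF (complex_of_real (1 / t)) (s (\<lambda>b. \<beta>1 b - \<beta>2 b))"
        by (simp add: s_def \<beta>_def cfun.scale_sum_right)
      ultimately have "y - (T u + s \<beta>) = scaleF (complex_of_real (1 / t)) (z - (q1 - q2))"
        unfolding q12 by (simp add: cfun.scale_right_diff_distrib cfun.scale_right_distrib)
      then have "normY p (y - (T u + s \<beta>)) \<le> (1 / t) * normY p (z - (q1 - q2))"
        using Y_scaleF(2)[OF Y_diff(1)[OF z(1) Y_diff(1)[OF qY]], of "complex_of_real (1 / t)"] t by (simp add: norm_divide)
      also have "\<dots> \<le> (1 / t) * (r / 4)" using zq t by (intro mult_left_mono) auto
      also have "\<dots> = normY p y / 2" using r unfolding tt by simp
      finally show ?thesis .
    qed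
    ultimately show ?thesis by blast
  qed
  then obtain U \<beta>f where U: "\<And>y. y \<in> Y p \<Longrightarrow> U y \<in> Y p" "\<And>y. y \<in> Y p \<Longrightarrow> normY p (U y) \<le> K0 * normY p y"
    and \<beta>f: "\<And>y b. y \<in> Y p \<Longrightarrow> b \<in> B \<Longrightarrow> cmod (\<beta>f y b) \<le> K0 * normY p y"
    and half: "\<And>y. y \<in> Y p \<Longrightarrow> normY p (y - (T (U y) + s (\<beta>f y))) \<le> normY p y / 2"
    by metis
  \<comment> \<open>Repeated correction of the remaining error, which is halved in each step.\<close>
  have main: "\<exists>u \<beta>. u \<in> Y p \<and> normY p u \<le> 2 * K0 * normY p y \<and> y = T u + s \<beta>" if y: "y \<in> Y p" for y
  proof -
    define w where "w = rec_nat y (\<lambda>_ v. v - (T (U v) + s (\<beta>f v)))"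
    have w0: "w 0 = y" and wS: "w (Suc k) = w k - (T (U (w k)) + s (\<beta>f (w k)))" for k by (simp_all add: w_def)
    have wY: "w k \<in> Y p" for k
    proof (induction k)
      case 0 then show ?case using y by (simp add: w0)
    next
      case (Suc k)
      then show ?case unfolding wS by (intro Y_diff(1) Y_add(1) T_Y s_Y U(1))
    qed
    have w_small: "normY p (w k) \<le> normY p y * (1 / 2) ^ k" for k
    proof (induction k)
      case (Suc k)
      then have "normY p (w (Suc k)) \<le> normY p y * (1 / 2) ^ Suc k" using half[OF wY[of k]] by (simp add: wS)
      then show ?case .
    qed (simp add: w0)
    define N where "N = normY p y"
    have N: "N \<ge> 0" using normY_nonneg[OF y] by (simp add: N_def)
    define g where "g k = (\<Sum>j<k. U (w j))" for k
    define \<gamma> where "\<gamma> k b = (\<Sum>j<k. \<beta>f (w j) b)" for k b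
    have gY: "g k \<in> Y p" for k unfolding g_def by (intro Y_sum(1) U(1) wY) simp
    have wk: "w k = y - (T (g k) + s (\<gamma> k))" for k
    proof (induction k)
      case 0
      have "T 0 = 0" using T_scale[OF zero_in_Y, of 0] by simp
      then have "w 0 = y - (T (g 0) + s (\<gamma> 0))" by (simp add: w0 g_def \<gamma>_def s_def)
      then show ?case .
    next
      case (Suc k)
      have "T (g (Suc k)) = T (g k) + T (U (w k))" using T_add[OF gY[of k] U(1)[OF wY[of k]]] by (simp add: g_def)
      moreover have "s (\<gamma> (Suc k)) = s (\<gamma> k) + s (\<beta>f (w k))"
        by (simp add: s_def \<gamma>_def cfun.scale_left_distrib sum.distrib)
      ultimately have "w (Suc k) = y - (T (g (Suc k)) + s (\<gamma> (Suc k)))"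
        using Suc unfolding wS by (metis (no_types, opaque_lifting) add.assoc add.left_commute diff_diff_eq)
      then show ?case .
    qed
    have geo: "(\<Sum>j\<in>{m..<m'}. K0 * N * (1 / 2) ^ j) \<le> 2 * K0 * N * (1 / 2) ^ m" if "m \<le> m'" for m m'
    proof -
      have "(\<Sum>j\<in>{m..<m'}. K0 * N * (1 / 2) ^ j) = K0 * N * (2 * (1 / 2) ^ m - 2 * (1 / 2) ^ m')"
        using that by (induction m' rule: dec_induct) (simp_all add: algebra_simps)
      also have "\<dots> \<le> K0 * N * (2 * (1 / 2) ^ m)" using K0 N by (intro mult_left_mono) auto
      finally show ?thesis by (simp add: algebra_simps)
    qed
    have Uw: "normY p (U (w j)) \<le> K0 * N * (1 / 2) ^ j" for j
      using U(2)[OF wY[of j]] mult_left_mono[OF w_small[of j] K0] by (simp add: N_def mult.assoc)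
    have g_diff: "normY p (g m' - g m) \<le> 2 * K0 * N * (1 / 2) ^ m" if "m \<le> m'" for m m'
    proof -
      have "g m' - g m = (\<Sum>j\<in>{m..<m'}. U (w j))"
        unfolding g_def using that by (simp add: lessThan_atLeast0 sum_diff_nat_ivl)
      then have "normY p (g m' - g m) \<le> (\<Sum>j\<in>{m..<m'}. normY p (U (w j)))"
        using Y_sum(2)[of "{m..<m'}" "\<lambda>j. U (w j)"] U(1)[OF wY] by simp
      also have "\<dots> \<le> (\<Sum>j\<in>{m..<m'}. K0 * N * (1 / 2) ^ j)" by (intro sum_mono Uw)
      finally show ?thesis using geo[OF that] by simp
    qed
    have small: "\<exists>k. \<forall>m\<ge>k. 2 * K0 * N * (1 / 2) ^ m < \<epsilon>" if "\<epsilon> > 0" for \<epsilon> :: real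
    proof -
      have "(\<lambda>m. 2 * K0 * N * (1 / 2) ^ m) \<longlonglongrightarrow> 2 * K0 * N * 0" by (intro tendsto_mult tendsto_const LIMSEQ_power_zero) simp
      then have "\<forall>\<^sub>F m in sequentially. 2 * K0 * N * (1 / 2) ^ m < \<epsilon>"
        using that by (intro order_tendstoD(2)) auto
      then show ?thesis by (simp add: eventually_sequentially)
    qed
    have "\<exists>k. \<forall>m\<ge>k. \<forall>m'\<ge>k. normY p (g m - g m') < \<epsilon>" if \<epsilon>: "\<epsilon> > 0" for \<epsilon>
    proof -
      obtain k where k: "\<forall>m\<ge>k. 2 * K0 * N * (1 / 2) ^ m < \<epsilon>" using small[OF \<epsilon>] by blast
      have "normY p (g m - g m') < \<epsilon>" if "m \<ge> k" "m' \<ge> k" for m m'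
        using g_diff[of m m'] g_diff[of m' m] k that normY_minus_commute[of "g m" "g m'"]
        by (cases "m \<le> m'") (auto intro: le_less_trans)
      then show ?thesis by blast
    qed
    then obtain u where u: "u \<in> Y p" "\<And>\<epsilon>. \<epsilon> > 0 \<Longrightarrow> \<exists>k. \<forall>m\<ge>k. normY p (g m - u) \<le> \<epsilon>"
      using Y_complete[of g] gY by blast
    have gd: "g k - u \<in> Y p" for k by (rule Y_diff(1)[OF gY u(1)])
    have g_lim: "(\<lambda>m. normY p (g m - u)) \<longlonglongrightarrow> 0"
    proof (rule LIMSEQ_I)
      fix e :: real assume "e > 0"
      then obtain k where "\<forall>m\<ge>k. normY p (g m - u) \<le> e / 2" using u(2)[of "e / 2"] by auto
      then show "\<exists>k. \<forall>m\<ge>k. norm (normY p (g m - u) - 0) < e"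
        using normY_nonneg[OF gd] \<open>e > 0\<close> by (intro exI[of _ k]) fastforce
    qed
    have "\<exists>l. (\<lambda>k. \<gamma> k b) \<longlonglongrightarrow> l" if b: "b \<in> B" for b
    proof -
      have le: "cmod (\<beta>f (w j) b) \<le> K0 * N * (1 / 2) ^ j" for j
        using \<beta>f[OF wY[of j] b] mult_left_mono[OF w_small[of j] K0] by (simp add: N_def mult.assoc)
      have "summable (\<lambda>j. K0 * N * (1 / 2) ^ j :: real)" by (intro summable_mult summable_geometric) simp
      then have "summable (\<lambda>j. \<beta>f (w j) b)" by (rule summable_comparison_test'[of _ 0]) (rule le)
      then show ?thesis unfolding \<gamma>_def summable_def sums_def .
    qed
    then obtain \<beta> where \<beta>: "\<And>b. b \<in> B \<Longrightarrow> (\<lambda>k. \<gamma> k b) \<longlonglongrightarrow> \<beta> b" by metis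
    have "normY p u \<le> 2 * K0 * N"
    proof (rule tendsto_lowerbound)
      show "(\<lambda>k. 2 * K0 * N + normY p (g k - u)) \<longlonglongrightarrow> 2 * K0 * N" using tendsto_add[OF tendsto_const g_lim] by simp
      have "normY p u \<le> 2 * K0 * N + normY p (g k - u)" for k
      proof -
        have "normY p (g k - (g k - u)) \<le> normY p (g k) + normY p (g k - u)" by (rule Y_diff(2)[OF gY gd])
        moreover have "normY p (g k) \<le> 2 * K0 * N" using g_diff[of 0 k] by (simp add: g_def)
        ultimately show ?thesis by simp
      qed
      then show "\<forall>\<^sub>F k in sequentially. normY p u \<le> 2 * K0 * N + normY p (g k - u)" by simp
    qed simp
    moreover have "y - (T u + s \<beta>) = 0"
    proof (rule normY_eq_0D)
      show Yd: "y - (T u + s \<beta>) \<in> Y p" by (intro Y_diff(1) Y_add(1) y T_Y u s_Y)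
      have "normY p (y - (T u + s \<beta>)) \<le> N * (1 / 2) ^ k + KT * normY p (g k - u) + (\<Sum>b\<in>B. cmod (\<gamma> k b - \<beta> b) * normY p b)" for k
      proof -
        have sd: "s (\<lambda>b. \<gamma> k b - \<beta> b) = s (\<gamma> k) - s \<beta>"
          by (simp add: s_def cfun.scale_left_diff_distrib sum_subtractf)
        have "y - (T u + s \<beta>) = w k + T (g k - u) + s (\<lambda>b. \<gamma> k b - \<beta> b)"
          using wk[of k] T_diff[OF gY u(1)] sd by simp
        then have "normY p (y - (T u + s \<beta>)) \<le> normY p (w k) + normY p (T (g k - u)) + normY p (s (\<lambda>b. \<gamma> k b - \<beta> b))"
          using Y_add(2)[OF wY T_Y[OF gd]] Y_add(2)[OF Y_add(1)[OF wY T_Y[OF gd]] s_Y]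
          by (smt (verit))
        also have "\<dots> \<le> N * (1 / 2) ^ k + KT * normY p (g k - u) + (\<Sum>b\<in>B. cmod (\<gamma> k b - \<beta> b) * normY p b)"
        proof (intro add_mono)
          show "normY p (w k) \<le> N * (1 / 2) ^ k" using w_small by (simp add: N_def)
          show "normY p (T (g k - u)) \<le> KT * normY p (g k - u)" by (rule KT[OF gd])
          have "normY p (s (\<lambda>b. \<gamma> k b - \<beta> b)) \<le> (\<Sum>b\<in>B. normY p (scaleF (\<gamma> k b - \<beta> b) b))"
            unfolding s_def by (intro Y_sum(2) B(1) Y_scaleF(1) BY)
          also have "\<dots> \<le> (\<Sum>b\<in>B. cmod (\<gamma> k b - \<beta> b) * normY p b)" by (intro sum_mono Y_scaleF(2) BY)
          finally show "normY p (s (\<lambda>b. \<gamma> k b - \<beta> b)) \<le> (\<Sum>b\<in>B. cmod (\<gamma> k b - \<beta> b) * normY p b)" .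
        qed
        finally show ?thesis .
      qed
      moreover have "(\<lambda>k. N * (1 / 2) ^ k + KT * normY p (g k - u) + (\<Sum>b\<in>B. cmod (\<gamma> k b - \<beta> b) * normY p b))
          \<longlonglongrightarrow> N * 0 + KT * 0 + (\<Sum>b\<in>B. cmod (\<beta> b - \<beta> b) * normY p b)"
        by (intro tendsto_add tendsto_mult tendsto_const tendsto_sum tendsto_norm tendsto_diff g_lim \<beta> LIMSEQ_power_zero) auto
      ultimately have "normY p (y - (T u + s \<beta>)) \<le> N * 0 + KT * 0 + (\<Sum>b\<in>B. cmod (\<beta> b - \<beta> b) * normY p b)"
        by (intro tendsto_lowerbound) auto
      then show "normY p (y - (T u + s \<beta>)) = 0" using normY_nonneg[OF Yd] by simp
    qed
    ultimately show ?thesis using u(1) unfolding N_def by auto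
  qed
  show ?thesis
  proof (intro exI[of _ "2 * K0"] conjI ballI)
    show "0 \<le> 2 * K0" using K0 by simp
    fix x :: "int ^ 'n \<Rightarrow> 'u" assume x: "x \<in> Y p"
    obtain u \<beta> where u: "u \<in> Y p" "normY p u \<le> 2 * K0 * normY p (T x)" "T x = T u + s \<beta>"
      using main[OF T_Y[OF x]] by blast
    have "s \<beta> = T (x - u)" using u T_diff[OF x u(1)] by simp
    then have "s \<beta> \<in> R" unfolding R_def using Y_diff(1)[OF x u(1)] by blast
    then have "T u = T x" using transversal u(3) by simp
    then show "\<exists>u\<in>Y p. T u = T x \<and> normY p u \<le> 2 * K0 * normY p (T x)" using u by blast
  qed
qed

end

section \<open>Pseudo-ergodicity\<close>

text \<open>A family that repeats a vector is dependent without its range being so, whence the two cases.\<close>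

lemma linear_dependence_of_many:
  fixes w :: "nat \<Rightarrow> 'i \<Rightarrow> 'u::complex_normed_vector"
  assumes E: "finite E" "card E < M" and w: "\<And>i. i < M \<Longrightarrow> w i \<in> cfun.span E"
  shows "\<exists>\<alpha>. (\<exists>i<M. \<alpha> i \<noteq> 0) \<and> (\<Sum>i<M. scaleF (\<alpha> i) (w i)) = 0"
proof (cases "inj_on w {..<M}")
  case True
  have "card (w ` {..<M}) = M" using card_image[OF True] by simp
  then have "cfun.dependent (w ` {..<M})"
    using cfun.independent_span_bound[OF E(1), of "w ` {..<M}"] w E(2) by auto
  then obtain u v where uv: "v \<in> w ` {..<M}" "u v \<noteq> 0" "(\<Sum>v\<in>w ` {..<M}. scaleF (u v) v) = 0"
    using cfun.dependent_finite[of "w ` {..<M}"] by auto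
  have "(\<Sum>i<M. scaleF (u (w i)) (w i)) = 0" using uv(3) sum.reindex[OF True, of "\<lambda>v. scaleF (u v) v"] by simp
  then show ?thesis using uv(1,2) by (intro exI[of _ "\<lambda>i. u (w i)"]) auto
next
  case False
  then obtain i j where ij: "i < M" "j < M" "i \<noteq> j" "w i = w j" by (auto simp: inj_on_def)
  define \<alpha> :: "nat \<Rightarrow> complex" where "\<alpha> k = (if k = i then 1 else if k = j then - 1 else 0)" for k
  have "(\<Sum>k<M. scaleF (\<alpha> k) (w k)) = (\<Sum>k\<in>{i, j}. scaleF (\<alpha> k) (w k))"
    using ij by (intro sum.mono_neutral_right) (auto simp: \<alpha>_def)
  also have "\<dots> = 0" using ij by (simp add: \<alpha>_def)
  finally have "(\<Sum>k<M. scaleF (\<alpha> k) (w k)) = 0" .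
  moreover have "\<exists>k<M. \<alpha> k \<noteq> 0" using ij(1) by (intro exI[of _ i]) (simp add: \<alpha>_def)
  ultimately show ?thesis by blast
qed

text \<open>Each \<open>x i\<close> differs by a vector of the kernel from some \<open>u i\<close> with norm controlled by \<open>T (x i)\<close>. If there
  are more vectors than the dimension of the kernel, the differences are linearly dependent, and the
  corresponding combination of the \<open>x i\<close> is the same combination of the \<open>u i\<close>.\<close>

lemma (in exponent) fredholm_combination_bound:
  fixes T :: "('n::finite, 'u::{complex_normed_vector,banach}) seq_op"
  assumes T: "fredholm_op p T"
  shows "\<exists>K\<ge>0. \<exists>M>0. \<forall>x :: nat \<Rightarrow> int ^ 'n \<Rightarrow> 'u. (\<forall>i<M. x i \<in> Y p) \<longrightarrow>
      (\<exists>\<alpha>. (\<exists>i<M. \<alpha> i \<noteq> 0) \<and>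
        normY p (\<Sum>i<M. scaleF (\<alpha> i) (x i)) \<le> (\<Sum>i<M. cmod (\<alpha> i) * (K * normY p (T (x i)))))"
proof -
  obtain E where E: "finite E" "cfun.span E = {x \<in> Y p. T x = 0}" using T by (auto simp: fredholm_op_def)
  obtain K where K: "K \<ge> 0" "\<And>x. x \<in> Y p \<Longrightarrow> \<exists>u\<in>Y p. T u = T x \<and> normY p u \<le> K * normY p (T x)"
    using fredholm_bounded_below[OF T] by blast
  have T_add: "T (x + y) = T x + T y" if "x \<in> Y p" "y \<in> Y p" for x y
    using T that by (auto simp: fredholm_op_def bounded_op_def)
  let ?M = "Suc (card E)"
  show ?thesis
  proof (intro exI[of _ K] conjI exI[of _ ?M] K(1) allI impI)
    fix x :: "nat \<Rightarrow> int ^ 'n \<Rightarrow> 'u" assume *: "\<forall>i<?M. x i \<in> Y p"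
    then have x: "x i \<in> Y p" if "i < ?M" for i using that by blast
    have "\<forall>i\<in>{..<?M}. \<exists>u. u \<in> Y p \<and> T u = T (x i) \<and> normY p u \<le> K * normY p (T (x i))"
      using K(2) x by blast
    from bchoice[OF this] obtain u
      where u: "\<And>i. i < ?M \<Longrightarrow> u i \<in> Y p \<and> T (u i) = T (x i) \<and> normY p (u i) \<le> K * normY p (T (x i))"
      by blast
    have ker: "x i - u i \<in> cfun.span E" if i: "i < ?M" for i
    proof -
      have d: "x i - u i \<in> Y p" using x[OF i] u[OF i] by (intro Y_diff(1)) auto
      have "T (x i) = T (x i - u i) + T (u i)" using T_add[OF d, of "u i"] u[OF i] by simp
      then show ?thesis using E(2) d u[OF i] by simp
    qed
    have "\<exists>\<alpha>. (\<exists>i<?M. \<alpha> i \<noteq> 0) \<and> (\<Sum>i<?M. scaleF (\<alpha> i) (x i - u i)) = 0"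
      by (rule linear_dependence_of_many[OF E(1) lessI]) (rule ker)
    then obtain \<alpha> where \<alpha>: "\<exists>i<?M. \<alpha> i \<noteq> 0" "(\<Sum>i<?M. scaleF (\<alpha> i) (x i - u i)) = 0"
      by (rule exE, elim conjE) (rule that)
    have eq: "(\<Sum>i<?M. scaleF (\<alpha> i) (x i)) = (\<Sum>i<?M. scaleF (\<alpha> i) (u i))"
      using \<alpha>(2) by (simp only: cfun.scale_right_diff_distrib sum_subtractf right_minus_eq)
    have "normY p (\<Sum>i<?M. scaleF (\<alpha> i) (x i)) \<le> (\<Sum>i<?M. normY p (scaleF (\<alpha> i) (u i)))"
      unfolding eq using u by (intro Y_sum(2) Y_scaleF(1)) auto
    also have "\<dots> \<le> (\<Sum>i<?M. cmod (\<alpha> i) * (K * normY p (T (x i))))"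
    proof (rule sum_mono)
      fix i assume i: "i \<in> {..<?M}"
      have "normY p (scaleF (\<alpha> i) (u i)) \<le> cmod (\<alpha> i) * normY p (u i)" using u i by (intro Y_scaleF(2)) auto
      also have "\<dots> \<le> cmod (\<alpha> i) * (K * normY p (T (x i)))" using u i by (intro mult_left_mono) auto
      finally show "normY p (scaleF (\<alpha> i) (u i)) \<le> cmod (\<alpha> i) * (K * normY p (T (x i)))" .
    qed
    finally show "\<exists>\<alpha>. (\<exists>i<?M. \<alpha> i \<noteq> 0) \<and>
        normY p (\<Sum>i<?M. scaleF (\<alpha> i) (x i)) \<le> (\<Sum>i<?M. cmod (\<alpha> i) * (K * normY p (T (x i))))"
      using \<alpha>(1) by blast
  qed simp
qed

text \<open>One application of pseudo-ergodicity, to the pattern that repeats \<open>c\<close> on \<open>M\<close> disjoint translates of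
  \<open>S\<close>, yields all copies at the same time.\<close>

lemma pseudo_ergodic_disjoint_copies:
  fixes b c :: "int ^ 'n::finite \<Rightarrow> 'u::complex_normed_vector \<Rightarrow>\<^sub>L 'u"
  assumes pe: "pseudo_ergodic b" and c: "range c \<subseteq> closure (range b)" and S: "finite S" and \<epsilon>: "\<epsilon> > 0"
  obtains t :: "nat \<Rightarrow> int ^ 'n" where
    "\<And>i s. i < M \<Longrightarrow> s \<in> S \<Longrightarrow> norm (c s - b (s + t i)) < \<epsilon>"
    "\<And>i j s. s \<in> S \<Longrightarrow> s + t i - t j \<in> S \<Longrightarrow> i = j"
proof -
  obtain r where r: "\<And>s. s \<in> S \<Longrightarrow> csize s \<le> int r"
  proof
    fix s assume "s \<in> S"
    then have "nat (csize s) \<le> Max (insert 0 ((\<lambda>s. nat (csize s)) ` S))" using S by (intro Max_ge) auto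
    then show "csize s \<le> int (Max (insert 0 ((\<lambda>s. nat (csize s)) ` S)))" by linarith
  qed
  \<comment> \<open>The shifts are multiples of \<open>2 r + 1\<close>, more than the diameter of the cube that contains \<open>S\<close>.\<close>
  define v :: "nat \<Rightarrow> int ^ 'n" where "v i = (\<chi> _. int i * (2 * int r + 1))" for i
  have disj: "i = j" if s: "s \<in> S" "s + v i - v j \<in> S" for i j s
  proof (rule ccontr)
    assume "i \<noteq> j"
    fix k :: 'n
    have "\<bar>s $ k\<bar> \<le> int r" "\<bar>(s + v i - v j) $ k\<bar> \<le> int r"
      using r s abs_nth_le_csize order_trans by blast+
    then have "\<bar>(int i - int j) * (2 * int r + 1)\<bar> \<le> 2 * int r" by (simp add: v_def left_diff_distrib)
    then have "\<bar>int i - int j\<bar> * (2 * int r + 1) \<le> 2 * int r" by (simp add: abs_mult)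
    moreover have "1 * (2 * int r + 1) \<le> \<bar>int i - int j\<bar> * (2 * int r + 1)"
      using \<open>i \<noteq> j\<close> by (intro mult_right_mono) auto
    ultimately have "1 * (2 * int r + 1) \<le> 2 * int r" by (rule order_trans[rotated])
    then show False by simp
  qed
  define S' where "S' = (\<lambda>(s, i). s + v i) ` (S \<times> {..<M})"
  define f where "f x = c (x - v (SOME i. x - v i \<in> S))" for x
  have f: "f (s + v i) = c s" if s: "s \<in> S" for s i
  proof -
    have "s + v i - v (SOME j. s + v i - v j \<in> S) \<in> S"
      by (rule someI[of "\<lambda>j. s + v i - v j \<in> S" i]) (use s in simp)
    from disj[OF s this] show ?thesis by (simp add: f_def)
  qed
  have fin: "finite S'" unfolding S'_def using S by auto
  have f_\<Sigma>: "f \<in> S' \<rightarrow> closure (range b)" using c by (auto simp: f_def)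
  obtain z where z: "\<forall>x\<in>S'. norm (f x - b (z + x)) < \<epsilon>"
    using pe[unfolded pseudo_ergodic_def, rule_format, OF \<epsilon> fin f_\<Sigma>] by (rule exE)
  show thesis
  proof (rule that[of "\<lambda>i. z + v i"])
    fix i s assume "i < M" "s \<in> S"
    then have "s + v i \<in> S'" by (auto simp: S'_def)
    from z[rule_format, OF this] f[OF \<open>s \<in> S\<close>, of i] show "norm (c s - b (s + (z + v i))) < \<epsilon>" by (simp add: ac_simps)
  next
    fix i j s assume "s \<in> S" "s + (z + v i) - (z + v j) \<in> S"
    then show "i = j" by (intro disj[of s]) (simp_all add: algebra_simps)
  qed
qed

lemma matop_pencil_perturb:
  fixes \<Lambda> c c' :: "int ^ 'n::finite \<Rightarrow> 'u::{complex_normed_vector,banach} \<Rightarrow>\<^sub>L 'u"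
  assumes \<Lambda>: "(\<lambda>k. norm (\<Lambda> k)) summable_on UNIV" and x: "\<And>m. norm (x m) \<le> R"
  shows "matop (pencil \<Lambda> \<mu> c') x i = matop (pencil \<Lambda> \<mu> c) x i + blinfun_apply (c i - c' i) (x i)"
  unfolding resolvent_eq_matop[OF \<Lambda> x, symmetric]
  by (simp add: mult_op_def blinfun.diff_left)

text \<open>Let \<open>X i\<close> be the translates of \<open>x\<close> to the places where \<open>b\<close> imitates \<open>c\<close> up to \<open>\<epsilon>\<close>. Then the norm of
  \<open>T (X i)\<close> exceeds that of \<open>y = T\<^sub>c x\<close> by at most \<open>\<epsilon>\<close> times the norm of \<open>x\<close>. In the combination of the \<open>X i\<close> with
  controlled norm, the summand with the largest coefficient can be compared with \<open>x\<close>, as the supports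
  are disjoint.\<close>

theorem (in exponent) fredholm_imp_lower_bound:
  fixes \<Lambda> b :: "int ^ 'n::finite \<Rightarrow> 'u::{complex_normed_vector,banach} \<Rightarrow>\<^sub>L 'u"
  assumes \<Lambda>: "(\<lambda>k. norm (\<Lambda> k)) summable_on UNIV" and b: "bounded (range b)" and pe: "pseudo_ergodic b"
    and fred: "fredholm_op p (scaleF \<mu> - (laurent \<Lambda> + mult_op b))"
  shows "\<exists>C>0. \<forall>c x. range c \<subseteq> closure (range b) \<longrightarrow> finite {m. x m \<noteq> 0} \<longrightarrow>
    normY p x \<le> C * normY p (matop (pencil \<Lambda> \<mu> c) x)"
proof -
  define T where "T = scaleF \<mu> - (laurent \<Lambda> + mult_op b)"
  obtain K M where K: "K \<ge> 0" and M: "M > 0" and comb: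
    "\<And>x :: nat \<Rightarrow> int ^ 'n \<Rightarrow> 'u. (\<And>i. i < M \<Longrightarrow> x i \<in> Y p) \<Longrightarrow>
      \<exists>\<alpha>. (\<exists>i<M. \<alpha> i \<noteq> 0) \<and>
        normY p (\<Sum>i<M. scaleF (\<alpha> i) (x i)) \<le> (\<Sum>i<M. cmod (\<alpha> i) * (K * normY p (T (x i))))"
    using fredholm_combination_bound[OF fred, folded T_def] by auto
  \<comment> \<open>Small enough for the error \<open>K M \<epsilon>\<close> to be at most \<open>1 / 2\<close>.\<close>
  define \<epsilon> where "\<epsilon> = 1 / (2 * (K * real M + 1))"
  have KM: "K * real M \<ge> 0" using K by simp
  have \<epsilon>: "\<epsilon> > 0" using KM by (simp add: \<epsilon>_def)
  have "normY p x \<le> (2 * K * real M + 1) * normY p (matop (pencil \<Lambda> \<mu> c) x)"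
    if c: "range c \<subseteq> closure (range b)" and fin: "finite {m. x m \<noteq> 0}" and Kx: "matop (pencil \<Lambda> \<mu> c) x \<in> Y p" for c x
  proof -
    define S where "S = {m. x m \<noteq> 0}"
    define y where "y = matop (pencil \<Lambda> \<mu> c) x"
    have xY: "x \<in> Y p" using ballY_finite_support[OF fin] .
    have xR: "norm (x m) \<le> normY p x" for m using ballY_coord[OF ballY_normY[OF xY]] .
    obtain t where t: "\<And>i s. i < M \<Longrightarrow> s \<in> S \<Longrightarrow> norm (c s - b (s + t i)) < \<epsilon>"
      and disj: "\<And>i j s. s \<in> S \<Longrightarrow> s + t i - t j \<in> S \<Longrightarrow> i = j"
      using pseudo_ergodic_disjoint_copies[OF pe c fin \<epsilon>] unfolding S_def by metis
    define X where "X i k = x (k - t i)" for i k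
    have XY: "X i \<in> Y p" for i
      using ballY_translate[OF ballY_normY[OF xY], of "- t i"] by (simp add: X_def[abs_def] ballY_def)
    have TX: "normY p (T (X i)) \<le> normY p y + \<epsilon> * normY p x" if i: "i < M" for i
    proof -
      have eq: "T (X i) = (\<lambda>k. matop (pencil \<Lambda> \<mu> (\<lambda>m. b (m + t i))) x (k - t i))"
      proof
        fix k
        have "matop (pencil \<Lambda> \<mu> b) (X i) k = matop (pencil \<Lambda> \<mu> (\<lambda>m. b (m + t i))) x (k - t i)"
          using matop_translate[of \<Lambda> \<mu> b "t i" "X i" "k - t i"] by (simp add: X_def)
        then show "T (X i) k = matop (pencil \<Lambda> \<mu> (\<lambda>m. b (m + t i))) x (k - t i)"
          unfolding T_def using resolvent_eq_matop[OF \<Lambda>, of "X i" "normY p x" \<mu> b] xR by (simp add: X_def)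
      qed
      have "(\<lambda>k. \<epsilon> *\<^sub>R x k) \<in> ballY p (\<epsilon> * normY p x)"
        using \<epsilon> by (intro ballY_scaleR[OF ballY_normY[OF xY]]) auto
      then have "matop (pencil \<Lambda> \<mu> (\<lambda>m. b (m + t i))) x \<in> ballY p (normY p y + \<epsilon> * normY p x)"
      proof (rule ballY_add[OF ballY_normY[OF Kx[folded y_def]]])
        fix k
        have "norm (blinfun_apply (c k - b (k + t i)) (x k)) \<le> \<epsilon> * norm (x k)"
        proof (cases "k \<in> S")
          case True
          then show ?thesis
            using t[OF i True] norm_blinfun[of "c k - b (k + t i)" "x k"]
            by (meson less_imp_le mult_right_mono norm_ge_zero order_trans)
        qed (simp add: S_def)
        then show "norm (matop (pencil \<Lambda> \<mu> (\<lambda>m. b (m + t i))) x k) \<le> norm (y k) + norm (\<epsilon> *\<^sub>R x k)"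
          unfolding matop_pencil_perturb[OF \<Lambda> xR, where c = c and c' = "\<lambda>m. b (m + t i)"] y_def
          using \<epsilon> by (intro order_trans[OF norm_triangle_ineq] add_mono) auto
      qed
      from ballY_translate[OF this, of "- t i"] show ?thesis by (simp add: eq ballY_def)
    qed
    obtain \<alpha> where \<alpha>: "\<exists>i<M. \<alpha> i \<noteq> 0"
      "normY p (\<Sum>i<M. scaleF (\<alpha> i) (X i)) \<le> (\<Sum>i<M. cmod (\<alpha> i) * (K * normY p (T (X i))))"
      using comb[of X] XY by blast
    have "Max ((\<lambda>i. cmod (\<alpha> i)) ` {..<M}) \<in> (\<lambda>i. cmod (\<alpha> i)) ` {..<M}" using M by (intro Max_in) auto
    then obtain i0 where i0: "i0 < M" "cmod (\<alpha> i0) = Max ((\<lambda>i. cmod (\<alpha> i)) ` {..<M})" by auto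
    have max: "cmod (\<alpha> i) \<le> cmod (\<alpha> i0)" if "i < M" for i using that unfolding i0(2) by (intro Max_ge) auto
    obtain i1 where "i1 < M" "\<alpha> i1 \<noteq> 0" using \<alpha>(1) by blast
    with max[of i1] have pos: "cmod (\<alpha> i0) > 0" by (smt (verit) zero_less_norm_iff)
    have sY: "(\<Sum>i<M. scaleF (\<alpha> i) (X i)) \<in> Y p" using XY by (intro Y_sum(1) Y_scaleF(1)) auto
    have "x \<in> ballY p ((1 / cmod (\<alpha> i0)) * normY p (\<Sum>i<M. scaleF (\<alpha> i) (X i)))"
    proof (rule ballY_scaleR[OF ballY_translate[OF ballY_normY[OF sY], of "t i0"]])
      fix k
      show "norm (x k) \<le> 1 / cmod (\<alpha> i0) * norm ((\<Sum>i<M. scaleF (\<alpha> i) (X i)) (k + t i0))"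
      proof (cases "k \<in> S")
        case True
        have "(\<Sum>i<M. scaleF (\<alpha> i) (X i)) (k + t i0) = (\<Sum>i<M. \<alpha> i *\<^sub>C x (k + t i0 - t i))"
          by (simp add: sum_fun_apply scaleF_def X_def)
        also have "\<dots> = (\<Sum>i\<in>{i0}. \<alpha> i *\<^sub>C x (k + t i0 - t i))"
        proof (rule sum.mono_neutral_right)
          show "\<forall>i\<in>{..<M} - {i0}. \<alpha> i *\<^sub>C x (k + t i0 - t i) = 0"
            using disj[OF True, of i0] by (auto simp: S_def)
        qed (use i0 in auto)
        finally show ?thesis using pos by (simp add: norm_scaleC)
      qed (simp add: S_def)
    qed simp
    then have "cmod (\<alpha> i0) * normY p x \<le> normY p (\<Sum>i<M. scaleF (\<alpha> i) (X i))"
      using pos by (simp add: ballY_def field_simps)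
    also note \<alpha>(2)
    also have "(\<Sum>i<M. cmod (\<alpha> i) * (K * normY p (T (X i)))) \<le> (\<Sum>i<M. cmod (\<alpha> i0) * (K * (normY p y + \<epsilon> * normY p x)))"
    proof (rule sum_mono)
      fix i assume i: "i \<in> {..<M}"
      have "T (X i) \<in> Y p" using fred XY unfolding fredholm_op_def bounded_op_def T_def by blast
      then have "0 \<le> normY p (T (X i))" by (rule normY_nonneg)
      then show "cmod (\<alpha> i) * (K * normY p (T (X i))) \<le> cmod (\<alpha> i0) * (K * (normY p y + \<epsilon> * normY p x))"
        using i K max TX by (intro mult_mono) auto
    qed
    also have "\<dots> = cmod (\<alpha> i0) * (K * real M * (normY p y + \<epsilon> * normY p x))" by simp
    finally have "normY p x \<le> K * real M * (normY p y + \<epsilon> * normY p x)" using pos by simp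
    also have "\<dots> = K * real M * normY p y + (K * real M * \<epsilon>) * normY p x" by (simp add: algebra_simps)
    also have "\<dots> \<le> K * real M * normY p y + 1 / 2 * normY p x"
    proof (intro add_left_mono mult_right_mono normY_nonneg[OF xY])
      show "K * real M * \<epsilon> \<le> 1 / 2" using KM by (simp add: \<epsilon>_def field_simps)
    qed
    finally have "normY p x \<le> 2 * K * real M * normY p y" by simp
    also have "\<dots> \<le> (2 * K * real M + 1) * normY p y"
      using normY_nonneg[OF Kx] by (simp add: y_def distrib_right)
    finally show ?thesis by (simp add: y_def)
  qed
  moreover have "matop (pencil \<Lambda> \<mu> c) x \<in> Y p" if "range c \<subseteq> closure (range b)" "finite {m. x m \<noteq> 0}" for c x
  proof -
    obtain S where S: "\<And>v. v \<in> closure (range b) \<Longrightarrow> norm v \<le> S"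
      using bounded_closure[OF b] unfolding bounded_iff by blast
    obtain a where "\<And>c. (\<And>m. norm (c m) \<le> S) \<Longrightarrow> conv_dominated a (pencil \<Lambda> \<mu> c)"
      using pencil_dominated[OF \<Lambda>] by blast
    then have "conv_dominated a (pencil \<Lambda> \<mu> c)" using S that(1) by blast
    from matop_ballY[OF this ballY_normY[OF ballY_finite_support[OF that(2)]]] show ?thesis
      by (simp add: ballY_def)
  qed
  ultimately show ?thesis using KM by (intro exI[of _ "2 * K * real M + 1"]) auto
qed

section \<open>Invertibility and spectra\<close>

text \<open>Localization of the lower bound from the exponent \<open>p\<close> to \<open>\<infinity>\<close>, for the right-hand side \<open>0\<close>.\<close>

lemma (in exponent) fredholm_imp_injective:
  fixes \<Lambda> b c :: "int ^ 'n::finite \<Rightarrow> 'u::{complex_normed_vector,banach} \<Rightarrow>\<^sub>L 'u"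
  assumes \<Lambda>: "(\<lambda>k. norm (\<Lambda> k)) summable_on UNIV" and b: "bounded (range b)" and pe: "pseudo_ergodic b"
    and fred: "fredholm_op p (scaleF \<mu> - (laurent \<Lambda> + mult_op b))"
    and c: "range c \<subseteq> closure (range b)" and x: "\<And>m. norm (x m) \<le> B"
    and eq: "matop (pencil \<Lambda> \<mu> c) x = (\<lambda>_. 0)"
  shows "x = (\<lambda>_. 0)"
proof -
  obtain C where C: "C > 0" "\<And>x. finite {m. x m \<noteq> 0} \<Longrightarrow> normY p x \<le> C * normY p (matop (pencil \<Lambda> \<mu> c) x)"
    using fredholm_imp_lower_bound[OF \<Lambda> b pe fred] c by blast
  obtain S where S: "\<And>v. v \<in> closure (range b) \<Longrightarrow> norm v \<le> S"
    using bounded_closure[OF b] unfolding bounded_iff by blast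
  obtain a where a: "\<And>c. (\<And>m. norm (c m) \<le> S) \<Longrightarrow> conv_dominated a (pencil \<Lambda> \<mu> c)"
    using pencil_dominated[OF \<Lambda>] by blast
  have K: "conv_dominated a (pencil \<Lambda> \<mu> c)" using a S c by blast
  from localization[OF K C]
  obtain k where k: "\<forall>q x B R. exponent q \<longrightarrow> (\<forall>m. norm (x m) \<le> B) \<longrightarrow>
    matop (pencil \<Lambda> \<mu> c) x \<in> ballY q R \<longrightarrow> x \<in> ballY q (k * R)" by (rule exE)
  have "x \<in> ballY \<infinity> (k * 0)"
    using k[rule_format, of \<infinity> x B 0] x by (auto simp: exponent_def eq ballY_infinity)
  then show ?thesis by (auto simp: ballY_infinity)
qed

lemma (in exponent) bounded_resolvent:
  fixes \<Lambda> c :: "int ^ 'n::finite \<Rightarrow> 'u::{complex_normed_vector,banach} \<Rightarrow>\<^sub>L 'u"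
  assumes \<Lambda>: "(\<lambda>k. norm (\<Lambda> k)) summable_on UNIV" "range \<Lambda> \<subseteq> clin_ops"
    and K: "conv_dominated a (pencil \<Lambda> \<mu> c)" and c: "range c \<subseteq> clin_ops"
  shows "bounded_op p (scaleF \<mu> - (laurent \<Lambda> + mult_op c))"
proof -
  define T where "T = scaleF \<mu> - (laurent \<Lambda> + mult_op c)"
  have coord: "norm (x m) \<le> normY p x" if "x \<in> Y p" for x :: "int ^ 'n \<Rightarrow> 'u" and m
    using ballY_coord[OF ballY_normY[OF that]] .
  have T: "T x = matop (pencil \<Lambda> \<mu> c) x" if "x \<in> Y p" for x
    unfolding T_def by (rule resolvent_eq_matop[OF \<Lambda>(1) coord[OF that]])
  have ball: "T x \<in> ballY p (infsum a UNIV * normY p x)" if "x \<in> Y p" for x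
    unfolding T[OF that] by (rule matop_ballY[OF K ballY_normY[OF that]])
  have add: "T (x + y) = T x + T y" if "x \<in> Y p" "y \<in> Y p" for x y
  proof
    fix i
    have "T (x + y) i = matop (pencil \<Lambda> \<mu> c) (\<lambda>m. x m + y m) i"
      using T[OF Y_add(1)[OF that]] by (simp add: plus_fun_def)
    also have "\<dots> = matop (pencil \<Lambda> \<mu> c) x i + matop (pencil \<Lambda> \<mu> c) y i"
      using matop_add[OF K, of x "normY p x" y "normY p y" i] coord that by blast
    finally show "T (x + y) i = (T x + T y) i" using T that by simp
  qed
  have scale: "T (scaleF r x) = scaleF r (T x)" if "x \<in> Y p" for r x
    using matop_scaleC[OF K pencil_clin_ops[OF \<Lambda>(2) c] coord[OF that]] that by (simp add: T Y_scaleF(1))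
  show ?thesis
    unfolding bounded_op_def T_def[symmetric]
  proof (intro conjI ballI allI exI[of _ "infsum a UNIV"])
    show "T ` Y p \<subseteq> Y p" using ball by (auto simp: ballY_def)
  qed (use ball add scale in \<open>auto simp: ballY_def\<close>)
qed

lemma (in exponent) invertible_imp_fredholm:
  fixes T :: "('n::finite, 'u::{complex_normed_vector,banach}) seq_op"
  assumes "invertible_op p T"
  shows "fredholm_op p T"
proof -
  have T: "bounded_op p T" using assms by (simp add: invertible_op_def)
  obtain B where B: "bounded_op p B" "\<And>x. x \<in> Y p \<Longrightarrow> B (T x) = x" "\<And>x. x \<in> Y p \<Longrightarrow> T (B x) = x"
    using assms unfolding invertible_op_def by blast
  have zero: "S 0 = 0" if "bounded_op p S" for S :: "('n, 'u) seq_op"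
  proof -
    have "S (scaleF 0 0) = scaleF 0 (S 0)" using that zero_in_Y unfolding bounded_op_def by blast
    then show ?thesis by simp
  qed
  have ker: "{x \<in> Y p. T x = 0} = {0}"
  proof (intro equalityI subsetI)
    fix x assume "x \<in> {x \<in> Y p. T x = 0}"
    then have "x = B 0" using B(2)[of x] by simp
    then show "x \<in> {0}" using zero[OF B(1)] by simp
  qed (use zero[OF T] zero_in_Y in auto)
  have surj: "T ` Y p = Y p"
  proof (intro equalityI subsetI)
    fix y :: "int ^ 'n \<Rightarrow> 'u" assume y: "y \<in> Y p"
    then have "B y \<in> Y p" using B(1) by (auto simp: bounded_op_def)
    then show "y \<in> T ` Y p" using B(3)[OF y] by (metis imageI)
  qed (use T in \<open>auto simp: bounded_op_def\<close>)
  have "cfun.span {} = {x \<in> Y p. T x = 0}" unfolding ker by (rule cfun.span_empty)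
  moreover have "cfun.span (T ` Y p \<union> {}) = Y p"
    unfolding surj Un_empty_right cfun.span_eq_iff by (rule subspace_Y)
  ultimately show ?thesis unfolding fredholm_op_def using T by (meson finite.emptyI)
qed

text \<open>On \<open>Y \<infinity>\<close> the operator is bounded below and onto. Localization puts the bounded solution of
  \<open>T x = y\<close> with \<open>y\<close> in \<open>Y p\<close> into \<open>Y p\<close> and bounds the inverse there.\<close>

lemma (in exponent) injective_imp_invertible:
  fixes \<Lambda> c :: "int ^ 'n::finite \<Rightarrow> 'u::{complex_normed_vector,banach} \<Rightarrow>\<^sub>L 'u"
  assumes fin_dim: "finite B0" "cvec.span B0 = (UNIV :: 'u set)"
    and \<Lambda>: "(\<lambda>k. norm (\<Lambda> k)) summable_on UNIV" "range \<Lambda> \<subseteq> clin_ops"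
    and \<Sigma>: "closed \<Sigma>" "bounded \<Sigma>" "\<Sigma> \<subseteq> clin_ops"
    and inj: "\<forall>c x R. range c \<subseteq> \<Sigma> \<longrightarrow> (\<forall>m. norm (x m) \<le> R) \<longrightarrow>
      matop (pencil \<Lambda> \<mu> c) x = (\<lambda>_. 0) \<longrightarrow> x = (\<lambda>_. 0)"
    and c: "range c \<subseteq> \<Sigma>"
  shows "invertible_op p (scaleF \<mu> - (laurent \<Lambda> + mult_op c))"
proof -
  define T where "T = scaleF \<mu> - (laurent \<Lambda> + mult_op c)"
  define R0 where "R0 = B0 \<union> (\<lambda>b. \<i> *\<^sub>C b) ` B0"
  have R0: "finite R0" "span R0 = UNIV"
    using fin_dim real_span_of_complex_span[OF fin_dim(2)] by (auto simp: R0_def)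
  have U: "compact (cball (0::'u) r)" for r using compact_cball_span[OF R0(1), of r] R0(2) by simp
  obtain E where E: "finite E" "span E = (UNIV :: ('u \<Rightarrow>\<^sub>L 'u) set)" using finite_span_blinfun[OF R0] by blast
  have cpt: "compact \<Sigma>" by (rule compact_if_finite_span[OF E \<Sigma>(1,2)])
  from uniform_lower_bound[OF \<Lambda>(1) cpt U inj]
  obtain \<kappa> where \<kappa>: "\<kappa> > 0" and below: "\<forall>c x B R. range c \<subseteq> \<Sigma> \<longrightarrow> (\<forall>m. norm (x m) \<le> B) \<longrightarrow>
      (\<forall>m. norm (matop (pencil \<Lambda> \<mu> c) x m) \<le> R) \<longrightarrow> (\<forall>m. norm (x m) \<le> \<kappa> * R)"
    by (elim exE conjE)
  obtain S where S: "\<And>v. v \<in> \<Sigma> \<Longrightarrow> norm v \<le> S" using \<Sigma>(2) unfolding bounded_iff by blast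
  obtain a where a: "\<And>c. (\<And>m. norm (c m) \<le> S) \<Longrightarrow> conv_dominated a (pencil \<Lambda> \<mu> c)"
    using pencil_dominated[OF \<Lambda>(1)] by blast
  have K: "conv_dominated a (pencil \<Lambda> \<mu> c)" using a S c by blast
  interpret inf: exponent \<infinity> by standard simp
  have lower: "normY \<infinity> x \<le> \<kappa> * normY \<infinity> (matop (pencil \<Lambda> \<mu> c) x)" if "finite {m. x m \<noteq> 0}" for x
  proof -
    have x: "x \<in> Y \<infinity>" by (rule inf.ballY_finite_support[OF that])
    have "matop (pencil \<Lambda> \<mu> c) x \<in> Y \<infinity>" using inf.matop_ballY[OF K ballY_normY[OF x]] by (simp add: ballY_def)
    from inf.ballY_coord[OF ballY_normY[OF this]] inf.ballY_coord[OF ballY_normY[OF x]]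
    have "norm (x m) \<le> \<kappa> * normY \<infinity> (matop (pencil \<Lambda> \<mu> c) x)" for m
      using below[rule_format, OF c, of x "normY \<infinity> x" "normY \<infinity> (matop (pencil \<Lambda> \<mu> c) x)" m] by blast
    then have "x \<in> ballY \<infinity> (\<kappa> * normY \<infinity> (matop (pencil \<Lambda> \<mu> c) x))" unfolding ballY_infinity by blast
    then show ?thesis by (simp add: ballY_def)
  qed
  from inf.localization[OF K \<kappa> lower]
  obtain k where k: "\<forall>q x B R. exponent q \<longrightarrow> (\<forall>m. norm (x m) \<le> B) \<longrightarrow>
    matop (pencil \<Lambda> \<mu> c) x \<in> ballY q R \<longrightarrow> x \<in> ballY q (k * R)" by (rule exE)
  have cl: "range c \<subseteq> clin_ops" using c \<Sigma>(3) by blast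
  have T_bounded: "bounded_op p T" unfolding T_def by (rule bounded_resolvent[OF \<Lambda> K cl])
  have coord: "norm (x m) \<le> normY p x" if "x \<in> Y p" for x :: "int ^ 'n \<Rightarrow> 'u" and m
    using ballY_coord[OF ballY_normY[OF that]] .
  have T: "T x = matop (pencil \<Lambda> \<mu> c) x" if "x \<in> Y p" for x
    unfolding T_def by (rule resolvent_eq_matop[OF \<Lambda>(1) coord[OF that]])
  have T_ball: "x \<in> ballY p (k * normY p (T x))" if x: "x \<in> Y p" for x
  proof (rule k[rule_format, OF exponent_axioms coord[OF x]])
    have "T x \<in> Y p" using T_bounded x by (auto simp: bounded_op_def)
    from ballY_normY[OF this] show "matop (pencil \<Lambda> \<mu> c) x \<in> ballY p (normY p (T x))" unfolding T[OF x] .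
  qed
  have T_add: "T (x + y) = T x + T y" if "x \<in> Y p" "y \<in> Y p" for x y
    using T_bounded that by (auto simp: bounded_op_def)
  have T_scale: "T (scaleF r x) = scaleF r (T x)" if "x \<in> Y p" for r x
    using T_bounded that by (auto simp: bounded_op_def)
  have T_inj: "x = y" if xy: "x \<in> Y p" "y \<in> Y p" "T x = T y" for x y
  proof -
    have d: "x - y \<in> Y p" by (rule Y_diff(1)[OF xy(1,2)])
    have "T x = T (x - y) + T y" using T_add[OF d xy(2)] by simp
    then have "T (x - y) = 0" using xy(3) by simp
    then have "matop (pencil \<Lambda> \<mu> c) (x - y) = (\<lambda>_. 0)" using T[OF d] by (simp add: zero_fun_def)
    then have "x - y = (\<lambda>_. 0)" by (rule inj[rule_format, OF c coord[OF d]])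
    then show ?thesis by (simp add: fun_eq_iff)
  qed
  have T_surj: "\<exists>x. x \<in> Y p \<and> T x = y" if y: "y \<in> Y p" for y
  proof -
    obtain x where x: "\<forall>m. norm (x m) \<le> \<kappa> * normY p y" "matop (pencil \<Lambda> \<mu> c) x = y"
      using bounded_below_imp_surj[OF fin_dim \<Lambda> \<Sigma>(2,3) U below c, of y "normY p y"] coord[OF y] by blast
    have "x \<in> ballY p (k * normY p y)"
      by (rule k[rule_format, OF exponent_axioms, where B = "\<kappa> * normY p y"]) (use x ballY_normY[OF y] in auto)
    then have "x \<in> Y p" by (simp add: ballY_def)
    then show ?thesis using T x(2) by blast
  qed
  define G where "G y = (SOME x. x \<in> Y p \<and> T x = y)" for y
  have G: "G y \<in> Y p" "T (G y) = y" if "y \<in> Y p" for y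
    using someI_ex[OF T_surj[OF that]] by (auto simp: G_def)
  have "bounded_op p G"
    unfolding bounded_op_def
  proof (intro conjI ballI allI exI[of _ k])
    show "G ` Y p \<subseteq> Y p" using G by auto
    fix x y :: "int ^ 'n \<Rightarrow> 'u" assume xy: "x \<in> Y p" "y \<in> Y p"
    show "G (x + y) = G x + G y"
    proof (rule T_inj[OF G(1)[OF Y_add(1)[OF xy]] Y_add(1)[OF G(1)[OF xy(1)] G(1)[OF xy(2)]]])
      show "T (G (x + y)) = T (G x + G y)"
        using xy by (simp only: G Y_add(1) T_add)
    qed
  next
    fix r and x :: "int ^ 'n \<Rightarrow> 'u" assume x: "x \<in> Y p"
    show "G (scaleF r x) = scaleF r (G x)"
    proof (rule T_inj[OF G(1)[OF Y_scaleF(1)[OF x]] Y_scaleF(1)[OF G(1)[OF x]]])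
      show "T (G (scaleF r x)) = T (scaleF r (G x))"
        using x by (simp only: G Y_scaleF(1) T_scale)
    qed
  next
    fix x :: "int ^ 'n \<Rightarrow> 'u" assume x: "x \<in> Y p"
    show "normY p (G x) \<le> k * normY p x" using T_ball[OF G(1)[OF x]] G(2)[OF x] by (simp add: ballY_def)
  qed
  moreover have "G (T x) = x \<and> T (G x) = x" if x: "x \<in> Y p" for x
  proof -
    have "T x \<in> Y p" using T_bounded x by (auto simp: bounded_op_def)
    then show ?thesis using G x T_inj by metis
  qed
  ultimately show ?thesis unfolding invertible_op_def T_def[symmetric] using T_bounded by blast
qed

theorem theorem7p6:
  fixes \<Lambda> b :: "int ^ 'n::finite \<Rightarrow> 'u::{complex_normed_vector,banach} \<Rightarrow>\<^sub>L 'u"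
    and L A :: "('n, 'u) seq_op"
    and \<Sigma> :: "('u \<Rightarrow>\<^sub>L 'u) set"
    and p :: ereal
  assumes fin_dim: "\<exists>B::'u set. finite B \<and> cvec.span B = UNIV"
    and \<Lambda>_lin: "range \<Lambda> \<subseteq> clin_ops"
    and wiener: "(\<lambda>k. norm (\<Lambda> k)) summable_on UNIV"
    and L: "L = laurent \<Lambda>"
    and b_lin: "range b \<subseteq> clin_ops"
    and b_bounded: "bounded (range b)"
    and A: "A = L + mult_op b"
    and \<Sigma>: "\<Sigma> = closure (range b)"
    and pe: "pseudo_ergodic b"
    and p: "p = 0 \<or> 1 \<le> p"
  shows "spec_ess p A = spec p A
    \<and> spec p A = (\<Union>c\<in>{c. range c \<subseteq> \<Sigma>}. spec p (L + mult_op c))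
    \<and> (\<Union>c\<in>{c. range c \<subseteq> \<Sigma>}. spec p (L + mult_op c))
        = (\<Union>c\<in>{c. range c \<subseteq> \<Sigma>}. spec_point \<infinity> (L + mult_op c))"
proof -
  interpret exponent p by (rule exponent.intro[OF p])
  obtain B0 :: "'u set" where B0: "finite B0" "cvec.span B0 = UNIV" using fin_dim by blast
  have \<Sigma>': "closed \<Sigma>" "bounded \<Sigma>" "\<Sigma> \<subseteq> clin_ops"
    unfolding \<Sigma> using bounded_closure[OF b_bounded] closure_minimal[OF b_lin closed_clin_ops] by auto
  have b\<Sigma>: "range b \<subseteq> \<Sigma>" unfolding \<Sigma> by (rule closure_subset)
  define I where "I \<mu> c = invertible_op p (scaleF \<mu> - (L + mult_op c))" for \<mu> c
  define F where "F \<mu> = fredholm_op p (scaleF \<mu> - (L + mult_op b))" for \<mu>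
  define J where "J \<mu> = (\<forall>c. range c \<subseteq> \<Sigma> \<longrightarrow> \<mu> \<notin> spec_point \<infinity> (L + mult_op c))" for \<mu>
  have eigen: "\<mu> \<in> spec_point \<infinity> (L + mult_op c) \<longleftrightarrow>
      (\<exists>x R. (\<forall>m. norm (x m) \<le> R) \<and> x \<noteq> (\<lambda>_. 0) \<and> matop (pencil \<Lambda> \<mu> c) x = (\<lambda>_. 0))" for \<mu> c
  proof -
    have "(L + mult_op c) x = scaleF \<mu> x \<longleftrightarrow> matop (pencil \<Lambda> \<mu> c) x = (\<lambda>_. 0)"
      if "\<forall>m. norm (x m) \<le> R" for x R
      using resolvent_eq_matop[OF wiener, of x R \<mu> c] that unfolding L by (auto simp: fun_eq_iff)
    moreover have "x \<in> Y \<infinity> \<longleftrightarrow> (\<exists>R. \<forall>m. norm (x m) \<le> R)" for x :: "int ^ 'n \<Rightarrow> 'u"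
      by (auto simp: Y_def bounded_iff)
    ultimately show ?thesis unfolding spec_point_def zero_fun_def by blast
  qed
  have FJ: "J \<mu>" if "F \<mu>" for \<mu>
    unfolding J_def eigen
    using fredholm_imp_injective[OF wiener b_bounded pe] that unfolding F_def L \<Sigma> by blast
  have JI: "I \<mu> c" if J: "J \<mu>" and c: "range c \<subseteq> \<Sigma>" for \<mu> c
    unfolding I_def L
  proof (rule injective_imp_invertible[OF B0 wiener \<Lambda>_lin \<Sigma>' _ c])
    show "\<forall>c x R. range c \<subseteq> \<Sigma> \<longrightarrow> (\<forall>m. norm (x m) \<le> R) \<longrightarrow>
        matop (pencil \<Lambda> \<mu> c) x = (\<lambda>_. 0) \<longrightarrow> x = (\<lambda>_. 0)"
      using J unfolding J_def eigen by blast
  qed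
  have IF: "F \<mu>" if "I \<mu> b" for \<mu>
    using that unfolding I_def F_def by (rule invertible_imp_fredholm)
  have "spec_ess p A = {\<mu>. \<not> F \<mu>}" unfolding spec_ess_def F_def A by simp
  moreover have "spec p A = {\<mu>. \<not> I \<mu> b}" unfolding spec_def I_def A by simp
  moreover have "(\<Union>c\<in>{c. range c \<subseteq> \<Sigma>}. spec p (L + mult_op c)) = {\<mu>. \<exists>c. range c \<subseteq> \<Sigma> \<and> \<not> I \<mu> c}"
    unfolding spec_def I_def by blast
  moreover have "(\<Union>c\<in>{c. range c \<subseteq> \<Sigma>}. spec_point \<infinity> (L + mult_op c)) = {\<mu>. \<not> J \<mu>}"
    unfolding J_def by blast
  moreover have "F \<mu> \<longleftrightarrow> J \<mu>" "I \<mu> b \<longleftrightarrow> J \<mu>" "(\<exists>c. range c \<subseteq> \<Sigma> \<and> \<not> I \<mu> c) \<longleftrightarrow> \<not> J \<mu>" for \<mu>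
    using FJ[of \<mu>] JI[of \<mu>] IF[of \<mu>] b\<Sigma> by blast+
  ultimately show ?thesis by simp
qed

end
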